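(* Let $d\geq 3$ and let $f_0\in\mathbb{C}[x,y]$ be a homogeneous singularity of degree $d$ (a nonzero homogeneous polynomial of degree $d$ without multiple factors). Then $\mathcal{M}(f_0)$ has the form $$\mathcal{M}(f_0)=\big((d-1)^2,\mu_1,\dots,\mu_r,(d-1)(d-2)+1,(d-1)(d-2),\dots,1,0\big),$$ where $\mu_1,\dots,\mu_r$ is some (possibly empty) strictly decreasing sequence of integers; that is, every integer $k$ with $0\le k\le (d-1)(d-2)+1$ is the generic Milnor number of some deformation of $f_0$.
   Context: For a germ $g$ of a holomorphic function at $0\in\mathbb{C}^2$ with an isolated critical point at $0$ and $g(0)=0$, $\mu(g)=\dim_{\mathbb{C}}\mathbb{C}\{x,y\}/(\partial g/\partial x,\partial g/\partial y)$ is its Milnor number. A deformation of an isolated singularity $f_0$ is a germ of a holomorphic function $f(x,y,s):(\mathbb{C}^2\times\mathbb{C},0)\to(\mathbb{C},0)$ with $f(x,y,0)=f_0(x,y)$ and $f(0,0,s)=0$; write $f_s=f(\cdot,\cdot,s)$. $\mu(f_s)$ is constant for sufficiently small $s\neq0$; this constant is the generic Milnor number $\mu^{\mathrm{gen}}(f_s)$, and $\mu^{\mathrm{gen}}(f_s)\le\mu(f_0)$. $\mathcal{M}(f_0)$ denotes the strictly decreasing sequence of all values $\mu^{\mathrm{gen}}(f_s)$ over all deformations $(f_s)$ of $f_0$; its first term is $\mu(f_0)=(d-1)^2$ and its last term is $0$. *)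

theory Defs
  imports "HOL-Analysis.Analysis" "HOL-Library.Extended_Nat"
begin

text \<open>Germs at the origin of C^2 are represented by functions complex => complex => complex;
  a germ is holomorphic if it is given by a convergent double power series near the point.\<close>

definition analytic2_at :: "complex \<Rightarrow> complex \<Rightarrow> (complex \<Rightarrow> complex \<Rightarrow> complex) \<Rightarrow> bool" where
  "analytic2_at x0 y0 f \<longleftrightarrow> (\<exists>r>0. \<exists>a::nat \<Rightarrow> nat \<Rightarrow> complex. \<forall>x y.
     cmod (x - x0) < r \<longrightarrow> cmod (y - y0) < r \<longrightarrow>
     ((\<lambda>(m,n). a m n * (x - x0)^m * (y - y0)^n) has_sum f x y) UNIV)"

definition analytic3_at0 :: "(complex \<Rightarrow> complex \<Rightarrow> complex \<Rightarrow> complex) \<Rightarrow> bool" where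
  "analytic3_at0 F \<longleftrightarrow> (\<exists>r>0. \<exists>a::nat \<Rightarrow> nat \<Rightarrow> nat \<Rightarrow> complex. \<forall>x y s.
     cmod x < r \<longrightarrow> cmod y < r \<longrightarrow> cmod s < r \<longrightarrow>
     ((\<lambda>(m,n,k). a m n k * x^m * y^n * s^k) has_sum F x y s) UNIV)"

definition near0 :: "(complex \<Rightarrow> complex \<Rightarrow> bool) \<Rightarrow> bool" where
  "near0 P \<longleftrightarrow> (\<exists>r>0. \<forall>x y. cmod x < r \<longrightarrow> cmod y < r \<longrightarrow> P x y)"

definition pdx :: "(complex \<Rightarrow> complex \<Rightarrow> complex) \<Rightarrow> complex \<Rightarrow> complex \<Rightarrow> complex" where
  "pdx f = (\<lambda>x y. deriv (\<lambda>t. f t y) x)"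

definition pdy :: "(complex \<Rightarrow> complex \<Rightarrow> complex) \<Rightarrow> complex \<Rightarrow> complex \<Rightarrow> complex" where
  "pdy f = (\<lambda>x y. deriv (\<lambda>t. f x t) y)"

text \<open>The quotient C{x,y}/(f_x,f_y) is spanned (as a C-vector space) by n germs.\<close>
definition milnor_span :: "(complex \<Rightarrow> complex \<Rightarrow> complex) \<Rightarrow> nat \<Rightarrow> bool" where
  "milnor_span f n \<longleftrightarrow> (\<exists>g :: nat \<Rightarrow> complex \<Rightarrow> complex \<Rightarrow> complex.
     (\<forall>i<n. analytic2_at 0 0 (g i)) \<and>
     (\<forall>h. analytic2_at 0 0 h \<longrightarrow>
        (\<exists>c :: nat \<Rightarrow> complex. \<exists>a b. analytic2_at 0 0 a \<and> analytic2_at 0 0 b \<and>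
           near0 (\<lambda>x y. h x y = (\<Sum>i<n. c i * g i x y) + a x y * pdx f x y + b x y * pdy f x y))))"

definition milnor :: "(complex \<Rightarrow> complex \<Rightarrow> complex) \<Rightarrow> enat" where
  "milnor f = (if \<exists>n. milnor_span f n then enat (LEAST n. milnor_span f n) else \<infinity>)"

definition deformation :: "(complex \<Rightarrow> complex \<Rightarrow> complex) \<Rightarrow> (complex \<Rightarrow> complex \<Rightarrow> complex \<Rightarrow> complex) \<Rightarrow> bool" where
  "deformation f0 F \<longleftrightarrow> analytic3_at0 F \<and> near0 (\<lambda>x y. F x y 0 = f0 x y) \<and>
     (\<exists>r>0. \<forall>s. cmod s < r \<longrightarrow> F 0 0 s = 0)"

definition generic_milnor :: "(complex \<Rightarrow> complex \<Rightarrow> complex \<Rightarrow> complex) \<Rightarrow> enat \<Rightarrow> bool" where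
  "generic_milnor F k \<longleftrightarrow> (\<forall>\<^sub>F s in at 0. milnor (\<lambda>x y. F x y s) = k)"

definition is_poly2 :: "(complex \<Rightarrow> complex \<Rightarrow> complex) \<Rightarrow> bool" where
  "is_poly2 g \<longleftrightarrow> (\<exists>N. \<exists>a :: nat \<Rightarrow> nat \<Rightarrow> complex. \<forall>x y.
      g x y = (\<Sum>i\<le>N. \<Sum>j\<le>N. a i j * x^i * y^j))"

definition homogeneous_singularity :: "nat \<Rightarrow> (complex \<Rightarrow> complex \<Rightarrow> complex) \<Rightarrow> bool" where
  "homogeneous_singularity d f0 \<longleftrightarrow>
     (\<exists>c :: nat \<Rightarrow> complex. (\<exists>i\<le>d. c i \<noteq> 0) \<and>
        (\<forall>x y. f0 x y = (\<Sum>i\<le>d. c i * x^i * y^(d - i)))) \<and>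
     \<not> (\<exists>g h. is_poly2 g \<and> is_poly2 h \<and> \<not> (\<exists>k. \<forall>x y. g x y = k) \<and>
              (\<forall>x y. f0 x y = (g x y)^2 * h x y))"

end

theory Submission
  imports Defs "HOL-Computational_Algebra.Formal_Power_Series"
    "HOL-Computational_Algebra.Fundamental_Theorem_Algebra" "HOL-Library.Function_Algebras"
begin

text \<open>
  The Milnor number is the intersection multiplicity of the two partial derivatives, which is
  additive in each argument. For \<open>f\<^sub>0\<close> itself one partial derivative is a product of lines on none of
  which the other one vanishes. All other values come from \<open>f\<^sub>0 + s P\<close> with \<open>P\<close> a sum of at most
  three monomials, in two kinds of linear coordinates: either \<open>y = 0\<close> is not a line of \<open>f\<^sub>0\<close>, or it
  is, and then \<open>y\<close> also divides \<open>P\<close>. For \<open>k > 0\<close> write \<open>k = (m - 1)\<^sup>2 + t\<close> with \<open>t \<le> 2m - 2\<close> and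
  let \<open>G\<close> be a sum of multiples of \<open>y\<^sup>e\<close>, \<open>x\<^sup>i y\<^sup>j\<close> (absent in the middle two cases), \<open>x\<^sup>n\<close> and other terms of degree at least \<open>n\<close>.
  Then \<open>k\<close> is the Milnor number of
  \<^item> \<open>G\<close> with \<open>e = m\<close>, \<open>j = t + 1\<close>, \<open>i = m - j\<close>, \<open>n = m + 1\<close>, if \<open>t \<le> m - 2\<close>;
  \<^item> \<open>G\<close> with \<open>e = m\<close>, \<open>n = m + 1\<close>, if \<open>t = m - 1\<close>;
  \<^item> \<open>y G\<close> with \<open>e = m - 1\<close>, \<open>n = m\<close>, if \<open>t = m\<close>;
  \<^item> \<open>y G\<close> with \<open>e = m\<close>, \<open>j = t - m\<close>, \<open>i = m - 1 - j\<close>, \<open>n = m + 1\<close>, if \<open>t \<ge> m + 1\<close>.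

  These Milnor numbers are found by eliminating \<open>x\<^sup>i y\<^sup>j\<close> from the two generators of the gradient ideal
  until one starts with a pure power \<open>y\<^sup>e\<close> and the other has order \<open>M\<close> and contains \<open>x\<^sup>M\<close>; two such
  germs meet with multiplicity \<open>e M\<close>.
\<close>

section \<open>Convergent power series in two variables\<close>

unbundle no vec_syntax and fps_syntax

text \<open>Why the values are consecutive: with \<open>n = e + 1\<close>, replacing
  \<open>x^i y^j\<close> by \<open>x^(i-1) y^(j+1)\<close> changes the multiplicity
  \<open>e * (i - 1) + j * n\<close> by \<open>n - e = 1\<close>. The two cases without middle
  monomial are those where it would reach \<open>i = 0\<close> or \<open>j = 0\<close>.

  Why they stop at \<open>(d - 1) * (d - 2) + 1\<close>: the monomial \<open>x^n\<close> can be
  supplied only up to the degree of the form, which is \<open>d\<close> in general coordinates and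
  \<open>d - 1\<close> for the cofactor of y. So the last case needs \<open>m \<le> d - 2\<close>,
  the others \<open>m \<le> d - 1\<close>. The final value has \<open>m = d - 1\<close>,
  \<open>t = m\<close>, and \<open>(d - 2)^2 + (d - 1)\<close> is the bound. At the extreme degrees
  \<open>x^n\<close> comes from \<open>f0\<close> itself: a general line does not divide
  \<open>f0\<close>, and no line divides it twice.

  The relevant coefficients are nonzero for every \<open>s \<noteq> 0\<close>, so each Milnor number
  is computed for a fixed \<open>s\<close> and genericity is immediate.

  The obstacle is additivity of the multiplicity: one generator must not be a zero divisor modulo
  the other. This is drawn from finite colength alone, since powers of both x and y then lie in the
  ideal and x, y are coprime.\<close>

text \<open>The summand 1 in the exponent lets one constant serve as both factor and growth rate in
  the usual bound \<open>C * R ^ (m + n)\<close>. The outer index is the exponent of x, the inner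
  one that of y.\<close>

definition gconv :: "complex fps fps \<Rightarrow> bool" where
  "gconv F \<longleftrightarrow> (\<exists>K\<ge>1. \<forall>m n. cmod (F $ m $ n) \<le> K ^ (m + n + 1))"

lemma gconvI:
  assumes "\<And>m n. cmod (F $ m $ n) \<le> K ^ (m + n + 1)" "K \<ge> 1"
  shows "gconv F"
  using assms by (auto simp: gconv_def)

lemma gconv_finite:
  assumes "finite {(m, n). F $ m $ n \<noteq> 0}"
  shows "gconv F"
proof -
  let ?S = "{(m, n). F $ m $ n \<noteq> 0}"
  define K where "K = 1 + (\<Sum>(m,n)\<in>?S. cmod (F $ m $ n))"
  have K1: "K \<ge> 1" by (auto simp: K_def intro!: sum_nonneg)
  have "cmod (F $ m $ n) \<le> K ^ (m + n + 1)" for m n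
  proof (cases "F $ m $ n = 0")
    case False
    have "cmod (F $ m $ n) = (\<Sum>(m,n)\<in>{(m,n)}. cmod (F $ m $ n))" by simp
    also have "\<dots> \<le> (\<Sum>(m,n)\<in>?S. cmod (F $ m $ n))"
      using False assms by (intro sum_mono2) auto
    also have "\<dots> \<le> K" by (simp add: K_def)
    also have "K ^ 1 \<le> K ^ (m + n + 1)" using K1 by (intro power_increasing) auto
    finally show ?thesis by simp
  qed (use K1 in auto)
  thus ?thesis using K1 by (rule gconvI)
qed

lemma gconv_add:
  assumes "gconv F" "gconv G" shows "gconv (F + G)"
proof -
  from assms obtain K L where K: "K \<ge> 1" "\<And>m n. cmod (F $ m $ n) \<le> K ^ (m + n + 1)"
    and L: "L \<ge> 1" "\<And>m n. cmod (G $ m $ n) \<le> L ^ (m + n + 1)" by (auto simp: gconv_def)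
  have "cmod ((F + G) $ m $ n) \<le> (K + L) ^ (m + n + 1)" for m n
  proof -
    have "cmod ((F + G) $ m $ n) \<le> K ^ (m + n + 1) + L ^ (m + n + 1)"
      using K(2)[of m n] L(2)[of m n] norm_triangle_ineq[of "F $ m $ n" "G $ m $ n"] by simp
    also have "\<dots> = K * K ^ (m + n) + L * L ^ (m + n)" by simp
    also have "\<dots> \<le> K * (K + L) ^ (m + n) + L * (K + L) ^ (m + n)"
      using K(1) L(1) by (intro add_mono mult_left_mono power_mono) auto
    finally show ?thesis by (simp add: algebra_simps)
  qed
  thus ?thesis using K(1) L(1) by (intro gconvI[of _ "K + L"]) auto
qed

lemma gconv_uminus: "gconv F \<Longrightarrow> gconv (- F)"
  by (simp add: gconv_def)

lemma fps2_mult_nth: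
  fixes F G :: "complex fps fps"
  shows "(F * G) $ m $ n = (\<Sum>i\<le>m. \<Sum>j\<le>n. F $ i $ j * G $ (m - i) $ (n - j))"
  by (simp add: fps_mult_nth fps_sum_nth atLeast0AtMost)

text \<open>A coefficient of the product has \<open>(m + 1) * (n + 1)\<close> summands, each at most
  \<open>M ^ (m + n + 2)\<close>. Their number is at most \<open>2 ^ (m + n)\<close>, which leads to
  the constant \<open>2 * M\<^sup>2\<close>.\<close>

lemma gconv_mult:
  assumes "gconv F" "gconv G" shows "gconv (F * G)"
proof -
  from assms obtain K L where K: "K \<ge> 1" "\<And>m n. cmod (F $ m $ n) \<le> K ^ (m + n + 1)"
    and L: "L \<ge> 1" "\<And>m n. cmod (G $ m $ n) \<le> L ^ (m + n + 1)" by (auto simp: gconv_def)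
  define M where "M = max K L"
  have M: "M \<ge> 1" "K \<le> M" "L \<le> M" using K(1) by (auto simp: M_def)
  have "cmod ((F * G) $ m $ n) \<le> (2 * M\<^sup>2) ^ (m + n + 1)" for m n
  proof -
    have "cmod ((F * G) $ m $ n) \<le> (\<Sum>i\<le>m. \<Sum>j\<le>n. M ^ (m + n + 2))"
      unfolding fps2_mult_nth
    proof (intro sum_norm_le)
      fix i j assume ij: "i \<in> {..m}" "j \<in> {..n}"
      have "cmod (F $ i $ j * G $ (m - i) $ (n - j)) \<le> K ^ (i + j + 1) * L ^ (m - i + (n - j) + 1)"
        unfolding norm_mult using K L by (intro mult_mono) auto
      also have "\<dots> \<le> M ^ (i + j + 1) * M ^ (m - i + (n - j) + 1)"
        using K(1) L(1) M by (intro mult_mono power_mono) auto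
      also have "\<dots> = M ^ (m + n + 2)" using ij by (simp flip: power_add)
      finally show "cmod (F $ i $ j * G $ (m - i) $ (n - j)) \<le> M ^ (m + n + 2)" .
    qed
    also have "\<dots> = real ((m + 1) * (n + 1)) * M ^ (m + n + 2)" by (simp add: algebra_simps)
    also have "\<dots> \<le> 2 ^ (m + n + 1) * (M\<^sup>2) ^ (m + n + 1)"
    proof (intro mult_mono)
      have "(m + 1) * (n + 1) \<le> 2 ^ m * 2 ^ n"
        by (intro mult_mono) (auto simp: Suc_leI)
      also have "\<dots> \<le> 2 ^ (m + n + 1)" by (simp add: power_add)
      finally have "real ((m + 1) * (n + 1)) \<le> real (2 ^ (m + n + 1))" unfolding of_nat_le_iff .
      thus "real ((m + 1) * (n + 1)) \<le> 2 ^ (m + n + 1)" by simp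
      have "M ^ (m + n + 2) \<le> M ^ (2 * (m + n + 1))" using M(1) by (intro power_increasing) auto
      thus "M ^ (m + n + 2) \<le> (M\<^sup>2) ^ (m + n + 1)" by (simp only: power_mult)
    qed (use M in auto)
    finally show ?thesis by (simp only: power_mult_distrib)
  qed
  moreover have "2 * M\<^sup>2 \<ge> 1" using M(1) one_le_power[of M 2] by linarith
  ultimately show ?thesis by (rule gconvI)
qed

lemma geometric_sum2_le:
  fixes r :: real
  assumes "0 \<le> r" "r \<le> 1/8"
  shows "(\<Sum>i\<le>m. \<Sum>j\<le>n. r ^ (i + j)) \<le> 1 + 4 * r"
proof -
  have g: "(\<Sum>i\<le>m. r ^ i) \<le> 1 / (1 - r)" for m
  proof -
    have "(\<Sum>i\<le>m. r ^ i) = (1 - r ^ Suc m) / (1 - r)" using assms by (subst sum_gp0) auto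
    also have "\<dots> \<le> 1 / (1 - r)" using assms by (intro divide_right_mono) auto
    finally show ?thesis .
  qed
  have "(\<Sum>i\<le>m. \<Sum>j\<le>n. r ^ (i + j)) = (\<Sum>i\<le>m. r ^ i) * (\<Sum>j\<le>n. r ^ j)"
    by (simp add: sum_product power_add)
  also have "\<dots> \<le> 1 / (1 - r) * (1 / (1 - r))"
    using assms by (intro mult_mono g sum_nonneg) auto
  also have "\<dots> \<le> 1 + 4 * r"
  proof -
    \<comment> \<open>The right-hand side is
      \<open>(1 + 4 * r) * (1 - r)\<^sup>2 - 1\<close>.\<close>
    have "0 \<le> r * (2 - 7 * r + 4 * r\<^sup>2)"
      using assms by (intro mult_nonneg_nonneg) (auto intro: add_nonneg_nonneg)
    hence "1 \<le> (1 + 4 * r) * ((1 - r) * (1 - r))"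
      by (simp add: algebra_simps power2_eq_square)
    moreover have "(1 - r) * (1 - r) > 0" using assms by auto
    ultimately show ?thesis by (simp add: field_simps)
  qed
  finally show ?thesis .
qed

text \<open>The equation \<open>F * G = 1\<close> expresses each coefficient of \<open>G\<close>
  through those of smaller total degree, so a geometric bound propagates by induction.\<close>

lemma gconv_inverse:
  assumes F: "gconv F" and F1: "F $ 0 $ 0 = 1" and inv: "F * G = 1"
  shows "gconv G"
proof -
  from F obtain K where K: "K \<ge> 1" "\<And>m n. cmod (F $ m $ n) \<le> K ^ (m + n + 1)"
    by (auto simp: gconv_def)
  \<comment> \<open>Gives \<open>K / L \<le> 1/8\<close>, as \<open>geometric_sum2_le\<close>
    requires, and \<open>K * (4 * (K / L)) = 1/2\<close>, so that the induction closes.\<close>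
  define L where "L = 8 * K\<^sup>2"
  have L8: "L \<ge> 8 * K" using K(1) by (simp add: L_def power2_eq_square)
  have L: "L \<ge> 1" using K(1) L8 by linarith
  have "cmod (G $ m $ n) \<le> L ^ (m + n)" for m n
  proof (induction "m + n" arbitrary: m n rule: less_induct)
    case less
    let ?t = "\<lambda>i j. F $ i $ j * G $ (m - i) $ (n - j)"
    have split: "(\<Sum>i\<le>m. \<Sum>j\<le>n. h i j) = h 0 0 + (\<Sum>(i,j)\<in>{..m}\<times>{..n} - {(0,0)}. h i j)"
      for h :: "nat \<Rightarrow> nat \<Rightarrow> 'a::comm_monoid_add"
      by (simp add: sum.cartesian_product sum.remove[where x = "(0,0)"])
    have "(if m = 0 \<and> n = 0 then 1 else 0) = (F * G) $ m $ n" using inv by simp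
    also have "\<dots> = G $ m $ n + (\<Sum>(i,j)\<in>{..m}\<times>{..n} - {(0,0)}. ?t i j)"
      unfolding fps2_mult_nth by (subst split) (simp add: F1)
    finally have eq: "G $ m $ n = (if m = 0 \<and> n = 0 then 1 else 0) - (\<Sum>(i,j)\<in>{..m}\<times>{..n} - {(0,0)}. ?t i j)"
      by simp
    show ?case
    proof (cases "m = 0 \<and> n = 0")
      case True
      hence e: "{..m}\<times>{..n} - {(0,0)} = {}" by auto
      show ?thesis using eq True unfolding e by simp
    next
      case False
      have "cmod (G $ m $ n) = cmod (\<Sum>(i,j)\<in>{..m}\<times>{..n} - {(0,0)}. ?t i j)"
        using eq False by auto
      also have "\<dots> \<le> (\<Sum>(i,j)\<in>{..m}\<times>{..n} - {(0,0)}. L ^ (m + n) * (K * (K / L) ^ (i + j)))"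
      proof (rule sum_norm_le)
        fix p assume p: "p \<in> {..m}\<times>{..n} - {(0,0)}"
        obtain i j where pij: "p = (i, j)" by (cases p)
        have ij: "i \<le> m" "j \<le> n" "(i, j) \<noteq> (0, 0)" using p pij by auto
        have "cmod (G $ (m - i) $ (n - j)) \<le> L ^ (m - i + (n - j))"
          using ij by (intro less) auto
        hence "cmod (?t i j) \<le> K ^ (i + j + 1) * L ^ (m - i + (n - j))"
          unfolding norm_mult using K by (intro mult_mono) auto
        also have "L ^ (m - i + (n - j)) = L ^ (m + n) / L ^ (i + j)"
          using ij L by (subst power_diff[symmetric]) (auto intro!: arg_cong[where f = "\<lambda>k. L ^ k"])
        finally show "cmod (case p of (i, j) \<Rightarrow> ?t i j) \<le> (case p of (i, j) \<Rightarrow> L ^ (m + n) * (K * (K / L) ^ (i + j)))"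
          by (simp add: power_divide algebra_simps pij)
      qed
      also have "\<dots> = L ^ (m + n) * (K * (\<Sum>(i,j)\<in>{..m}\<times>{..n} - {(0,0)}. (K / L) ^ (i + j)))"
        by (simp add: sum_distrib_left case_prod_unfold)
      also have "\<dots> \<le> L ^ (m + n) * (K * (4 * (K / L)))"
      proof -
        have "K / L \<le> 1 / 8" "0 \<le> K / L" using L8 K(1) L by (auto simp: field_simps)
        from geometric_sum2_le[OF this(2,1), of n m] show ?thesis
          using K(1) L by (intro mult_left_mono) (auto simp: split)
      qed
      also have "K * (4 * (K / L)) \<le> 1"
        using K(1) by (simp add: L_def field_simps power2_eq_square)
      hence "L ^ (m + n) * (K * (4 * (K / L))) \<le> L ^ (m + n)"
        using L mult_left_mono[of "K * (4 * (K / L))" 1 "L ^ (m + n)"] by simp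
      finally show ?thesis .
    qed
  qed
  moreover have "L ^ (m + n) \<le> L ^ (m + n + 1)" for m n using L by (intro power_increasing) auto
  ultimately show ?thesis using L by (intro gconvI[of _ L]) (blast intro: order_trans)+
qed

section \<open>The local ring of convergent power series in x and y\<close>

typedef germ = "{F. gconv F}"
  using gconv_finite[of 0] by auto

setup_lifting type_definition_germ

instantiation germ :: idom
begin
lift_definition zero_germ :: germ is 0 by (rule gconv_finite) simp
lift_definition one_germ :: germ is 1
  by (rule gconv_finite, rule finite_subset[of _ "{(0,0)}"]) (auto split: if_splits)
lift_definition plus_germ :: "germ \<Rightarrow> germ \<Rightarrow> germ" is "(+)" by (rule gconv_add)
lift_definition uminus_germ :: "germ \<Rightarrow> germ" is "uminus" by (rule gconv_uminus)
lift_definition minus_germ :: "germ \<Rightarrow> germ \<Rightarrow> germ" is "(-)"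
  using gconv_add gconv_uminus by fastforce
lift_definition times_germ :: "germ \<Rightarrow> germ \<Rightarrow> germ" is "(*)" by (rule gconv_mult)
instance by standard (transfer, simp add: algebra_simps; fail)+
end

lift_definition cf :: "germ \<Rightarrow> nat \<Rightarrow> nat \<Rightarrow> complex" is "\<lambda>F m n. F $ m $ n" .
lift_definition gconst :: "complex \<Rightarrow> germ" is "\<lambda>c. fps_const (fps_const c)"
  by (rule gconv_finite, rule finite_subset[of _ "{(0,0)}"]) (auto split: if_splits)
lift_definition gX :: germ is "fps_X"
  by (rule gconv_finite, rule finite_subset[of _ "{(1,0)}"]) (auto split: if_splits)
lift_definition gY :: germ is "fps_const fps_X"
  by (rule gconv_finite, rule finite_subset[of _ "{(0,1)}"]) (auto split: if_splits)

lemma germ_eqI: "(\<And>a b. cf F a b = cf G a b) \<Longrightarrow> F = G"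
  by transfer (auto simp: fps_eq_iff)

lemma cf_0 [simp]: "cf 0 a b = 0" by transfer simp
lemma cf_1: "cf 1 a b = (if a = 0 \<and> b = 0 then 1 else 0)" by transfer simp
lemma cf_add [simp]: "cf (F + G) a b = cf F a b + cf G a b" by transfer simp
lemma cf_diff [simp]: "cf (F - G) a b = cf F a b - cf G a b" by transfer simp
lemma cf_uminus [simp]: "cf (- F) a b = - cf F a b" by transfer simp
lemma cf_mult: "cf (F * G) a b = (\<Sum>i\<le>a. \<Sum>j\<le>b. cf F i j * cf G (a - i) (b - j))"
  by transfer (rule fps2_mult_nth)
lemma cf_const: "cf (gconst c) a b = (if a = 0 \<and> b = 0 then c else 0)" by transfer simp
lemma cf_const_mult [simp]: "cf (gconst c * F) a b = c * cf F a b" by transfer simp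
lemma cf_sum [simp]: "cf (\<Sum>i\<in>A. F i) a b = (\<Sum>i\<in>A. cf (F i) a b)"
  by (induction A rule: infinite_finite_induct) auto
lemma cf_X_mult: "cf (gX * F) a b = (if a = 0 then 0 else cf F (a - 1) b)"
  by transfer simp
lemma cf_Y_mult: "cf (gY * F) a b = (if b = 0 then 0 else cf F a (b - 1))"
  by transfer simp
lemma cf_X_power_mult: "cf (gX ^ k * F) a b = (if a < k then 0 else cf F (a - k) b)"
  by (induction k arbitrary: a) (auto simp: cf_X_mult mult.assoc)
lemma cf_Y_power_mult: "cf (gY ^ k * F) a b = (if b < k then 0 else cf F a (b - k))"
  by (induction k arbitrary: b) (auto simp: cf_Y_mult mult.assoc)
lemma cf_XY_mult: "cf (gX ^ k * gY ^ l * F) a b = (if a < k \<or> b < l then 0 else cf F (a - k) (b - l))"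
  by (simp add: mult.assoc cf_X_power_mult cf_Y_power_mult)
lemma cf_XY: "cf (gX ^ k * gY ^ l) a b = (if a = k \<and> b = l then 1 else 0)"
  using cf_XY_mult[of k l 1 a b] by (auto simp: cf_1)

lemma gconst_simps [simp]:
  "gconst 0 = 0" "gconst 1 = 1" "gconst (c + d) = gconst c + gconst d" "gconst (c - d) = gconst c - gconst d"
  "gconst (- c) = - gconst c"
  by (auto intro!: germ_eqI simp: cf_const cf_1)
lemma gconst_mult: "gconst (c * d) = gconst c * gconst d"
  by (auto intro!: germ_eqI simp: cf_const)
lemma gconst_sum: "gconst (\<Sum>i\<in>A. f i) = (\<Sum>i\<in>A. gconst (f i))"
  by (induction A rule: infinite_finite_induct) auto

text \<open>After scaling the constant term to 1 a formal inverse exists, and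
  \<open>gconv_inverse\<close> makes it convergent. This is what makes the ring local.\<close>

lemma germ_unit:
  assumes "cf F 0 0 \<noteq> 0"
  shows "\<exists>G. F * G = 1"
  using assms
proof transfer
  fix F :: "complex fps fps" assume F: "gconv F" and nz: "F $ 0 $ 0 \<noteq> 0"
  define c where "c = fps_const (fps_const (inverse (F $ 0 $ 0)))"
  have c: "gconv c" unfolding c_def
    by (rule gconv_finite, rule finite_subset[of _ "{(0,0)}"]) (auto split: if_splits)
  define F' where "F' = c * F"
  have F': "gconv F'" "F' $ 0 $ 0 = 1" using F c nz by (auto simp: F'_def gconv_mult c_def)
  define G where "G = fps_right_inverse F' (inverse (F' $ 0))"
  have "F' $ 0 * inverse (F' $ 0) = 1" using F'(2) by (subst mult.commute) (simp add: inverse_mult_eq_1)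
  hence "F' * G = 1" unfolding G_def by (rule fps_right_inverse)
  moreover from gconv_inverse[OF F' this] have "gconv G" .
  ultimately show "\<exists>G\<in>Collect gconv. F * G = 1"
    using c by (intro bexI[of _ "c * G"]) (auto simp: F'_def gconv_mult mult_ac)
qed

lift_definition shX :: "germ \<Rightarrow> germ" is "\<lambda>F. Abs_fps (\<lambda>m. F $ Suc m)"
proof -
  fix F assume "gconv F"
  then obtain K where K: "K \<ge> 1" "\<And>m n. cmod (F $ m $ n) \<le> K ^ (m + n + 1)" by (auto simp: gconv_def)
  have "cmod (F $ Suc m $ n) \<le> (K\<^sup>2) ^ (m + n + 1)" for m n
  proof -
    have "cmod (F $ Suc m $ n) \<le> K ^ (Suc m + n + 1)" by (rule K)
    also have "\<dots> \<le> K ^ (2 * (m + n + 1))" using K(1) by (intro power_increasing) auto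
    finally show ?thesis by (simp only: power_mult)
  qed
  thus "gconv (Abs_fps (\<lambda>m. F $ Suc m))"
    using K(1) by (intro gconvI[of _ "K\<^sup>2"]) (auto simp: one_le_power)
qed
lift_definition shY :: "germ \<Rightarrow> germ" is "\<lambda>F. Abs_fps (\<lambda>m. Abs_fps (\<lambda>n. F $ m $ Suc n))"
proof -
  fix F assume "gconv F"
  then obtain K where K: "K \<ge> 1" "\<And>m n. cmod (F $ m $ n) \<le> K ^ (m + n + 1)" by (auto simp: gconv_def)
  have "cmod (F $ m $ Suc n) \<le> (K\<^sup>2) ^ (m + n + 1)" for m n
  proof -
    have "cmod (F $ m $ Suc n) \<le> K ^ (m + Suc n + 1)" by (rule K)
    also have "\<dots> \<le> K ^ (2 * (m + n + 1))" using K(1) by (intro power_increasing) auto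
    finally show ?thesis by (simp only: power_mult)
  qed
  thus "gconv (Abs_fps (\<lambda>m. Abs_fps (\<lambda>n. F $ m $ Suc n)))"
    using K(1) by (intro gconvI[of _ "K\<^sup>2"]) (auto simp: one_le_power)
qed

lemma cf_shX [simp]: "cf (shX F) a b = cf F (Suc a) b" by transfer simp
lemma cf_shY [simp]: "cf (shY F) a b = cf F a (Suc b)" by transfer simp

lemma X_dvd_germ: "(\<And>b. cf F 0 b = 0) \<Longrightarrow> F = gX * shX F"
  by (rule germ_eqI) (auto simp: cf_X_mult gr0_conv_Suc)
lemma Y_dvd_germ: "(\<And>a. cf F a 0 = 0) \<Longrightarrow> F = gY * shY F"
  by (rule germ_eqI) (auto simp: cf_Y_mult gr0_conv_Suc)

lift_definition dX :: "germ \<Rightarrow> germ" is "fps_deriv"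
proof -
  fix F :: "complex fps fps" assume "gconv F"
  then obtain K where K: "K \<ge> 1" "\<And>m n. cmod (F $ m $ n) \<le> K ^ (m + n + 1)" by (auto simp: gconv_def)
  have "cmod (fps_deriv F $ m $ n) \<le> (2 * K\<^sup>2) ^ (m + n + 1)" for m n
  proof -
    have "cmod (fps_deriv F $ m $ n) = real (m + 1) * cmod (F $ (m + 1) $ n)"
      by (simp add: norm_mult del: of_nat_Suc flip: of_nat_Suc)
    also have "\<dots> \<le> real (m + 1) * K ^ (m + 1 + n + 1)" by (intro mult_left_mono K) auto
    also have "\<dots> \<le> 2 ^ (m + n + 1) * K ^ (2 * (m + n + 1))"
    proof (intro mult_mono power_increasing)
      have "real (m + 1) \<le> real (2 ^ m)" unfolding of_nat_le_iff by (simp add: Suc_leI)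
      also have "\<dots> \<le> 2 ^ (m + n + 1)" unfolding of_nat_power of_nat_numeral by (intro power_increasing) auto
      finally show "real (m + 1) \<le> 2 ^ (m + n + 1)" .
    qed (use K in auto)
    finally show ?thesis by (simp only: power_mult_distrib power_mult)
  qed
  moreover have "2 * K\<^sup>2 \<ge> 1" using K(1) one_le_power[of K 2] by linarith
  ultimately show "gconv (fps_deriv F)" by (rule gconvI)
qed
lift_definition dY :: "germ \<Rightarrow> germ" is "\<lambda>F. Abs_fps (\<lambda>m. fps_deriv (F $ m))"
proof -
  fix F :: "complex fps fps" assume "gconv F"
  then obtain K where K: "K \<ge> 1" "\<And>m n. cmod (F $ m $ n) \<le> K ^ (m + n + 1)" by (auto simp: gconv_def)
  have "cmod (fps_deriv (F $ m) $ n) \<le> (2 * K\<^sup>2) ^ (m + n + 1)" for m n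
  proof -
    have "cmod (fps_deriv (F $ m) $ n) = real (n + 1) * cmod (F $ m $ (n + 1))"
      by (simp add: norm_mult del: of_nat_Suc flip: of_nat_Suc)
    also have "\<dots> \<le> real (n + 1) * K ^ (m + (n + 1) + 1)" by (intro mult_left_mono K) auto
    also have "\<dots> \<le> 2 ^ (m + n + 1) * K ^ (2 * (m + n + 1))"
    proof (intro mult_mono power_increasing)
      have "real (n + 1) \<le> real (2 ^ n)" unfolding of_nat_le_iff by (simp add: Suc_leI)
      also have "\<dots> \<le> 2 ^ (m + n + 1)" unfolding of_nat_power of_nat_numeral by (intro power_increasing) auto
      finally show "real (n + 1) \<le> 2 ^ (m + n + 1)" .
    qed (use K in auto)
    finally show ?thesis by (simp only: power_mult_distrib power_mult)
  qed
  moreover have "2 * K\<^sup>2 \<ge> 1" using K(1) one_le_power[of K 2] by linarith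
  ultimately show "gconv (Abs_fps (\<lambda>m. fps_deriv (F $ m)))" by (intro gconvI) auto
qed

lemma cf_dX [simp]: "cf (dX F) a b = of_nat (Suc a) * cf F (Suc a) b"
  by transfer (simp del: of_nat_Suc flip: of_nat_Suc)
lemma cf_dY [simp]: "cf (dY F) a b = of_nat (Suc b) * cf F a (Suc b)"
  by transfer simp

lemma dX_mult: "dX (F * G) = dX F * G + F * dX G"
  by transfer simp
lemma dY_mult: "dY (F * G) = dY F * G + F * dY G"
  by transfer (simp add: fps_eq_iff[where ?'a = "complex fps"] fps_mult_nth fps_deriv_sum sum.distrib)

lemma dX_simps [simp]: "dX (F + G) = dX F + dX G" "dX (gconst c) = 0" "dX gX = 1" "dX gY = 0"
  by (transfer, simp)+
lemma dY_simps [simp]: "dY (F + G) = dY F + dY G" "dY (gconst c) = 0" "dY gX = 0" "dY gY = 1"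
  by (transfer, auto simp: fps_eq_iff)+

section \<open>Colength and intersection multiplicity\<close>

lemma sum_fun_apply: "(\<Sum>t\<in>T. f t) x = (\<Sum>t\<in>T. f t x)"
  for f :: "'a \<Rightarrow> 'b \<Rightarrow> complex"
  by (induction T rule: infinite_finite_induct) auto

lemma linear_dependence:
  fixes v :: "'s \<Rightarrow> 't \<Rightarrow> complex"
  assumes "finite S" "finite T" "card T < card S"
  shows "\<exists>u. (\<exists>s\<in>S. u s \<noteq> 0) \<and> (\<forall>t\<in>T. (\<Sum>s\<in>S. u s * v s t) = 0)"
proof -
  interpret V: vector_space "\<lambda>(c::complex) (f::'t \<Rightarrow> complex) x. c * f x"
    by unfold_locales (auto simp: fun_eq_iff algebra_simps)
  define w where "w = (\<lambda>s t. if t \<in> T then v s t else 0)"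
  define e :: "'t \<Rightarrow> 't \<Rightarrow> complex" where "e = (\<lambda>t t'. if t' = t then (1::complex) else 0)"
  have w_span: "w ` S \<subseteq> V.span (e ` T)"
  proof
    fix x assume "x \<in> w ` S"
    then obtain s where s: "x = w s" by auto
    have "w s = (\<Sum>t\<in>T. (\<lambda>x. w s t * e t x))"
      using assms(2) by (auto simp: fun_eq_iff w_def e_def sum_fun_apply if_distrib cong: if_cong)
    also have "\<dots> \<in> V.span (e ` T)"
      by (intro V.span_sum V.span_scale V.span_base) auto
    finally show "x \<in> V.span (e ` T)" by (simp add: s)
  qed
  show ?thesis
  proof (cases "inj_on w S")
    \<comment> \<open>A family with a repetition is dependent, but its image may be an independent
      set, so this case cannot be left to \<open>V.dependent\<close>.\<close>
    case False
    then obtain s1 s2 where s: "s1 \<in> S" "s2 \<in> S" "s1 \<noteq> s2" "w s1 = w s2" by (auto simp: inj_on_def)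
    define u where "u = (\<lambda>s. if s = s1 then 1 else if s = s2 then -1 else (0::complex))"
    have "(\<Sum>s\<in>S. u s * v s t) = 0" if "t \<in> T" for t
    proof -
      have "(\<Sum>s\<in>S. u s * v s t) = (\<Sum>s\<in>{s1,s2}. u s * v s t)"
        using s assms(1) by (intro sum.mono_neutral_right) (auto simp: u_def)
      also have "\<dots> = v s1 t - v s2 t" using s(3) by (simp add: u_def)
      also have "\<dots> = 0" using fun_cong[OF s(4), of t] that by (simp add: w_def)
      finally show ?thesis .
    qed
    thus ?thesis using s(1) by (intro exI[of _ u]) (auto simp: u_def)
  next
    case True
    have "V.dependent (w ` S)"
    proof (rule ccontr)
      assume "V.independent (w ` S)"
      from V.independent_span_bound[OF _ this w_span] assms(2)
      have "card (w ` S) \<le> card (e ` T)" by auto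
      also have "\<dots> \<le> card T" using assms(2) by (rule card_image_le)
      finally show False using assms(3) card_image[OF True] by simp
    qed
    then obtain u where u: "\<exists>x\<in>w ` S. u x \<noteq> 0" "(\<Sum>x\<in>w ` S. (\<lambda>t. u x * x t)) = 0"
      using assms(1) by (auto simp: V.dependent_finite)
    have "(\<Sum>s\<in>S. u (w s) * v s t) = 0" if "t \<in> T" for t
    proof -
      have "(\<Sum>s\<in>S. u (w s) * w s t) = (\<Sum>x\<in>w ` S. (\<lambda>t. u x * x t)) t"
        by (simp add: sum.reindex[OF True] sum_fun_apply)
      also have "\<dots> = 0" using u(2) by simp
      finally show ?thesis using that by (simp add: w_def)
    qed
    thus ?thesis using u(1) by (intro exI[of _ "u \<circ> w"]) auto
  qed
qed

text \<open>The indicators form a basis of the functions on \<open>S\<close>, here spanned by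
  \<open>card T\<close> functions. All lower bounds on colengths rest on this count.\<close>

lemma card_le_if_indicators_span:
  fixes c :: "'s \<Rightarrow> 't \<Rightarrow> complex"
  assumes "finite S" "finite T"
    and "\<And>s s'. s \<in> S \<Longrightarrow> s' \<in> S \<Longrightarrow> (if s' = s then 1 else 0) = (\<Sum>t\<in>T. c s t * w t s')"
  shows "card S \<le> card T"
proof (rule ccontr)
  assume "\<not> card S \<le> card T"
  with linear_dependence[of S T c] assms obtain u s' where
    u: "s' \<in> S" "u s' \<noteq> 0" "\<And>t. t \<in> T \<Longrightarrow> (\<Sum>s\<in>S. u s * c s t) = 0" by force
  have "u s' = (\<Sum>s\<in>S. u s * (if s' = s then 1 else 0))" using u(1) assms(1) by (simp add: if_distrib cong: if_cong)
  also have "\<dots> = (\<Sum>s\<in>S. u s * (\<Sum>t\<in>T. c s t * w t s'))" using assms(3) u(1) by (intro sum.cong) auto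
  also have "\<dots> = (\<Sum>t\<in>T. (\<Sum>s\<in>S. u s * c s t) * w t s')"
    by (simp add: sum_distrib_left sum_distrib_right mult.assoc) (rule sum.swap)
  also have "\<dots> = 0" using u(3) by simp
  finally show False using u(2) by simp
qed

section \<open>Ideals of germs and their colength\<close>

definition gideal :: "germ set \<Rightarrow> bool" where
  "gideal J \<longleftrightarrow> 0 \<in> J \<and> (\<forall>x\<in>J. \<forall>y\<in>J. x + y \<in> J) \<and> (\<forall>r. \<forall>x\<in>J. r * x \<in> J)"

lemma gidealD:
  assumes "gideal J"
  shows "0 \<in> J" "x \<in> J \<Longrightarrow> y \<in> J \<Longrightarrow> x + y \<in> J" "x \<in> J \<Longrightarrow> r * x \<in> J" "x \<in> J \<Longrightarrow> x * r \<in> J"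
    "x \<in> J \<Longrightarrow> - x \<in> J" "x \<in> J \<Longrightarrow> y \<in> J \<Longrightarrow> x - y \<in> J"
proof -
  note J = assms[unfolded gideal_def]
  show "0 \<in> J" "x \<in> J \<Longrightarrow> y \<in> J \<Longrightarrow> x + y \<in> J" "x \<in> J \<Longrightarrow> r * x \<in> J" using J by auto
  thus "x \<in> J \<Longrightarrow> x * r \<in> J" by (simp add: mult.commute)
  show neg: "- x \<in> J" if "x \<in> J" for x using J that by (metis mult_minus1)
  show "x \<in> J \<Longrightarrow> y \<in> J \<Longrightarrow> x - y \<in> J" using neg[of y] J by (metis add_uminus_conv_diff)
qed

lemma gideal_sum: "gideal J \<Longrightarrow> (\<And>i. i \<in> A \<Longrightarrow> f i \<in> J) \<Longrightarrow> (\<Sum>i\<in>A. f i) \<in> J"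
  by (induction A rule: infinite_finite_induct) (auto simp: gidealD)

definition ideal2 :: "germ \<Rightarrow> germ \<Rightarrow> germ set" where
  "ideal2 u w = {a * u + b * w | a b. True}"

lemma gideal_ideal2 [simp]: "gideal (ideal2 u w)"
  unfolding gideal_def ideal2_def
proof (intro conjI ballI allI)
  show "0 \<in> {a * u + b * w |a b. True}" by (auto intro: exI[of _ 0])
next
  fix x y assume "x \<in> {a * u + b * w |a b. True}" "y \<in> {a * u + b * w |a b. True}"
  then obtain a b a' b' where "x = a * u + b * w" "y = a' * u + b' * w" by auto
  hence "x + y = (a + a') * u + (b + b') * w" by (simp add: algebra_simps)
  thus "x + y \<in> {a * u + b * w |a b. True}" by blast
next
  fix r x assume "x \<in> {a * u + b * w |a b. True}"
  then obtain a b where "x = a * u + b * w" by auto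
  hence "r * x = (r * a) * u + (r * b) * w" by (simp add: algebra_simps)
  thus "r * x \<in> {a * u + b * w |a b. True}" by blast
qed

lemma ideal2I: "a * u + b * w \<in> ideal2 u w" by (auto simp: ideal2_def)
lemma ideal2_gen [simp]: "u \<in> ideal2 u w" "w \<in> ideal2 u w"
  using ideal2I[of 1 u 0 w] ideal2I[of 0 u 1 w] by auto
lemma ideal2_subset: "gideal J \<Longrightarrow> u \<in> J \<Longrightarrow> w \<in> J \<Longrightarrow> ideal2 u w \<subseteq> J"
  by (auto simp: ideal2_def gidealD)
lemma ideal2_eqI:
  "u \<in> ideal2 u' w' \<Longrightarrow> w \<in> ideal2 u' w' \<Longrightarrow> u' \<in> ideal2 u w \<Longrightarrow> w' \<in> ideal2 u w \<Longrightarrow> ideal2 u w = ideal2 u' w'"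
  by (intro equalityI ideal2_subset) auto

definition lincomb :: "nat \<Rightarrow> (nat \<Rightarrow> complex) \<Rightarrow> (nat \<Rightarrow> germ) \<Rightarrow> germ" where
  "lincomb n c g = (\<Sum>i<n. gconst (c i) * g i)"

definition spans :: "germ set \<Rightarrow> nat \<Rightarrow> bool" where
  "spans J n \<longleftrightarrow> (\<exists>g. \<forall>h. \<exists>c. h - lincomb n c g \<in> J)"

text \<open>A relation instead of a function because the codimension may be infinite;
  \<open>colen J n\<close> includes finiteness.\<close>

definition colen :: "germ set \<Rightarrow> nat \<Rightarrow> bool" where
  "colen J n \<longleftrightarrow> spans J n \<and> (\<forall>m<n. \<not> spans J m)"

lemma colen_unique: "colen J m \<Longrightarrow> colen J n \<Longrightarrow> m = n"
  unfolding colen_def by (metis linorder_neqE_nat)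

lemma spans_imp_colen: "spans J n \<Longrightarrow> \<exists>m. colen J m"
  unfolding colen_def by (metis LeastI_ex not_less_Least)

lemma spans_mono: "spans J n \<Longrightarrow> J \<subseteq> J' \<Longrightarrow> spans J' n"
  unfolding spans_def by blast

lemma spans_finite:
  assumes "finite S" and "\<And>h. \<exists>c. h - (\<Sum>s\<in>S. gconst (c s) * g s) \<in> J"
  shows "spans J (card S)"
proof -
  obtain f where f: "bij_betw f {0..<card S} S" using ex_bij_betw_nat_finite[OF assms(1)] by blast
  have "\<exists>c. h - lincomb (card S) c (g \<circ> f) \<in> J" for h
  proof -
    from assms(2) obtain c where c: "h - (\<Sum>s\<in>S. gconst (c s) * g s) \<in> J" by blast
    have "lincomb (card S) (c \<circ> f) (g \<circ> f) = (\<Sum>s\<in>S. gconst (c s) * g s)"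
      unfolding lincomb_def using sum.reindex_bij_betw[OF f, of "\<lambda>s. gconst (c s) * g s"]
      by (simp add: lessThan_atLeast0)
    thus ?thesis using c by metis
  qed
  thus ?thesis unfolding spans_def by blast
qed

text \<open>In a spanning family of minimal length no nontrivial combination lies in
  \<open>J\<close>: otherwise one member could be expressed by the rest and dropped.\<close>

lemma colen_basis:
  assumes "colen J n" "gideal J"
  obtains g where "\<And>h. \<exists>c. h - lincomb n c g \<in> J"
    "\<And>c i. lincomb n c g \<in> J \<Longrightarrow> i < n \<Longrightarrow> c i = 0"
proof -
  note J = gidealD[OF assms(2)]
  from assms obtain g where g: "\<And>h. \<exists>c. h - lincomb n c g \<in> J"
    unfolding colen_def spans_def by blast
  have "c k = 0" if c: "lincomb n c g \<in> J" and k: "k < n" for c k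
  proof (rule ccontr)
    assume ck: "c k \<noteq> 0"
    have "\<exists>d. h - (\<Sum>i\<in>{..<n} - {k}. gconst (d i) * g i) \<in> J" for h
    proof -
      obtain d where d: "h - lincomb n d g \<in> J" using g by blast
      \<comment> \<open>The multiple of the relation \<open>c\<close> whose subtraction kills the
        coefficient at \<open>k\<close>.\<close>
      define q where "q = d k / c k"
      define d' where "d' = (\<lambda>i. d i - q * c i)"
      have "lincomb n d' g = lincomb n d g - gconst q * lincomb n c g"
        by (simp add: lincomb_def d'_def gconst_mult sum_subtractf sum_distrib_left algebra_simps)
      hence "h - lincomb n d' g = (h - lincomb n d g) + gconst q * lincomb n c g" by simp
      also have "\<dots> \<in> J" using d c J by auto
      also have "lincomb n d' g = (\<Sum>i\<in>{..<n} - {k}. gconst (d' i) * g i)"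
        unfolding lincomb_def using k ck by (subst sum.remove[of _ k]) (auto simp: d'_def q_def)
      finally show ?thesis by blast
    qed
    from spans_finite[OF _ this] have "spans J (card ({..<n} - {k}))" by simp
    moreover have "card ({..<n} - {k}) < n" using k by simp
    ultimately show False using assms(1) by (auto simp: colen_def)
  qed
  with g that show ?thesis by blast
qed

text \<open>Steinitz exchange: if \<open>m\<close> germs span as well, the two base changes compose
  to the identity of size \<open>n\<close>, whence \<open>n \<le> m\<close>.\<close>

lemma colenI:
  assumes J: "gideal J" and g: "\<And>h. \<exists>c. h - lincomb n c g \<in> J"
    and ind: "\<And>c i. lincomb n c g \<in> J \<Longrightarrow> i < n \<Longrightarrow> c i = 0"
  shows "colen J n"
  unfolding colen_def
proof (intro conjI allI impI notI)
  show "spans J n" using g unfolding spans_def by blast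
  fix m assume m: "m < n" "spans J m"
  then obtain g' where g': "\<And>h. \<exists>c. h - lincomb m c g' \<in> J" unfolding spans_def by blast
  obtain c where c: "\<And>i. g i - lincomb m (c i) g' \<in> J"
    using choice[of "\<lambda>i c. g i - lincomb m c g' \<in> J"] g' by blast
  obtain d where d: "\<And>j. g' j - lincomb n (d j) g \<in> J"
    using choice[of "\<lambda>j c. g' j - lincomb n c g \<in> J"] g by blast
  have "card {..<n} \<le> card {..<m}"
  proof (rule card_le_if_indicators_span[where c = c and w = d])
    fix i k assume ik: "i \<in> {..<n}" "k \<in> {..<n}"
    \<comment> \<open>Row \<open>i\<close> of the identity minus the product of the two base
      changes; independence modulo \<open>J\<close> makes it zero.\<close>
    define e where "e = (\<lambda>k. (if k = i then 1 else 0) - (\<Sum>j<m. c i j * d j k))"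
    have "lincomb n e g = g i - (\<Sum>k<n. \<Sum>j<m. gconst (c i j) * (gconst (d j k) * g k))"
      using ik(1) by (simp add: lincomb_def e_def algebra_simps sum_subtractf sum_distrib_left sum_distrib_right
          gconst_sum gconst_mult if_distrib[of gconst] if_distrib[where f = "\<lambda>x. y * x" for y] cong: if_cong)
    also have "\<dots> = (g i - lincomb m (c i) g') + (\<Sum>j<m. gconst (c i j) * (g' j - lincomb n (d j) g))"
      by (subst sum.swap) (simp add: lincomb_def algebra_simps sum_subtractf sum_distrib_left)
    also have "\<dots> \<in> J"
      using c d by (intro gidealD(2,3)[OF J] gideal_sum[OF J]) auto
    finally have "e k = 0" using ind ik by blast
    thus "(if k = i then 1 else 0) = (\<Sum>j\<in>{..<m}. c i j * d j k)" by (simp add: e_def)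
  qed auto
  thus False using m by simp
qed

lemma cf00_mult: "cf (F * G) 0 0 = cf F 0 0 * cf G 0 0" by (simp add: cf_mult)
lemma cf00_power: "cf (F ^ n) 0 0 = cf F 0 0 ^ n" by (induction n) (auto simp: cf_1 cf00_mult)

lemma unit_mult_in_ideal:
  assumes "gideal J" "u * x \<in> J" "cf u 0 0 \<noteq> 0" shows "x \<in> J"
proof -
  obtain v where "u * v = 1" using germ_unit[OF assms(3)] by blast
  hence "x = v * (u * x)" by (simp add: mult_ac)
  thus ?thesis using gidealD[OF assms(1)] assms(2) by metis
qed

text \<open>The \<open>n + 1\<close> powers up to \<open>F ^ n\<close> are dependent modulo
  \<open>J\<close>. Factoring out the lowest power that occurs leaves a unit, because
  \<open>F\<close> vanishes at the origin.\<close>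

lemma power_in_ideal:
  assumes J: "gideal J" and sp: "spans J n" and F: "cf F 0 0 = 0"
  shows "\<exists>N. F ^ N \<in> J"
proof -
  obtain g where g: "\<And>h. \<exists>c. h - lincomb n c g \<in> J" using sp unfolding spans_def by blast
  obtain c where c: "\<And>s. F ^ s - lincomb n (c s) g \<in> J"
    using choice[of "\<lambda>s c. F ^ s - lincomb n c g \<in> J"] g by blast
  obtain u where u: "\<exists>s\<in>{..n}. u s \<noteq> 0" "\<And>t. t < n \<Longrightarrow> (\<Sum>s\<le>n. u s * c s t) = 0"
    using linear_dependence[of "{..n}" "{..<n}" c] by auto
  have "(\<Sum>s\<le>n. gconst (u s) * lincomb n (c s) g) = (\<Sum>i<n. gconst (\<Sum>s\<le>n. u s * c s i) * g i)"
    unfolding lincomb_def gconst_sum gconst_mult sum_distrib_left sum_distrib_right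
    by (subst sum.swap) (simp add: mult_ac)
  also have "\<dots> = 0" using u(2) by simp
  finally have "(\<Sum>s\<le>n. gconst (u s) * F ^ s) = (\<Sum>s\<le>n. gconst (u s) * (F ^ s - lincomb n (c s) g))"
    by (simp add: algebra_simps sum_subtractf)
  also have "\<dots> \<in> J" using c by (intro gideal_sum[OF J] gidealD(3)[OF J]) auto
  finally have inJ: "(\<Sum>s\<le>n. gconst (u s) * F ^ s) \<in> J" .
  define k where "k = (LEAST s. u s \<noteq> 0)"
  have k: "u k \<noteq> 0" "k \<le> n" "\<And>s. s < k \<Longrightarrow> u s = 0"
  proof -
    from u(1) obtain s where s: "s \<le> n" "u s \<noteq> 0" by auto
    show "u k \<noteq> 0" unfolding k_def by (rule LeastI[of _ s]) (rule s)
    show "k \<le> n" using Least_le[of "\<lambda>s. u s \<noteq> 0", OF s(2)] s(1) by (simp add: k_def)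
    show "\<And>s. s < k \<Longrightarrow> u s = 0" unfolding k_def using not_less_Least by blast
  qed
  define U where "U = (\<Sum>s\<in>{k..n}. gconst (u s) * F ^ (s - k))"
  have "(\<Sum>s\<le>n. gconst (u s) * F ^ s) = (\<Sum>s\<in>{k..n}. gconst (u s) * F ^ s)"
    using k by (intro sum.mono_neutral_right) (auto simp: not_le)
  also have "\<dots> = U * F ^ k" unfolding U_def sum_distrib_right
    by (intro sum.cong) (auto simp: mult.assoc simp flip: power_add)
  finally have "U * F ^ k \<in> J" using inJ by simp
  moreover have "cf U 0 0 = u k"
  proof -
    have "cf U 0 0 = (\<Sum>s\<in>{k..n}. if s = k then u k else 0)" unfolding U_def cf_sum
      by (intro sum.cong) (auto simp: cf00_power F)
    thus ?thesis using k(2) by simp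
  qed
  ultimately show ?thesis using unit_mult_in_ideal[OF J] k(1) by metis
qed

lemma cf_gX [simp]: "cf gX a b = (if a = 1 \<and> b = 0 then 1 else 0)"
  and cf_gY [simp]: "cf gY a b = (if a = 0 \<and> b = 1 then 1 else 0)"
  using cf_XY[of 1 0 a b] cf_XY[of 0 1 a b] by auto

section \<open>Intersection multiplicity and its additivity\<close>

definition isect :: "germ \<Rightarrow> germ \<Rightarrow> nat \<Rightarrow> bool" where
  "isect u w n \<longleftrightarrow> colen (ideal2 u w) n"

lemma isect_commute: "isect u w n \<longleftrightarrow> isect w u n"
proof -
  have "ideal2 u w = ideal2 w u" by (rule ideal2_eqI) auto
  thus ?thesis by (simp add: isect_def)
qed

lemma isect_ideal_cong: "ideal2 u w = ideal2 u' w' \<Longrightarrow> isect u w n \<longleftrightarrow> isect u' w' n"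
  by (simp add: isect_def)

lemma gX_neq_0: "gX \<noteq> 0" and gY_neq_0: "gY \<noteq> 0"
  by (metis cf_0 cf_gX zero_neq_one, metis cf_0 cf_gY zero_neq_one)

text \<open>Coprimality of x and y. Each round splits one x off \<open>p\<close>, cancels it, and
  applies the induction hypothesis to y times the quotient; the y is then cancelled in turn.\<close>

lemma Y_power_cancel:
  assumes "gY ^ N * p = gX ^ N * q" shows "\<exists>t. p = gX ^ N * t"
  using assms
proof (induction N arbitrary: p q)
  case (Suc N)
  have "cf p 0 b = 0" for b
    using arg_cong[OF Suc.prems, of "\<lambda>F. cf F 0 (b + Suc N)"]
    by (simp add: cf_X_power_mult cf_Y_power_mult del: power_Suc)
  from X_dvd_germ[OF this] have p: "p = gX * shX p" .
  have "gX * (gY ^ N * (gY * shX p)) = gX * (gX ^ N * q)"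
    using Suc.prems by (subst (asm) p) (simp add: mult_ac)
  hence "gY ^ N * (gY * shX p) = gX ^ N * q" by (simp add: mult_left_cancel[where c = gX] gX_neq_0)
  from Suc.IH[OF this] obtain t where t: "gY * shX p = gX ^ N * t" by blast
  have "cf t a 0 = 0" for a
    using arg_cong[OF t, of "\<lambda>F. cf F (a + N) 0"] by (simp add: cf_X_power_mult cf_Y_mult)
  from Y_dvd_germ[OF this] have "gY * shX p = gY * (gX ^ N * shY t)"
    using t by (metis mult.left_commute)
  hence "shX p = gX ^ N * shY t" by (simp add: mult_left_cancel[where c = gY] gY_neq_0)
  thus ?case using p by (metis mult.assoc power_Suc)
qed (auto intro: exI[of _ p])

text \<open>Finite colength puts a power of x and a power of y into the ideal. Hence
  \<open>gX ^ N * z\<close> and \<open>gY ^ N * z\<close> are both multiples of \<open>w\<close>,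
  and coprimality of x and y makes \<open>z\<close> itself one.\<close>

lemma isect_regular:
  assumes "isect u w n" "u * z = w * b"
  shows "\<exists>t. z = w * t"
proof -
  let ?J = "ideal2 u w"
  have sp: "spans ?J n" using assms(1) by (auto simp: isect_def colen_def)
  obtain N1 where N1: "gX ^ N1 \<in> ?J" using power_in_ideal[OF _ sp, of gX] by auto
  obtain N2 where N2: "gY ^ N2 \<in> ?J" using power_in_ideal[OF _ sp, of gY] by auto
  define N where "N = N1 + N2"
  have "gX ^ N \<in> ?J" "gY ^ N \<in> ?J"
    using N1 N2 by (simp_all add: N_def power_add gidealD)
  then obtain a1 b1 a2 b2 where X: "gX ^ N = a1 * u + b1 * w" and Y: "gY ^ N = a2 * u + b2 * w"
    by (auto simp: ideal2_def)
  define p where "p = a1 * b + b1 * z"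
  define q where "q = a2 * b + b2 * z"
  have Xz: "gX ^ N * z = w * p"
  proof -
    have "gX ^ N * z = a1 * (u * z) + b1 * w * z" by (simp add: X algebra_simps)
    thus ?thesis by (simp add: assms(2) p_def algebra_simps)
  qed
  have Yz: "gY ^ N * z = w * q"
  proof -
    have "gY ^ N * z = a2 * (u * z) + b2 * w * z" by (simp add: Y algebra_simps)
    thus ?thesis by (simp add: assms(2) q_def algebra_simps)
  qed
  show ?thesis
  proof (cases "w = 0")
    case True
    thus ?thesis using Xz gX_neq_0 by (intro exI[of _ 0]) simp
  next
    case False
    have "w * (gY ^ N * p) = w * (gX ^ N * q)" using Xz Yz by (metis mult.left_commute)
    hence "gY ^ N * p = gX ^ N * q" using False by simp
    from Y_power_cancel[OF this] obtain t where "p = gX ^ N * t" by blast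
    hence "gX ^ N * z = gX ^ N * (w * t)" using Xz by (simp add: mult_ac)
    thus ?thesis using gX_neq_0 by auto
  qed
qed

text \<open>Multiplication by \<open>u1\<close> embeds the quotient by \<open>(u2, w)\<close> into
  that by \<open>(u1 * u2, w)\<close>, with cokernel the quotient by \<open>(u1, w)\<close>. A basis
  is a lifted basis of the cokernel together with \<open>u1\<close> times a basis of the
  subspace.\<close>

lemma isect_mult:
  assumes m: "isect u1 w m" and n: "isect u2 w n"
  shows "isect (u1 * u2) w (m + n)"
proof -
  obtain g where g: "\<And>h. \<exists>c. h - lincomb m c g \<in> ideal2 u1 w"
    "\<And>c i. lincomb m c g \<in> ideal2 u1 w \<Longrightarrow> i < m \<Longrightarrow> c i = 0"
    using colen_basis[of "ideal2 u1 w" m] m by (auto simp: isect_def)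
  obtain g' where g': "\<And>h. \<exists>c. h - lincomb n c g' \<in> ideal2 u2 w"
    "\<And>c i. lincomb n c g' \<in> ideal2 u2 w \<Longrightarrow> i < n \<Longrightarrow> c i = 0"
    using colen_basis[of "ideal2 u2 w" n] n by (auto simp: isect_def)
  define G where "G = (\<lambda>i. if i < m then g i else u1 * g' (i - m))"
  have lc: "lincomb (m + n) c G = lincomb m c g + u1 * lincomb n (\<lambda>i. c (i + m)) g'" for c
  proof -
    have un: "{..<m + n} = {..<m} \<union> {m..<m + n}" by auto
    have "lincomb (m + n) c G = (\<Sum>i<m. gconst (c i) * G i) + (\<Sum>i\<in>{m..<m + n}. gconst (c i) * G i)"
      unfolding lincomb_def un by (subst sum.union_disjoint) auto
    also have "(\<Sum>i\<in>{m..<m + n}. gconst (c i) * G i) = (\<Sum>i<n. gconst (c (i + m)) * G (i + m))"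
      using sum.shift_bounds_nat_ivl[of "\<lambda>i. gconst (c i) * G i" 0 m n]
      by (simp add: lessThan_atLeast0 add.commute)
    finally show ?thesis by (simp add: lincomb_def G_def sum_distrib_left mult_ac)
  qed
  show ?thesis unfolding isect_def
  proof (rule colenI)
    fix h
    obtain c where "h - lincomb m c g \<in> ideal2 u1 w" using g(1) by blast
    then obtain a b where 1: "h - lincomb m c g = a * u1 + b * w" by (auto simp: ideal2_def)
    obtain d where "a - lincomb n d g' \<in> ideal2 u2 w" using g'(1) by blast
    then obtain a' b' where 2: "a - lincomb n d g' = a' * u2 + b' * w" by (auto simp: ideal2_def)
    have a: "a = a' * u2 + b' * w + lincomb n d g'" using 2 by (simp add: algebra_simps)
    define e where "e = (\<lambda>i. if i < m then c i else d (i - m))"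
    have "lincomb m e g = lincomb m c g" by (simp add: lincomb_def e_def)
    moreover have "lincomb n (\<lambda>i. e (i + m)) g' = lincomb n d g'" by (simp add: lincomb_def e_def)
    ultimately have "h - lincomb (m + n) e G = (h - lincomb m c g) - u1 * lincomb n d g'" by (simp add: lc)
    also have "\<dots> = a' * (u1 * u2) + (b + u1 * b') * w"
      unfolding 1 a by (simp add: algebra_simps)
    also have "\<dots> \<in> ideal2 (u1 * u2) w" by (rule ideal2I)
    finally show "\<exists>c. h - lincomb (m + n) c G \<in> ideal2 (u1 * u2) w" by blast
  next
    fix c i assume "lincomb (m + n) c G \<in> ideal2 (u1 * u2) w" and i: "i < m + n"
    then obtain a b where ab: "lincomb m c g + u1 * lincomb n (\<lambda>i. c (i + m)) g' = a * (u1 * u2) + b * w"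
      by (auto simp: lc ideal2_def)
    hence "lincomb m c g = (a * u2 - lincomb n (\<lambda>i. c (i + m)) g') * u1 + b * w"
      by (simp add: algebra_simps eq_diff_eq)
    hence c0: "c i = 0" if "i < m" for i using g(2)[of c] ideal2I that by metis
    hence "lincomb m c g = 0" by (simp add: lincomb_def)
    with ab have "u1 * (lincomb n (\<lambda>i. c (i + m)) g' - a * u2) = w * b" by (simp add: algebra_simps)
    \<comment> \<open>This is injectivity of multiplication by \<open>u1\<close>.\<close>
    from isect_regular[OF m this] obtain t where "lincomb n (\<lambda>i. c (i + m)) g' - a * u2 = w * t" by blast
    hence "lincomb n (\<lambda>i. c (i + m)) g' = a * u2 + t * w" by (simp add: algebra_simps)
    hence c1: "c (i + m) = 0" if "i < n" for i using g'(2)[of "\<lambda>i. c (i + m)"] ideal2I that by metis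
    show "c i = 0" using c0[of i] c1[of "i - m"] i by (cases "i < m") auto
  qed simp
qed

lemma isect_unit: "isect 1 w 0"
proof -
  have "ideal2 1 w = UNIV" using ideal2I[of _ 1 0 w] by auto
  thus ?thesis by (simp add: isect_def colen_def spans_def)
qed

lemma isect_power: "isect u w n \<Longrightarrow> isect (u ^ k) w (k * n)"
  by (induction k) (auto simp: isect_unit intro: isect_mult)

text \<open>The ideal \<open>(u2, w)\<close> contains \<open>(u1 * u2, w)\<close>, so its colength
  is finite, and additivity then determines it.\<close>

lemma isect_cancel:
  assumes N: "isect (u1 * u2) w N" and m: "isect u1 w m"
  shows "m \<le> N \<and> isect u2 w (N - m)"
proof -
  have "spans (ideal2 (u1 * u2) w) N" using N by (simp add: isect_def colen_def)
  moreover have "ideal2 (u1 * u2) w \<subseteq> ideal2 u2 w" by (rule ideal2_subset) (auto intro: gidealD)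
  ultimately have "spans (ideal2 u2 w) N" by (rule spans_mono)
  then obtain n where n: "isect u2 w n" using spans_imp_colen isect_def by blast
  from isect_mult[OF m n] N have "m + n = N" unfolding isect_def by (rule colen_unique)
  thus ?thesis using n by auto
qed

lemma isect_unit_mult:
  assumes "cf U 0 0 \<noteq> 0" shows "isect (U * u) w n \<longleftrightarrow> isect u w n"
proof -
  obtain V where V: "U * V = 1" using germ_unit[OF assms] by blast
  have "u = V * (U * u)" using V by (simp add: mult_ac)
  hence "u \<in> ideal2 (U * u) w" by (metis gidealD(3) gideal_ideal2 ideal2_gen(1))
  hence "ideal2 (U * u) w = ideal2 u w" by (intro ideal2_eqI) (auto intro: gidealD)
  thus ?thesis by (rule isect_ideal_cong)
qed

lemma isect_X_Y: "isect gX gY 1"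
  unfolding isect_def
proof (rule colenI[where g = "\<lambda>_. 1"])
  fix h
  have "h - gconst (cf h 0 0) = gX * shX h + gY * shY (h - gX * shX h)"
    by (rule germ_eqI) (auto simp: cf_X_mult cf_Y_mult cf_const gr0_conv_Suc)
  hence "h - lincomb 1 (\<lambda>_. cf h 0 0) (\<lambda>_. 1) = shX h * gX + shY (h - gX * shX h) * gY"
    by (simp add: lincomb_def mult.commute)
  thus "\<exists>c. h - lincomb 1 c (\<lambda>_. 1) \<in> ideal2 gX gY" using ideal2I by metis
next
  fix c :: "nat \<Rightarrow> complex" and i assume "lincomb 1 c (\<lambda>_. 1) \<in> ideal2 gX gY" and i: "i < (1::nat)"
  then obtain a b where "gconst (c 0) = a * gX + b * gY" by (auto simp: lincomb_def ideal2_def)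
  from arg_cong[OF this, of "\<lambda>F. cf F 0 0"] show "c i = 0" using i by (simp add: cf_const cf00_mult)
qed simp

text \<open>Modulo y only the restriction of \<open>w\<close> to the axis matters, and that is a
  unit times \<open>gX ^ n\<close>.\<close>

lemma isect_Y:
  assumes "cf w n 0 \<noteq> 0" "\<And>a. a < n \<Longrightarrow> cf w a 0 = 0"
  shows "isect gY w n"
proof -
  define r where "r = w - gY * shY w"
  have r: "cf r a b = (if b = 0 then cf w a 0 else 0)" for a b by (auto simp: r_def cf_Y_mult gr0_conv_Suc)
  have "\<exists>U. r = gX ^ k * U \<and> (\<forall>a. cf U a 0 = cf r (a + k) 0) \<and> (\<forall>a b. b > 0 \<longrightarrow> cf U a b = 0)" if "k \<le> n" for k
    using that
  proof (induction k)
    case 0 thus ?case by (intro exI[of _ r]) (auto simp: r)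
  next
    case (Suc k)
    then obtain U where U: "r = gX ^ k * U" "\<forall>a. cf U a 0 = cf r (a + k) 0" "\<forall>a b. b > 0 \<longrightarrow> cf U a b = 0" by auto
    have "cf U 0 b = 0" for b using U(2,3) assms(2)[of k] Suc.prems by (cases "b = 0") (auto simp: r)
    from X_dvd_germ[OF this] have "r = gX ^ Suc k * shX U" using U(1) by (metis mult.left_commute mult.assoc power_Suc)
    thus ?case using U(2,3) by (intro exI[of _ "shX U"]) auto
  qed
  from this[of n] obtain U where U0: "r = gX ^ n * U" "\<forall>a. cf U a 0 = cf r (a + n) 0" by blast
  have U: "r = gX ^ n * U" "cf U 0 0 = cf w n 0"
    by (rule U0(1)) (use U0(2)[rule_format, of 0] in \<open>simp add: r\<close>)
  have "isect (U * gX ^ n) gY n"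
    using isect_power[of gX gY 1 n] isect_X_Y isect_unit_mult[of U] U(2) assms(1) by simp
  hence "isect r gY n" using U(1) by (simp add: mult.commute)
  moreover have "ideal2 r gY = ideal2 gY w"
  proof (rule ideal2_eqI)
    show "r \<in> ideal2 gY w" by (simp add: r_def gidealD)
    have "w = r + gY * shY w" by (simp add: r_def)
    thus "w \<in> ideal2 r gY" by (metis gidealD(2,4) gideal_ideal2 ideal2_gen)
  qed simp_all
  ultimately show ?thesis using isect_ideal_cong by blast
qed

section \<open>Gradient ideals of germs with one or two Newton edges\<close>

definition ord_ge :: "nat \<Rightarrow> germ \<Rightarrow> bool" where
  "ord_ge t F \<longleftrightarrow> (\<forall>a b. a + b < t \<longrightarrow> cf F a b = 0)"

lemma ord_ge_0 [simp]: "ord_ge 0 F" "ord_ge t 0" by (auto simp: ord_ge_def)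
lemma ord_ge_add: "ord_ge t F \<Longrightarrow> ord_ge t G \<Longrightarrow> ord_ge t (F + G)"
  and ord_ge_mono: "ord_ge t F \<Longrightarrow> t' \<le> t \<Longrightarrow> ord_ge t' F"
  by (auto simp: ord_ge_def)

lemma ord_ge_const_mult: "ord_ge t F \<Longrightarrow> ord_ge t (gconst c * F)"
  by (auto simp: ord_ge_def)

lemma ord_ge_XY: "t \<le> a + b \<Longrightarrow> ord_ge t (gX ^ a * gY ^ b)"
  by (auto simp: ord_ge_def cf_XY)

definition deg_less :: "nat \<Rightarrow> (nat \<times> nat) set" where
  "deg_less t = {(a, b). a + b < t}"

lemma deg_less_Suc: "deg_less (Suc t) = deg_less t \<union> (\<lambda>a. (a, t - a)) ` {..t}"
  by (auto simp: deg_less_def image_iff)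

lemma finite_deg_less [simp]: "finite (deg_less t)"
proof -
  have "deg_less t \<subseteq> {..<t} \<times> {..<t}" by (auto simp: deg_less_def)
  thus ?thesis by (rule finite_subset) simp
qed

lemma card_deg_less: "2 * card (deg_less t) = t * (t + 1)"
proof (induction t)
  case (Suc t)
  have "card (deg_less (Suc t)) = card (deg_less t) + card ((\<lambda>a. (a, t - a)) ` {..t})"
    unfolding deg_less_Suc by (rule card_Un_disjoint) (simp, simp, auto simp: deg_less_def)
  also have "card ((\<lambda>a. (a, t - a)) ` {..t}) = t + 1"
    by (subst card_image) (auto simp: inj_on_def)
  finally show ?case using Suc by simp
qed (simp add: deg_less_def)

text \<open>Since \<open>u\<close> has order at least \<open>m\<close>, terms of \<open>A\<close> of
  degree \<open>n\<close> or more only affect degrees from \<open>m + n\<close> on. This leaves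
  finitely many unknowns for the count that follows.\<close>

lemma cf_mult_deg_less:
  assumes u: "ord_ge m u" and s: "a + b < m + n"
  shows "cf (A * u) a b = (\<Sum>(i,j)\<in>deg_less n. cf A i j * cf (gX ^ i * gY ^ j * u) a b)"
proof -
  have "cf (A * u) a b = (\<Sum>(i,j)\<in>{..a}\<times>{..b}. cf A i j * cf u (a - i) (b - j))"
    unfolding cf_mult by (simp add: sum.cartesian_product)
  also have "\<dots> = (\<Sum>(i,j)\<in>{..a}\<times>{..b}. cf A i j * cf (gX ^ i * gY ^ j * u) a b)"
    by (intro sum.cong) (auto simp: cf_XY_mult)
  also have "\<dots> = (\<Sum>(i,j)\<in>deg_less n. cf A i j * cf (gX ^ i * gY ^ j * u) a b)"
  proof -
    let ?h = "\<lambda>(i,j). cf A i j * cf (gX ^ i * gY ^ j * u) a b"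
    have "sum ?h ({..a}\<times>{..b}) = sum ?h ({..a}\<times>{..b} \<union> deg_less n)"
      by (intro sum.mono_neutral_left) (auto simp: cf_XY_mult split: if_splits)
    also have "\<dots> = sum ?h (deg_less n)"
    proof (intro sum.mono_neutral_right ballI)
      fix p assume p: "p \<in> {..a}\<times>{..b} \<union> deg_less n - deg_less n"
      obtain i j where ij: "p = (i, j)" by (cases p)
      have "(a - i) + (b - j) < m" using s p by (auto simp: deg_less_def ij)
      thus "?h p = 0" using u by (auto simp: cf_XY_mult ord_ge_def ij)
    qed auto
    finally show ?thesis .
  qed
  finally show ?thesis .
qed

text \<open>Modulo monomials of degree \<open>m + n\<close>, the ideal is spanned by too few multiples of \<open>u\<close> and \<open>w\<close>.\<close>

lemma colength_ge_order_product:
  assumes u: "ord_ge m u" and w: "ord_ge n w" and sp: "spans (ideal2 u w) k"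
  shows "m * n \<le> k"
proof -
  let ?S = "deg_less (m + n)"
  obtain g where g: "\<And>h. \<exists>c. h - lincomb k c g \<in> ideal2 u w" using sp unfolding spans_def by blast
  have "\<exists>c A B. gX ^ fst s * gY ^ snd s = lincomb k c g + A * u + B * w" for s
  proof -
    obtain c where "gX ^ fst s * gY ^ snd s - lincomb k c g \<in> ideal2 u w" using g by blast
    then obtain A B where "gX ^ fst s * gY ^ snd s - lincomb k c g = A * u + B * w" by (auto simp: ideal2_def)
    hence "gX ^ fst s * gY ^ snd s = lincomb k c g + A * u + B * w" by (simp add: algebra_simps)
    thus ?thesis by blast
  qed
  then obtain c A B where cAB: "\<And>s. gX ^ fst s * gY ^ snd s = lincomb k (c s) g + A s * u + B s * w" by metis
  \<comment> \<open>Indexes the \<open>k\<close> spanning germs, the multiples of \<open>u\<close>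
    by monomials of degree below \<open>n\<close>, and those of \<open>w\<close> by monomials of
    degree below \<open>m\<close>.\<close>
  define T where "T = {..<k} <+> (deg_less n <+> deg_less m)"
  define C where "C = (\<lambda>s t. case t of Inl i \<Rightarrow> c s i | Inr (Inl (i, j)) \<Rightarrow> cf (A s) i j | Inr (Inr (i, j)) \<Rightarrow> cf (B s) i j)"
  define W where "W = (\<lambda>t s. case t of Inl i \<Rightarrow> cf (g i) (fst s) (snd s)
     | Inr (Inl (i, j)) \<Rightarrow> cf (gX ^ i * gY ^ j * u) (fst s) (snd s)
     | Inr (Inr (i, j)) \<Rightarrow> cf (gX ^ i * gY ^ j * w) (fst s) (snd s))"
  have "card ?S \<le> card T"
  proof (rule card_le_if_indicators_span[where c = C and w = W])
    fix s s' assume s: "s \<in> ?S" "s' \<in> ?S"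
    obtain a b where ab: "s' = (a, b)" by (cases s')
    have "(if s' = s then 1 else 0) = cf (gX ^ fst s * gY ^ snd s) a b"
      by (auto simp: cf_XY ab prod_eq_iff)
    also have "\<dots> = (\<Sum>i<k. c s i * cf (g i) a b) + cf (A s * u) a b + cf (B s * w) a b"
      by (subst cAB) (simp add: lincomb_def)
    also have "cf (A s * u) a b = (\<Sum>(i,j)\<in>deg_less n. cf (A s) i j * cf (gX ^ i * gY ^ j * u) a b)"
      using s ab by (intro cf_mult_deg_less[OF u]) (auto simp: deg_less_def)
    also have "cf (B s * w) a b = (\<Sum>(i,j)\<in>deg_less m. cf (B s) i j * cf (gX ^ i * gY ^ j * w) a b)"
      using s ab by (intro cf_mult_deg_less[OF w]) (auto simp: deg_less_def add.commute)
    finally show "(if s' = s then 1 else 0) = (\<Sum>t\<in>T. C s t * W t s')"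
      unfolding T_def C_def W_def ab by (simp add: sum.Plus case_prod_unfold)
  qed (auto simp: T_def)
  also have "card T = k + (card (deg_less n) + card (deg_less m))"
    unfolding T_def by (simp add: card_Plus)
  \<comment> \<open>With triangular numbers,
    \<open>(m + n) * (m + n + 1) - m * (m + 1) - n * (n + 1)\<close> is
    \<open>2 * m * n\<close>.\<close>
  finally have "2 * card ?S \<le> 2 * k + (2 * card (deg_less n) + 2 * card (deg_less m))" by simp
  thus ?thesis unfolding card_deg_less by (simp add: algebra_simps)
qed

text \<open>Gaussian elimination: \<open>1 - l i0\<close> is a unit, so the relation for
  \<open>i0\<close> can be solved for \<open>z i0\<close> and substituted into the others, whose
  coefficients keep vanishing at the origin.\<close>

lemma nakayama:
  assumes J: "gideal J" and I: "finite I"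
    and z: "\<And>i. i \<in> I \<Longrightarrow> \<exists>l. (\<forall>k\<in>I. cf (l k) 0 0 = 0) \<and> z i - (\<Sum>k\<in>I. l k * z k) \<in> J"
  shows "i \<in> I \<Longrightarrow> z i \<in> J"
  using I z
proof (induction I arbitrary: i rule: finite_induct)
  case (insert i0 I)
  note J' = gidealD[OF J]
  obtain l where l: "cf (l i0) 0 0 = 0" "\<And>k. k \<in> I \<Longrightarrow> cf (l k) 0 0 = 0"
    "z i0 - (\<Sum>k\<in>insert i0 I. l k * z k) \<in> J" using insert.prems(2)[of i0] by auto
  have "cf (1 - l i0) 0 0 \<noteq> 0" using l(1) by (simp add: cf_1)
  then obtain U where U: "(1 - l i0) * U = 1" using germ_unit by blast
  define s where "s = (\<Sum>k\<in>I. l k * z k)"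
  have "U * (z i0 - (\<Sum>k\<in>insert i0 I. l k * z k)) = ((1 - l i0) * U) * z i0 - U * s"
    using insert.hyps by (simp add: s_def algebra_simps)
  hence z0: "z i0 - U * s \<in> J" using l(3) J'(3)[of _ U] U by (metis mult_1)
  have IH: "z k \<in> J" if "k \<in> I" for k
  proof (rule insert.IH[OF that])
    fix m assume m: "m \<in> I"
    then obtain r where r: "\<And>k. k \<in> insert i0 I \<Longrightarrow> cf (r k) 0 0 = 0"
      "z m - (\<Sum>k\<in>insert i0 I. r k * z k) \<in> J" using insert.prems(2)[of m] by auto
    define q where "q = (\<lambda>k. r k + r i0 * U * l k)"
    have "z m - (\<Sum>k\<in>I. q k * z k) = (z m - (\<Sum>k\<in>insert i0 I. r k * z k)) + r i0 * (z i0 - U * s)"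
      using insert.hyps by (simp add: q_def s_def algebra_simps sum.distrib sum_distrib_left)
    also have "\<dots> \<in> J" using r(2) z0 J' by auto
    finally show "\<exists>l. (\<forall>k\<in>I. cf (l k) 0 0 = 0) \<and> z m - (\<Sum>k\<in>I. l k * z k) \<in> J"
      using r(1) l by (intro exI[of _ q]) (auto simp: q_def cf00_mult)
  qed
  have "s \<in> J" unfolding s_def using IH by (intro gideal_sum[OF J] J') auto
  hence "z i0 \<in> J" using z0 J'(2)[OF z0, of "U * s"] J'(3) by simp
  thus ?case using insert.prems(1) IH by auto
qed simp

text \<open>The terms free of x are divisible by \<open>gY ^ N\<close>; the rest is x times a germ
  of order \<open>N - 1\<close>.\<close>

lemma ord_ge_decompose:
  assumes "ord_ge N F"
  shows "\<exists>G. F = (\<Sum>k\<le>N. G k * (gX ^ k * gY ^ (N - k)))"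
  using assms
proof (induction N arbitrary: F)
  case (Suc N)
  define F0 where "F0 = F - gX * shX F"
  have F0: "cf F0 a b = (if a = 0 then cf F 0 b else 0)" for a b
    by (auto simp: F0_def cf_X_mult gr0_conv_Suc)
  have "\<exists>U. F0 = gY ^ k * U \<and> (\<forall>a b. cf U a b = cf F0 a (b + k))" if "k \<le> Suc N" for k
    using that
  proof (induction k)
    case (Suc k)
    then obtain U where U: "F0 = gY ^ k * U" "\<forall>a b. cf U a b = cf F0 a (b + k)" by auto
    have "cf U a 0 = 0" for a using U(2) Suc.prems \<open>ord_ge (Suc N) F\<close> by (auto simp: F0 ord_ge_def)
    from Y_dvd_germ[OF this] have "F0 = gY ^ Suc k * shY U" using U(1) by (metis mult.left_commute mult.assoc power_Suc)
    thus ?case using U(2) by (intro exI[of _ "shY U"]) auto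
  qed (intro exI[of _ F0], auto)
  then obtain U where U: "F0 = gY ^ Suc N * U" by blast
  have "ord_ge N (shX F)" using Suc.prems by (auto simp: ord_ge_def)
  from Suc.IH[OF this] obtain G where G: "shX F = (\<Sum>k\<le>N. G k * (gX ^ k * gY ^ (N - k)))" by blast
  define G' where "G' = (\<lambda>k. case k of 0 \<Rightarrow> U | Suc k \<Rightarrow> G k)"
  have "F = F0 + gX * shX F" by (simp add: F0_def)
  also have "\<dots> = (\<Sum>k\<le>Suc N. G' k * (gX ^ k * gY ^ (Suc N - k)))"
    unfolding sum.atMost_Suc_shift G'_def by (simp add: U G sum_distrib_left mult_ac)
  finally show ?case by blast
next
  case (0 F)
  show ?case by (rule exI[of _ "\<lambda>_. F"]) simp
qed

text \<open>The initial forms \<open>y^e\<close> and one containing \<open>x^M\<close> have no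
  common factor, so the multiplicity is the product of the orders. The monomials
  \<open>x^a y^b\<close> with \<open>a < M\<close>, \<open>b < e\<close> span the quotient.\<close>

lemma isect_semihomogeneous:
  assumes B: "cf B 0 e \<noteq> 0" "\<And>a b. a + b \<le> e \<Longrightarrow> (a, b) \<noteq> (0, e) \<Longrightarrow> cf B a b = 0"
    and v: "ord_ge M v" "cf v M 0 \<noteq> 0"
  shows "isect B v (e * M)"
proof -
  define J where "J = ideal2 B v"
  have Jid: "gideal J" by (simp add: J_def)
  note J = gidealD[OF Jid]
  have BJ: "B \<in> J" and vJ: "v \<in> J" by (auto simp: J_def)
  define Bs where "Bs = {..<M} \<times> {..<e}"
  define mono where "mono = (\<lambda>s. gX ^ fst s * gY ^ snd s)"
  \<comment> \<open>Modulo \<open>J\<close> and terms of degree above \<open>t\<close>,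
    \<open>F\<close> is a combination of basis monomials of degree exactly \<open>t\<close>.
    Exactness matters in degree \<open>N\<close> below, where no basis monomial is left.\<close>
  define good where "good = (\<lambda>t F. \<exists>c j. j \<in> J \<and> (\<forall>s\<in>Bs. fst s + snd s \<noteq> t \<longrightarrow> c s = 0)
      \<and> ord_ge (Suc t) (F - (\<Sum>s\<in>Bs. gconst (c s) * mono s) - j))"
  have finBs: "finite Bs" by (simp add: Bs_def)
  have goodI0: "good t F" if "ord_ge (Suc t) (F - j)" "j \<in> J" for t F j
    unfolding good_def using that by (intro exI[of _ "\<lambda>_. 0"] exI[of _ j]) auto
  have good_add: "good t (F + G)" if "good t F" "good t G" for t F G
  proof -
    from that obtain c j c' j' where *: "j \<in> J" "j' \<in> J"
      "\<forall>s\<in>Bs. fst s + snd s \<noteq> t \<longrightarrow> c s = 0" "\<forall>s\<in>Bs. fst s + snd s \<noteq> t \<longrightarrow> c' s = 0"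
      and o: "ord_ge (Suc t) (F - (\<Sum>s\<in>Bs. gconst (c s) * mono s) - j)"
        "ord_ge (Suc t) (G - (\<Sum>s\<in>Bs. gconst (c' s) * mono s) - j')" unfolding good_def by blast
    have "F + G - (\<Sum>s\<in>Bs. gconst (c s + c' s) * mono s) - (j + j') =
      (F - (\<Sum>s\<in>Bs. gconst (c s) * mono s) - j) + (G - (\<Sum>s\<in>Bs. gconst (c' s) * mono s) - j')"
      by (simp add: algebra_simps sum.distrib)
    hence "ord_ge (Suc t) (F + G - (\<Sum>s\<in>Bs. gconst (c s + c' s) * mono s) - (j + j'))"
      using ord_ge_add[OF o] by (simp only:)
    thus ?thesis unfolding good_def using *
      by (intro exI[of _ "\<lambda>s. c s + c' s"] exI[of _ "j + j'"]) (auto simp del: gconst_simps intro: J)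
  qed
  have good_scale: "good t (gconst r * F)" if "good t F" for t F r
  proof -
    from that obtain c j where *: "j \<in> J" "\<forall>s\<in>Bs. fst s + snd s \<noteq> t \<longrightarrow> c s = 0"
      and o: "ord_ge (Suc t) (F - (\<Sum>s\<in>Bs. gconst (c s) * mono s) - j)" unfolding good_def by blast
    have "gconst r * F - (\<Sum>s\<in>Bs. gconst (r * c s) * mono s) - gconst r * j =
      gconst r * (F - (\<Sum>s\<in>Bs. gconst (c s) * mono s) - j)"
      by (simp add: algebra_simps sum_distrib_left gconst_mult)
    hence "ord_ge (Suc t) (gconst r * F - (\<Sum>s\<in>Bs. gconst (r * c s) * mono s) - gconst r * j)"
      using ord_ge_const_mult[OF o] by (simp only:)
    thus ?thesis unfolding good_def using *
      by (intro exI[of _ "\<lambda>s. r * c s"] exI[of _ "gconst r * j"]) (auto simp del: gconst_simps intro: J)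
  qed
  have good_sum: "good t (\<Sum>i\<in>A. H i)" if "\<And>i. i \<in> A \<Longrightarrow> good t (H i)" for t A and H :: "nat \<Rightarrow> germ"
    using that
  proof (induction A rule: infinite_finite_induct)
    case (insert i A)
    thus ?case by (simp add: good_add)
  qed (auto intro: goodI0[where j = 0] J)
  \<comment> \<open>Multiples of \<open>y^e\<close> are reduced by \<open>B\<close>, other multiples
    of \<open>x^M\<close> by \<open>v\<close>. The latter trades x for y, so induction on
    \<open>e - b\<close> terminates.\<close>
  have good_mono: "good (a + b) (gX ^ a * gY ^ b)" for a b
  proof (induction "e - b" arbitrary: a b rule: less_induct)
    case less
    show ?case
    proof (cases "b \<ge> e")
      case True
      define j where "j = gconst (inverse (cf B 0 e)) * (gX ^ a * gY ^ (b - e)) * B"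
      have "ord_ge (Suc (a + b)) (gX ^ a * gY ^ b - j)"
        unfolding ord_ge_def
      proof (intro allI impI)
        fix x y assume xy: "x + y < Suc (a + b)"
        have "cf j x y = (if x = a \<and> y = b then 1 else 0)"
          using True B(1) xy
          by (auto simp: j_def mult.assoc cf_X_power_mult cf_Y_power_mult intro!: B(2))
        thus "cf (gX ^ a * gY ^ b - j) x y = 0" by (simp add: cf_XY)
      qed
      thus ?thesis using J BJ by (intro goodI0[of _ _ j]) (auto simp: j_def)
    next
      case be: False
      show ?thesis
      proof (cases "a < M")
        case True
        with be have ab: "(a, b) \<in> Bs" by (simp add: Bs_def)
        define c where "c = (\<lambda>s. if s = (a, b) then 1 else (0::complex))"
        have "(\<Sum>s\<in>Bs. gconst (c s) * mono s) = (\<Sum>s\<in>Bs. if s = (a, b) then mono (a, b) else 0)"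
          by (intro sum.cong) (auto simp: c_def)
        also have "\<dots> = gX ^ a * gY ^ b" using ab finBs by (simp add: mono_def)
        finally show ?thesis unfolding good_def using J
          by (intro exI[of _ c] exI[of _ 0]) (auto simp: c_def)
      next
        case False
        define g where "g = inverse (cf v M 0)"
        define j where "j = gconst g * (gX ^ (a - M) * gY ^ b) * v"
        \<comment> \<open>The remaining terms of the initial form of \<open>j\<close>, moved to the
          other side; each has a higher power of y than \<open>gX ^ a * gY ^ b\<close>.\<close>
        define r where "r = (\<Sum>k\<in>{1..M}. gconst (- g * cf v (M - k) k) * (gX ^ (a - k) * gY ^ (b + k)))"
        have "good (a + b) r" unfolding r_def
        proof (intro good_sum good_scale)
          fix k assume k: "k \<in> {1..M}"
          have "good ((a - k) + (b + k)) (gX ^ (a - k) * gY ^ (b + k))"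
            using k be by (intro less) auto
          thus "good (a + b) (gX ^ (a - k) * gY ^ (b + k))" using k False by simp
        qed
        moreover have "good (a + b) (gX ^ a * gY ^ b - r)"
        proof (rule goodI0[of _ _ j])
          show "j \<in> J" using J vJ by (simp add: j_def)
          show "ord_ge (Suc (a + b)) (gX ^ a * gY ^ b - r - j)" unfolding ord_ge_def
          proof (intro allI impI)
            fix x y assume xy: "x + y < Suc (a + b)"
            have cj: "cf j x y = (if x < a - M \<or> y < b then 0 else g * cf v (x - (a - M)) (y - b))"
              by (simp add: j_def mult.assoc cf_X_power_mult cf_Y_power_mult)
            have cr: "cf r x y = (\<Sum>k\<in>{1..M}. if x = a - k \<and> y = b + k then - g * cf v (M - k) k else 0)"
              by (auto simp: r_def cf_XY intro!: sum.cong)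
            show "cf (gX ^ a * gY ^ b - r - j) x y = 0"
            proof (cases "x + y = a + b \<and> b \<le> y \<and> y \<le> b + M")
              case True
              define k where "k = y - b"
              have k: "y = b + k" "x = a - k" "k \<le> M" "k \<le> a" "a - k - (a - M) = M - k"
                using True False by (auto simp: k_def)
              have "cf r x y = (\<Sum>l\<in>{1..M}. if l = k then - g * cf v (M - k) k else 0)"
                unfolding cr using k by (intro sum.cong) auto
              also have "\<dots> = (if k = 0 then 0 else - g * cf v (M - k) k)" using k by auto
              finally have "cf r x y = (if k = 0 then 0 else - g * cf v (M - k) k)" .
              moreover have "cf j x y = g * cf v (M - k) k" using cj k False by auto
              moreover have "g * cf v M 0 = 1" using v(2) by (simp add: g_def)
              ultimately show ?thesis using k by (auto simp: cf_XY)
            next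
              case ne: False
              have "cf r x y = 0" unfolding cr using ne False by (intro sum.neutral) auto
              moreover have "cf j x y = 0"
              proof (cases "x < a - M \<or> y < b")
                case False
                hence "(x - (a - M)) + (y - b) < M" using ne xy \<open>\<not> a < M\<close> by auto
                thus ?thesis using v(1) cj by (auto simp: ord_ge_def)
              qed (use cj in auto)
              moreover have "\<not> (x = a \<and> y = b)" using ne by auto
              ultimately show ?thesis by (simp add: cf_XY)
            qed
          qed
        qed
        ultimately show ?thesis using good_add[of "a + b" "gX ^ a * gY ^ b - r" r] by simp
      qed
    qed
  qed
  have good_ord: "good t F" if F: "ord_ge t F" for t F
  proof -
    define H where "H = (\<Sum>a\<le>t. gconst (cf F a (t - a)) * (gX ^ a * gY ^ (t - a)))"
    have "good t H" unfolding H_def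
    proof (intro good_sum good_scale)
      fix a assume "a \<in> {..t}"
      thus "good t (gX ^ a * gY ^ (t - a))" using good_mono[of a "t - a"] by simp
    qed
    moreover have "ord_ge (Suc t) (F - H)" unfolding ord_ge_def
    proof (intro allI impI)
      fix x y assume xy: "x + y < Suc t"
      have "cf H x y = (\<Sum>a\<le>t. if a = x then (if x + y = t then cf F x y else 0) else 0)"
        unfolding H_def cf_sum using xy by (intro sum.cong) (auto simp: cf_XY)
      also have "\<dots> = (if x + y = t then cf F x y else 0)" using xy by auto
      finally show "cf (F - H) x y = 0" using F xy by (auto simp: ord_ge_def)
    qed
    hence "good t (F - H)" using J by (intro goodI0[where j = 0]) auto
    ultimately show ?thesis using good_add[of t "F - H" H] by simp
  qed
  \<comment> \<open>Every basis monomial has smaller degree, so a germ of order \<open>N\<close>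
    lies in \<open>J\<close> up to order \<open>N + 1\<close>. Nakayama's lemma removes this error
    for the monomials of degree \<open>N\<close>.\<close>
  define N where "N = e + M"
  have high: "\<exists>j\<in>J. ord_ge (Suc N) (F - j)" if F: "ord_ge N F" for F
  proof -
    from good_ord[OF F] obtain c j where *: "j \<in> J" "\<forall>s\<in>Bs. fst s + snd s \<noteq> N \<longrightarrow> c s = 0"
      "ord_ge (Suc N) (F - (\<Sum>s\<in>Bs. gconst (c s) * mono s) - j)" unfolding good_def by blast
    have "c s = 0" if "s \<in> Bs" for s using *(2) that by (auto simp: Bs_def N_def)
    hence "(\<Sum>s\<in>Bs. gconst (c s) * mono s) = 0" by simp
    thus ?thesis using * by auto
  qed
  have gens: "gX ^ i * gY ^ (N - i) \<in> J" if "i \<in> {..N}" for i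
  proof (rule nakayama[OF Jid _ _ that, where z = "\<lambda>i. gX ^ i * gY ^ (N - i)"])
    fix i assume i: "i \<in> {..N}"
    hence "ord_ge N (gX ^ i * gY ^ (N - i))" by (intro ord_ge_XY) auto
    from high[OF this] obtain j where j: "j \<in> J" and o: "ord_ge (Suc N) (gX ^ i * gY ^ (N - i) - j)" by blast
    obtain l where l: "gX ^ i * gY ^ (N - i) - j = (\<Sum>k\<le>N. l k * (gX ^ k * gY ^ (N - k)))"
      using ord_ge_decompose[OF ord_ge_mono[OF o, of N]] by auto
    have "cf (l k) 0 0 = 0" if "k \<le> N" for k
    proof -
      have "0 = cf (\<Sum>m\<le>N. l m * (gX ^ m * gY ^ (N - m))) k (N - k)"
        using o that unfolding l by (auto simp: ord_ge_def)
      also have "\<dots> = (\<Sum>m\<le>N. if m = k then cf (l k) 0 0 else 0)"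
        unfolding cf_sum using that
        by (intro sum.cong) (auto simp: cf_XY_mult mult.commute[of "l _"])
      also have "\<dots> = cf (l k) 0 0" using that by auto
      finally show ?thesis by simp
    qed
    moreover have "gX ^ i * gY ^ (N - i) - (\<Sum>k\<in>{..N}. l k * (gX ^ k * gY ^ (N - k))) \<in> J"
      using j by (simp flip: l)
    ultimately show "\<exists>l. (\<forall>k\<in>{..N}. cf (l k) 0 0 = 0) \<and>
       gX ^ i * gY ^ (N - i) - (\<Sum>k\<in>{..N}. l k * (gX ^ k * gY ^ (N - k))) \<in> J"
      by (intro exI[of _ l]) auto
  qed simp
  have sp: "\<exists>c. F - (\<Sum>s\<in>Bs. gconst (c s) * mono s) \<in> J" if "ord_ge t F" for t F
    using that
  proof (induction "N - t" arbitrary: t F rule: less_induct)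
    case less
    show ?case
    proof (cases "t \<ge> N")
      case True
      then obtain G where G: "F = (\<Sum>k\<le>N. G k * (gX ^ k * gY ^ (N - k)))"
        using ord_ge_decompose[of N F] less.prems ord_ge_mono by blast
      have "F \<in> J" unfolding G by (intro gideal_sum[OF Jid]) (rule J(3)[OF gens])
      thus ?thesis by (intro exI[of _ "\<lambda>_. 0"]) simp
    next
      case False
      from good_ord[OF less.prems] obtain c j where *: "j \<in> J"
        "ord_ge (Suc t) (F - (\<Sum>s\<in>Bs. gconst (c s) * mono s) - j)" unfolding good_def by blast
      have "N - Suc t < N - t" using False by simp
      from less.hyps[OF this *(2)] obtain c' where
        c': "F - (\<Sum>s\<in>Bs. gconst (c s) * mono s) - j - (\<Sum>s\<in>Bs. gconst (c' s) * mono s) \<in> J" by blast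
      have "F - (\<Sum>s\<in>Bs. gconst (c s + c' s) * mono s) =
          (F - (\<Sum>s\<in>Bs. gconst (c s) * mono s) - j - (\<Sum>s\<in>Bs. gconst (c' s) * mono s)) + j"
        by (simp add: algebra_simps sum.distrib)
      hence "F - (\<Sum>s\<in>Bs. gconst (c s + c' s) * mono s) \<in> J"
        using J(2)[OF c' *(1)] by (simp only:)
      thus ?thesis by (intro exI)
    qed
  qed
  have "spans J (card Bs)" by (rule spans_finite[OF finBs, where g = mono]) (rule sp[OF ord_ge_0(1)])
  hence "spans J (e * M)" by (simp add: Bs_def mult.commute)
  \<comment> \<open>The lower bound is the general one by the product of the orders.\<close>
  moreover have "ord_ge e B" unfolding ord_ge_def using B(2) by auto
  hence "e * M \<le> k" if "spans J k" for k
    using colength_ge_order_product[OF _ v(1)] that by (auto simp: J_def)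
  ultimately show ?thesis unfolding isect_def colen_def J_def[symmetric] by (meson not_le)
qed

text \<open>\<open>\<kappa> = 0\<close> and \<open>\<kappa> = 1\<close> serve for the gradients of \<open>G\<close> and \<open>y G\<close>, since
  \<open>\<partial>\<^sub>y (y G) = G + y \<partial>\<^sub>y G\<close>.\<close>

lemma isect_two_edges:
  fixes e i j n \<kappa> :: nat and G :: germ
  assumes G: "cf G 0 e \<noteq> 0" "cf G i j \<noteq> 0" "cf G n 0 \<noteq> 0"
    and supp: "\<And>a b. a + b < n \<Longrightarrow> (a, b) \<noteq> (0, e) \<Longrightarrow> (a, b) \<noteq> (i, j) \<Longrightarrow> cf G a b = 0"
    and ij: "1 \<le> i" "1 \<le> j" "i + j \<le> e" "e < n"
  shows "isect (dX G) (gconst (of_nat \<kappa>) * G + gY * dY G) (e * (i - 1) + j * n)"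
proof -
  define D where "D = gconst (of_nat \<kappa>) * G + gY * dY G"
  define A where "A = dX G"
  \<comment> \<open>\<open>D\<close> and \<open>gX * A\<close> multiply the coefficient of
    \<open>x^a y^b\<close> in \<open>G\<close> by \<open>\<kappa> + b\<close> and by
    \<open>a\<close>. The combination has factor
    \<open>i * (\<kappa> + b) - (j + \<kappa>) * a\<close>, which vanishes at \<open>(i, j)\<close>
    and leaves only \<open>y^e\<close> below degree \<open>n\<close>.\<close>
  define B where "B = gconst (of_nat i) * D - gconst (of_nat (j + \<kappa>)) * (gX * A)"
  define \<beta> where "\<beta> = of_nat (i * (\<kappa> + e)) * cf G 0 e"
  \<comment> \<open>Cancels the common monomial \<open>x^(i-1) y^e\<close> of
    \<open>gY ^ (e - j) * A\<close> and \<open>gX ^ (i - 1) * B\<close>. Because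
    \<open>i + j \<le> e\<close>, the rest has order at least \<open>n + i - 1\<close>, and its pure
    power of x in that degree comes from \<open>B\<close> alone.\<close>
  define v where "v = gconst \<beta> * (gY ^ (e - j) * A) - gconst (of_nat i * cf G i j) * (gX ^ (i - 1) * B)"
  have D: "cf D a b = of_nat (\<kappa> + b) * cf G a b" for a b
    by (cases b) (simp_all add: D_def cf_Y_mult distrib_right)
  have XA: "cf (gX * A) a b = of_nat a * cf G a b" for a b
    by (cases a) (auto simp: A_def cf_X_mult)
  have B: "cf B a b = (of_nat (i * (\<kappa> + b)) - of_nat ((j + \<kappa>) * a)) * cf G a b" for a b
    unfolding B_def cf_diff cf_const_mult D XA by (simp add: algebra_simps)
  have B0: "cf B 0 e \<noteq> 0" using G(1) ij by (simp add: B del: of_nat_add of_nat_mult)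
  have Blow: "cf B a b = 0" if "a + b < n" "(a, b) \<noteq> (0, e)" for a b
  proof (cases "(a, b) = (i, j)")
    case True
    have "i * (\<kappa> + j) = (j + \<kappa>) * i" by (simp add: algebra_simps)
    thus ?thesis using True by (simp only: B prod.inject) (simp add: algebra_simps)
  qed (use supp[OF that] in \<open>simp add: B\<close>)
  \<comment> \<open>The factor here is \<open>i * \<kappa> - (j + \<kappa>) * n\<close>, negative
    since \<open>i \<le> n\<close> and \<open>j\<close>, \<open>n\<close> are positive.\<close>
  have Bn: "cf B n 0 \<noteq> 0"
  proof -
    have "i * \<kappa> < (j + \<kappa>) * n"
    proof -
      have "i \<le> n" using ij by simp
      hence "i * \<kappa> \<le> \<kappa> * n" by (simp add: mult.commute)
      moreover have "0 < j * n" using ij by simp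
      ultimately show ?thesis unfolding add_mult_distrib by linarith
    qed
    hence "of_nat (i * \<kappa>) \<noteq> (of_nat ((j + \<kappa>) * n) :: complex)" unfolding of_nat_eq_iff by simp
    thus ?thesis using G(3) by (simp add: B)
  qed
  have cfv: "cf v a b = \<beta> * (if b < e - j then 0 else of_nat (Suc a) * cf G (Suc a) (b - (e - j)))
      - of_nat i * cf G i j * (if a < i - 1 then 0 else cf B (a - (i - 1)) b)" for a b
    by (simp add: v_def A_def cf_X_power_mult cf_Y_power_mult)
  have "isect B v (e * (n + i - 1))"
  proof (rule isect_semihomogeneous)
    show "cf B 0 e \<noteq> 0" by (rule B0)
    show "cf B a b = 0" if "a + b \<le> e" "(a, b) \<noteq> (0, e)" for a b using Blow that ij by auto
    have "cf v (n + i - 1) 0 = - of_nat i * cf G i j * cf B n 0"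
      unfolding cfv using ij by (auto simp: )
    thus "cf v (n + i - 1) 0 \<noteq> 0" using Bn G(2) ij by auto
    show "ord_ge (n + i - 1) v" unfolding ord_ge_def
    proof (intro allI impI)
      fix a b assume ab: "a + b < n + i - 1"
      show "cf v a b = 0"
      proof (cases "(a, b) = (i - 1, e)")
        case True
        have "cf v a b = \<beta> * (of_nat i * cf G i j) - of_nat i * cf G i j * cf B 0 e"
          unfolding cfv using True ij by auto
        also have "cf B 0 e = \<beta>" by (simp add: B \<beta>_def)
        finally show ?thesis by simp
      next
        case False
        have 1: "cf G (Suc a) (b - (e - j)) = 0" if "b \<ge> e - j"
          using False ab that ij by (intro supp) auto
        have 2: "cf B (a - (i - 1)) b = 0" if "a \<ge> i - 1"
          using False ab that ij by (intro Blow) auto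
        show ?thesis unfolding cfv using 1 2 by auto
      qed
    qed
  qed
  moreover have "ideal2 B v = ideal2 (gY ^ (e - j) * A) B"
  proof (rule ideal2_eqI)
    have "v = gconst \<beta> * (gY ^ (e - j) * A) + (- gconst (of_nat i * cf G i j) * gX ^ (i - 1)) * B"
      by (simp add: v_def mult.assoc)
    thus "v \<in> ideal2 (gY ^ (e - j) * A) B" using ideal2I by metis
    have "\<beta> \<noteq> 0" using G(1) ij by (simp add: \<beta>_def del: of_nat_add of_nat_mult)
    hence "gconst (inverse \<beta>) * gconst \<beta> = 1" by (simp flip: gconst_mult)
    hence "gY ^ (e - j) * A = gconst (inverse \<beta>) * (gconst \<beta> * (gY ^ (e - j) * A))"
      by (simp only: mult.assoc[symmetric] mult_1)
    also have "gconst \<beta> * (gY ^ (e - j) * A) = v + (gconst (of_nat i * cf G i j) * gX ^ (i - 1)) * B"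
      by (simp add: v_def mult.assoc)
    also have "gconst (inverse \<beta>) * \<dots> \<in> ideal2 B v" by (intro gidealD(2,3)) auto
    finally show "gY ^ (e - j) * A \<in> ideal2 B v" .
  qed auto
  ultimately have 1: "isect (gY ^ (e - j) * A) B (e * (n + i - 1))" using isect_ideal_cong by blast
  \<comment> \<open>The factor \<open>gY ^ (e - j)\<close> was brought in only for the cancellation;
    its contribution \<open>(e - j) * n\<close> is now subtracted.\<close>
  have "isect gY B n" using Bn Blow ij by (intro isect_Y) auto
  hence 2: "isect (gY ^ (e - j)) B ((e - j) * n)" by (rule isect_power)
  have AB: "isect A B (e * (n + i - 1) - (e - j) * n)" using isect_cancel[OF 1 2] by blast
  have "(e - j) * n + (e * (i - 1) + j * n) = e * (n + i - 1)"
    using ij by (cases i) (auto simp: algebra_simps diff_mult_distrib)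
  hence "isect A B (e * (i - 1) + j * n)" using AB by (metis add_diff_cancel_left')
  moreover have "ideal2 A B = ideal2 A D"
  proof (rule ideal2_eqI)
    show "B \<in> ideal2 A D" unfolding B_def by (intro gidealD(3,6)) auto
    have "gconst (inverse (of_nat i)) * gconst (of_nat i) = 1" using ij by (simp flip: gconst_mult)
    hence "D = gconst (inverse (of_nat i)) * (gconst (of_nat i) * D)"
      by (simp only: mult.assoc[symmetric] mult_1)
    also have "gconst (of_nat i) * D = B + gconst (of_nat (j + \<kappa>)) * (gX * A)" by (simp add: B_def)
    also have "gconst (inverse (of_nat i)) * \<dots> \<in> ideal2 A B"
      by (intro gidealD(2,3)) auto
    finally show "D \<in> ideal2 A B" .
  qed auto
  ultimately show ?thesis unfolding A_def D_def using isect_ideal_cong by blast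
qed

text \<open>Without a middle monomial the generators already have the shape of
  \<open>isect_semihomogeneous\<close>, and no elimination takes place.\<close>

lemma isect_one_edge:
  fixes e n \<kappa> :: nat and G :: germ
  assumes G: "cf G 0 e \<noteq> 0" "cf G n 0 \<noteq> 0" "1 \<le> e" "e < n"
    and supp: "\<And>a b. a + b < n \<Longrightarrow> (a, b) \<noteq> (0, e) \<Longrightarrow> cf G a b = 0"
  shows "isect (dX G) (gconst (of_nat \<kappa>) * G + gY * dY G) (e * (n - 1))"
    and "isect (dX G) (dY G) ((e - 1) * (n - 1))"
proof -
  have X: "cf (dX G) (n - 1) 0 \<noteq> 0" "ord_ge (n - 1) (dX G)"
    using G supp by (auto simp: ord_ge_def simp del: of_nat_Suc)
  have D: "cf (gconst (of_nat \<kappa>) * G + gY * dY G) a b = of_nat (\<kappa> + b) * cf G a b" for a b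
    by (cases b) (simp_all add: cf_Y_mult distrib_right)
  have "isect (gconst (of_nat \<kappa>) * G + gY * dY G) (dX G) (e * (n - 1))"
  proof (rule isect_semihomogeneous[OF _ _ X(2,1)])
    show "cf (gconst (of_nat \<kappa>) * G + gY * dY G) 0 e \<noteq> 0"
      unfolding D using G by (simp del: of_nat_add)
    show "cf (gconst (of_nat \<kappa>) * G + gY * dY G) a b = 0" if "a + b \<le> e" "(a, b) \<noteq> (0, e)" for a b
      unfolding D using supp[of a b] that G by simp
  qed
  thus "isect (dX G) (gconst (of_nat \<kappa>) * G + gY * dY G) (e * (n - 1))" by (simp add: isect_commute)
  have "isect (dY G) (dX G) ((e - 1) * (n - 1))"
  proof (rule isect_semihomogeneous[OF _ _ X(2,1)])
    show "cf (dY G) 0 (e - 1) \<noteq> 0" using G by (simp del: of_nat_Suc)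
    show "cf (dY G) a b = 0" if "a + b \<le> e - 1" "(a, b) \<noteq> (0, e - 1)" for a b
    proof -
      have "cf G a (Suc b) = 0" using that G by (intro supp) auto
      thus ?thesis by simp
    qed
  qed
  thus "isect (dX G) (dY G) ((e - 1) * (n - 1))" by (simp add: isect_commute)
qed

text \<open>The x-derivative of \<open>gY * G\<close> is \<open>gY * dX G\<close>. The axis accounts
  for \<open>n\<close>, the order of \<open>G\<close> restricted to it, and \<open>dX G\<close> for
  \<open>k\<close>.\<close>

lemma isect_gradient_Y_mult:
  assumes "isect (dX G) (gconst (of_nat 1) * G + gY * dY G) k"
    and "cf G n 0 \<noteq> 0" "\<And>a. a < n \<Longrightarrow> cf G a 0 = 0"
  shows "isect (dX (gY * G)) (dY (gY * G)) (n + k)"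
proof -
  have "isect gY (gconst (of_nat 1) * G + gY * dY G) n"
    using assms(2,3) by (intro isect_Y) (auto simp: cf_Y_mult)
  from isect_mult[OF this assms(1)] show ?thesis by (simp add: dX_mult dY_mult)
qed

text \<open>For \<open>\<kappa> = 0\<close> the second generator is \<open>gY * dY G\<close>; its
  factor y meets \<open>dX G\<close> with multiplicity \<open>n - 1\<close>.\<close>

lemma isect_gradient:
  assumes "isect (dX G) (gconst (of_nat 0) * G + gY * dY G) k"
    and "cf G n 0 \<noteq> 0" "\<And>a. a < n \<Longrightarrow> cf G a 0 = 0" "1 \<le> n"
  shows "isect (dX G) (dY G) (k - (n - 1))"
proof -
  have "isect (gY * dY G) (dX G) k" using assms(1) by (simp add: isect_commute)
  moreover have "isect gY (dX G) (n - 1)"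
    using assms(2-4) by (intro isect_Y) (auto simp del: of_nat_Suc)
  ultimately show ?thesis using isect_cancel isect_commute by blast
qed

section \<open>Germs and analytic functions\<close>

lemma powser_eq_0_imp:
  fixes c :: "nat \<Rightarrow> complex"
  assumes r: "r > 0" and s: "\<And>x. cmod x < r \<Longrightarrow> (\<lambda>n. c n * x ^ n) sums 0"
  shows "c n = 0"
proof (induction n rule: less_induct)
  case (less n)
  have "(\<lambda>k. c (k + n) * x ^ k) sums 0" if x: "x \<noteq> 0" "cmod x < r" for x
  proof -
    have "(\<lambda>k. c (k + n) * x ^ (k + n)) sums (0 - (\<Sum>i<n. c i * x ^ i))"
      by (rule sums_split_initial_segment[OF s[OF x(2)]])
    also have "(\<Sum>i<n. c i * x ^ i) = 0" using less by simp
    finally have "(\<lambda>k. inverse (x ^ n) * (c (k + n) * x ^ (k + n))) sums (inverse (x ^ n) * 0)"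
      by (intro sums_mult) simp
    also have "(\<lambda>k. inverse (x ^ n) * (c (k + n) * x ^ (k + n))) = (\<lambda>k. c (k + n) * x ^ k)"
      using x by (auto simp: power_add field_simps)
    finally show ?thesis by simp
  qed
  hence "((\<lambda>_::complex. 0) \<longlongrightarrow> c (0 + n)) (at 0)"
    by (rule powser_limit_0_strong[OF r, of "\<lambda>k. c (k + n)"])
  thus ?case by (simp add: tendsto_const_iff)
qed

section \<open>Translation between germs and functions near the origin\<close>

definition rep :: "germ \<Rightarrow> (complex \<Rightarrow> complex \<Rightarrow> complex) \<Rightarrow> bool" where
  "rep F f \<longleftrightarrow> (\<exists>r>0. \<forall>x y. cmod x < r \<longrightarrow> cmod y < r \<longrightarrow>
     ((\<lambda>(m,n). cf F m n * x ^ m * y ^ n) has_sum f x y) UNIV)"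

lemma rep_analytic: "rep F f \<Longrightarrow> analytic2_at 0 0 f"
  unfolding rep_def analytic2_at_def by auto

text \<open>Cauchy estimates: the terms of an absolutely convergent series at \<open>(r, r)\<close>
  are bounded by its sum \<open>C\<close>.\<close>

lemma gconv_if_summable:
  fixes a :: "nat \<Rightarrow> nat \<Rightarrow> complex"
  assumes r: "r > 0" and s: "(\<lambda>(m,n). a m n * of_real r ^ m * of_real r ^ n) summable_on UNIV"
  shows "gconv (Abs_fps (\<lambda>m. Abs_fps (a m)))"
proof -
  have abs: "(\<lambda>(m,n). cmod (a m n) * r ^ m * r ^ n) summable_on UNIV"
    using s r unfolding summable_on_iff_abs_summable_on_complex
    by (simp add: case_prod_unfold norm_mult norm_power)
  define C where "C = infsum (\<lambda>(m,n). cmod (a m n) * r ^ m * r ^ n) UNIV"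
  have C: "cmod (a m n) * r ^ m * r ^ n \<le> C" for m n
    using finite_sum_le_infsum[OF abs, of "{(m, n)}"] r unfolding C_def by (auto simp: case_prod_unfold)
  have "cmod (a 0 0) \<le> C" using C[of 0 0] by simp
  hence C0: "C \<ge> 0" using norm_ge_zero[of "a 0 0"] by linarith
  define K where "K = 1 + C + 1 / r"
  have K: "K \<ge> 1" "K \<ge> C" "K \<ge> 1 / r" using C0 r by (auto simp: K_def)
  have "cmod (a m n) \<le> K ^ (m + n + 1)" for m n
  proof -
    have "cmod (a m n) \<le> C * (1 / r) ^ (m + n)"
      using C[of m n] r by (simp add: field_simps power_add)
    also have "\<dots> \<le> K * K ^ (m + n)" using K C0 r by (intro mult_mono power_mono) auto
    finally show ?thesis by simp
  qed
  thus ?thesis using K(1) by (intro gconvI[of _ K]) auto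
qed

lemma analytic_imp_rep:
  assumes "analytic2_at 0 0 f" obtains F where "rep F f"
proof -
  from assms obtain r a where r: "r > 0" and
    a: "\<And>x y. cmod x < r \<Longrightarrow> cmod y < r \<Longrightarrow> ((\<lambda>(m,n). a m n * x ^ m * y ^ n) has_sum f x y) UNIV"
    unfolding analytic2_at_def by auto
  have "((\<lambda>(m,n). a m n * of_real (r/2) ^ m * of_real (r/2) ^ n) has_sum f (of_real (r/2)) (of_real (r/2))) UNIV"
    by (rule a) (use r in auto)
  hence "gconv (Abs_fps (\<lambda>m. Abs_fps (a m)))"
    using r by (intro gconv_if_summable[of "r/2"]) (auto simp: summable_on_def)
  hence cfa: "cf (Abs_germ (Abs_fps (\<lambda>m. Abs_fps (a m)))) m n = a m n" for m n
    by (simp add: cf.rep_eq Abs_germ_inverse)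
  have "rep (Abs_germ (Abs_fps (\<lambda>m. Abs_fps (a m)))) f"
    unfolding rep_def cfa using r a by blast
  thus ?thesis by (rule that)
qed

lemma germ_has_rep: "\<exists>f. rep F f"
proof -
  obtain K where K: "K \<ge> 1" "\<And>m n. cmod (cf F m n) \<le> K ^ (m + n + 1)"
    by (transfer, auto simp: gconv_def)
  \<comment> \<open>Inside this radius the terms are dominated by
    \<open>K / 2 ^ (m + n)\<close>.\<close>
  define r where "r = 1 / (2 * K)"
  have r: "r > 0" using K(1) by (simp add: r_def)
  have geo: "((\<lambda>n. c * (1/2) ^ n) has_sum (c * 2)) UNIV" for c :: real
  proof -
    have "((\<lambda>n. (1/2) ^ n :: real) has_sum 2) UNIV"
      using geometric_sums[of "1/2 :: real"] by (intro sums_nonneg_imp_has_sum) auto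
    thus ?thesis by (rule has_sum_cmult_right)
  qed
  have dom: "(\<lambda>(m,n). K * (1/2) ^ m * (1/2) ^ n) summable_on (UNIV \<times> UNIV)"
  proof (rule summable_on_SigmaI[where g = "\<lambda>m. K * 2 * (1/2) ^ m"])
    show "((\<lambda>n. case (m, n) of (m, n) \<Rightarrow> K * (1/2) ^ m * (1/2) ^ n) has_sum K * 2 * (1/2) ^ m) UNIV" for m :: nat
      using geo[of "K * (1/2) ^ m"] by (simp add: mult_ac)
    show "(\<lambda>m. K * 2 * (1/2) ^ m) summable_on UNIV" using geo[of "K * 2"] by (auto simp: summable_on_def)
  qed (use K(1) in auto)
  have "(\<lambda>(m,n). cf F m n * x ^ m * y ^ n) summable_on UNIV" if xy: "cmod x < r" "cmod y < r" for x y
  proof (rule abs_summable_summable, rule Infinite_Sum.abs_summable_on_comparison_test)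
    show "(\<lambda>p. norm (case p of (m,n) \<Rightarrow> K * (1/2) ^ m * (1/2) ^ n)) summable_on UNIV"
      using dom K(1) by (simp add: case_prod_unfold)
    fix p :: "nat \<times> nat"
    obtain m n where p: "p = (m, n)" by (cases p)
    have "cmod (cf F m n * x ^ m * y ^ n) \<le> K ^ (m + n + 1) * r ^ m * r ^ n"
      unfolding norm_mult norm_power using xy K r by (intro mult_mono power_mono) auto
    also have "\<dots> = K * (K * r) ^ m * (K * r) ^ n" by (simp add: power_add power_mult_distrib mult_ac)
    also have "K * r = 1 / 2" using K(1) by (simp add: r_def)
    finally show "norm (case p of (m, n) \<Rightarrow> cf F m n * x ^ m * y ^ n) \<le> norm (case p of (m, n) \<Rightarrow> K * (1/2) ^ m * (1/2) ^ n)"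
      using K(1) by (simp add: p)
  qed
  hence "rep F (\<lambda>x y. infsum (\<lambda>(m,n). cf F m n * x ^ m * y ^ n) UNIV)"
    unfolding rep_def using r by (intro exI[of _ r]) auto
  thus ?thesis by blast
qed

lemma rep_add: assumes "rep F f" "rep G g" shows "rep (F + G) (\<lambda>x y. f x y + g x y)"
proof -
  from assms obtain r s where r: "r > 0" "\<And>x y. cmod x < r \<Longrightarrow> cmod y < r \<Longrightarrow> ((\<lambda>(m,n). cf F m n * x ^ m * y ^ n) has_sum f x y) UNIV"
    and s: "s > 0" "\<And>x y. cmod x < s \<Longrightarrow> cmod y < s \<Longrightarrow> ((\<lambda>(m,n). cf G m n * x ^ m * y ^ n) has_sum g x y) UNIV"
    unfolding rep_def by auto
  have "((\<lambda>(m,n). cf (F + G) m n * x ^ m * y ^ n) has_sum f x y + g x y) UNIV"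
    if "cmod x < min r s" "cmod y < min r s" for x y
    using has_sum_add[OF r(2)[of x y] s(2)[of x y]] that
    by (simp add: case_prod_unfold distrib_right)
  thus ?thesis unfolding rep_def using r(1) s(1) by (intro exI[of _ "min r s"]) auto
qed

text \<open>Fubini along the fibres of \<open>e\<close>. It collects equal monomials in Cauchy
  products and after linear substitutions.\<close>

lemma has_sum_fibers:
  fixes t :: "'i \<Rightarrow> complex"
  assumes "(t has_sum S) I" "\<And>p. (t has_sum g p) {i\<in>I. e i = p}"
  shows "(g has_sum S) UNIV"
proof -
  have "((\<lambda>(p, i). t i) has_sum S) (Sigma UNIV (\<lambda>p. {i\<in>I. e i = p}))"
    using assms(1) by (rule has_sum_reindex_bij_witness[of _ "\<lambda>i. (e i, i)" snd, THEN iffD2, rotated -1]) auto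
  thus ?thesis by (rule has_sum_SigmaD) (use assms(2) in auto)
qed

lemma has_sum_product:
  fixes u :: "'a \<Rightarrow> complex" and v :: "'b \<Rightarrow> complex"
  assumes "(u has_sum a) A" "(v has_sum b) B"
  shows "((\<lambda>(i, j). u i * v j) has_sum (a * b)) (A \<times> B)"
proof (rule has_sum_SigmaI)
  show "((\<lambda>j. case (i, j) of (i, j) \<Rightarrow> u i * v j) has_sum u i * b) B" for i
    using has_sum_cmult_right[OF assms(2)] by simp
  show "((\<lambda>i. u i * b) has_sum a * b) A" using has_sum_cmult_left[OF assms(1)] by simp
  have u: "(\<lambda>i. cmod (u i)) summable_on A" and v: "(\<lambda>j. cmod (v j)) summable_on B"
    by (rule summable_on_iff_abs_summable_on_complex[THEN iffD1, OF has_sum_imp_summable[OF assms(1)]],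
        rule summable_on_iff_abs_summable_on_complex[THEN iffD1, OF has_sum_imp_summable[OF assms(2)]])
  have "(\<lambda>(i, j). cmod (u i) * cmod (v j)) summable_on A \<times> B"
  proof (rule summable_on_SigmaI)
    show "((\<lambda>j. case (i, j) of (i, j) \<Rightarrow> cmod (u i) * cmod (v j)) has_sum cmod (u i) * infsum (\<lambda>j. cmod (v j)) B) B" for i
      using has_sum_cmult_right[OF has_sum_infsum[OF v]] by simp
    show "(\<lambda>i. cmod (u i) * infsum (\<lambda>j. cmod (v j)) B) summable_on A" using u by (rule summable_on_cmult_left)
  qed auto
  thus "(\<lambda>(i, j). u i * v j) summable_on A \<times> B"
    by - (rule abs_summable_summable, simp add: case_prod_unfold norm_mult)
qed

lemma rep_mult: assumes "rep F f" "rep G g" shows "rep (F * G) (\<lambda>x y. f x y * g x y)"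
proof -
  from assms obtain r s where r: "r > 0" "\<And>x y. cmod x < r \<Longrightarrow> cmod y < r \<Longrightarrow> ((\<lambda>(m,n). cf F m n * x ^ m * y ^ n) has_sum f x y) UNIV"
    and s: "s > 0" "\<And>x y. cmod x < s \<Longrightarrow> cmod y < s \<Longrightarrow> ((\<lambda>(m,n). cf G m n * x ^ m * y ^ n) has_sum g x y) UNIV"
    unfolding rep_def by auto
  have "((\<lambda>(m,n). cf (F * G) m n * x ^ m * y ^ n) has_sum f x y * g x y) UNIV"
    if xy: "cmod x < min r s" "cmod y < min r s" for x y
  proof (rule has_sum_fibers)
    let ?u = "\<lambda>(m,n). cf F m n * x ^ m * y ^ n" and ?v = "\<lambda>(m,n). cf G m n * x ^ m * y ^ n"
    let ?e = "\<lambda>(p, q). (fst p + fst q, snd p + snd q)"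
    show "((\<lambda>(p, q). ?u p * ?v q) has_sum f x y * g x y) (UNIV \<times> UNIV)"
      using xy by (intro has_sum_product r s) auto
    fix p :: "nat \<times> nat"
    obtain a b where p: "p = (a, b)" by (cases p)
    have "((\<lambda>(i,j). cf F i j * cf G (a - i) (b - j) * (x ^ a * y ^ b)) has_sum (cf (F * G) a b * (x ^ a * y ^ b))) ({..a} \<times> {..b})"
      by (rule has_sum_finiteI) (auto simp: cf_mult sum.cartesian_product sum_distrib_right case_prod_unfold)
    hence "((\<lambda>(p, q). ?u p * ?v q) has_sum (cf (F * G) a b * (x ^ a * y ^ b))) {i \<in> UNIV \<times> UNIV. ?e i = p}"
    proof (rule has_sum_reindex_bij_witness[of _ "\<lambda>(i,j). ((i,j),(a - i,b - j))" fst, THEN iffD2, rotated -1])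
      fix q assume q: "q \<in> {i \<in> UNIV \<times> UNIV. ?e i = p}"
      obtain i j k l where ijkl: "q = ((i,j),(k,l))" by (metis prod.exhaust)
      have kl: "k = a - i" "l = b - j" "i \<le> a" "j \<le> b" using q by (auto simp: ijkl p)
      have "x ^ a = x ^ i * x ^ k" "y ^ b = y ^ j * y ^ l" using kl by (auto simp flip: power_add)
      thus "(case fst q of (i, j) \<Rightarrow> cf F i j * cf G (a - i) (b - j) * (x ^ a * y ^ b)) = (case q of (p, q) \<Rightarrow> ?u p * ?v q)"
        by (simp add: ijkl kl(1,2)[symmetric] mult_ac)
    qed (auto simp: p)
    thus "((\<lambda>(p, q). ?u p * ?v q) has_sum (case p of (a, b) \<Rightarrow> cf (F * G) a b * x ^ a * y ^ b)) {i \<in> UNIV \<times> UNIV. ?e i = p}"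
      by (simp add: p mult.assoc)
  qed
  thus ?thesis unfolding rep_def using r(1) s(1) by (intro exI[of _ "min r s"]) auto
qed

lemma rep_const: "rep (gconst c) (\<lambda>x y. c)"
  and rep_X: "rep gX (\<lambda>x y. x)" and rep_Y: "rep gY (\<lambda>x y. y)"
proof -
  have "((\<lambda>(m,n). cf (gconst c) m n * x ^ m * y ^ n) has_sum c) UNIV" for x y
    by (rule has_sum_finite_neutralI[of "{(0,0)}"]) (auto simp: cf_const split: if_splits)
  thus "rep (gconst c) (\<lambda>x y. c)" unfolding rep_def by (intro exI[of _ 1]) auto
  have "((\<lambda>(m,n). cf gX m n * x ^ m * y ^ n) has_sum x) UNIV" for x y
    by (rule has_sum_finite_neutralI[of "{(1,0)}"]) (auto split: if_splits)
  thus "rep gX (\<lambda>x y. x)" unfolding rep_def by (intro exI[of _ 1]) auto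
  have "((\<lambda>(m,n). cf gY m n * x ^ m * y ^ n) has_sum y) UNIV" for x y
    by (rule has_sum_finite_neutralI[of "{(0,1)}"]) (auto split: if_splits)
  thus "rep gY (\<lambda>x y. y)" unfolding rep_def by (intro exI[of _ 1]) auto
qed

lemma rep_diff: assumes "rep F f" "rep G g" shows "rep (F - G) (\<lambda>x y. f x y - g x y)"
  using rep_add[OF assms(1) rep_mult[OF rep_const[of "-1"] assms(2)]] by simp

lemma rep_sum: "(\<And>i. i \<in> A \<Longrightarrow> rep (H i) (h i)) \<Longrightarrow> rep (\<Sum>i\<in>A. H i) (\<lambda>x y. \<Sum>i\<in>A. h i x y)"
proof (induction A rule: infinite_finite_induct)
  case (insert i A)
  thus ?case using rep_add[of "H i" "h i"] by simp
qed (use rep_const[of 0] in auto)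

text \<open>One-variable uniqueness is applied twice: in x for fixed y, giving
  \<open>c y m = 0\<close>, and then in y to the series defining \<open>c y m\<close>.\<close>

lemma rep_0_unique:
  assumes "rep F f" "near0 (\<lambda>x y. f x y = 0)" shows "F = 0"
proof -
  from assms obtain r s where r: "r > 0" "\<And>x y. cmod x < r \<Longrightarrow> cmod y < r \<Longrightarrow> ((\<lambda>(m,n). cf F m n * x ^ m * y ^ n) has_sum f x y) UNIV"
    and s: "s > 0" "\<And>x y. cmod x < s \<Longrightarrow> cmod y < s \<Longrightarrow> f x y = 0"
    unfolding rep_def near0_def by auto
  define t where "t = min r s"
  have t: "t > 0" using r s by (simp add: t_def)
  have h: "((\<lambda>(m,n). cf F m n * x ^ m * y ^ n) has_sum 0) (UNIV \<times> UNIV)" if "cmod x < t" "cmod y < t" for x y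
    using r(2)[of x y] s(2)[of x y] that by (simp add: t_def)
  define c where "c = (\<lambda>y m. infsum (\<lambda>n. cf F m n * y ^ n) UNIV)"
  have c: "((\<lambda>n. cf F m n * y ^ n) has_sum c y m) UNIV" if y: "cmod y < t" for y m
  proof -
    \<comment> \<open>Any nonzero value of x serves: dividing row \<open>m\<close> by its
      \<open>m\<close>-th power leaves the series in y.\<close>
    have "(\<lambda>(m,n). cf F m n * of_real (t/2) ^ m * y ^ n) summable_on UNIV \<times> UNIV"
      using h[of "of_real (t/2)" y] t y by (auto simp: summable_on_def)
    from summable_on_SigmaD1[OF this, of m] have "(\<lambda>n. inverse (of_real (t/2) ^ m) * (cf F m n * of_real (t/2) ^ m * y ^ n)) summable_on UNIV"
      by (intro summable_on_cmult_right) auto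
    also have "(\<lambda>n. inverse (of_real (t/2) ^ m) * (cf F m n * of_real (t/2) ^ m * y ^ n)) = (\<lambda>n. cf F m n * y ^ n)"
      using t by (auto simp: field_simps)
    finally show ?thesis unfolding c_def by (rule has_sum_infsum)
  qed
  have "c y m = 0" if y: "cmod y < t" for y m
  proof (rule powser_eq_0_imp[OF t])
    fix x assume x: "cmod x < t"
    have "((\<lambda>m. c y m * x ^ m) has_sum 0) UNIV"
    proof (rule has_sum_SigmaD[OF h[OF x y]])
      fix m show "((\<lambda>n. case (m, n) of (m, n) \<Rightarrow> cf F m n * x ^ m * y ^ n) has_sum c y m * x ^ m) UNIV"
        using has_sum_cmult_left[OF c[OF y, of m], of "x ^ m"] by (simp add: mult_ac)
    qed
    thus "(\<lambda>m. c y m * x ^ m) sums 0" by (rule has_sum_imp_sums)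
  qed
  hence "cf F m n = 0" for m n
    using c by (intro powser_eq_0_imp[OF t, where c = "cf F m"] has_sum_imp_sums) metis
  thus ?thesis by (intro germ_eqI) simp
qed

lemma near0_mono: "near0 P \<Longrightarrow> (\<And>x y. P x y \<Longrightarrow> Q x y) \<Longrightarrow> near0 Q"
  unfolding near0_def by blast

lemma rep_unique:
  assumes "rep F f" "rep G g" "near0 (\<lambda>x y. f x y = g x y)" shows "F = G"
  using rep_0_unique[OF rep_diff[OF assms(1,2)] near0_mono[OF assms(3)]] by simp

lemma rep_near0: "rep F f \<Longrightarrow> rep F g \<Longrightarrow> near0 (\<lambda>x y. f x y = g x y)"
proof -
  assume "rep F f" "rep F g"
  then obtain r s where rs: "r > 0" "s > 0"
    and f: "\<And>x y. cmod x < r \<Longrightarrow> cmod y < r \<Longrightarrow> ((\<lambda>(m,n). cf F m n * x ^ m * y ^ n) has_sum f x y) UNIV"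
    and g: "\<And>x y. cmod x < s \<Longrightarrow> cmod y < s \<Longrightarrow> ((\<lambda>(m,n). cf F m n * x ^ m * y ^ n) has_sum g x y) UNIV"
    unfolding rep_def by auto
  have "f x y = g x y" if "cmod x < min r s" "cmod y < min r s" for x y
    using has_sum_unique[OF f g] that by simp
  thus ?thesis unfolding near0_def using rs by (intro exI[of _ "min r s"]) auto
qed

section \<open>The Milnor number as an intersection multiplicity\<close>

lemma milnor_span_iff:
  assumes U: "rep U (pdx f)" and W: "rep W (pdy f)"
  shows "milnor_span f n \<longleftrightarrow> spans (ideal2 U W) n"
proof
  assume "milnor_span f n"
  then obtain g where g: "\<forall>i<n. analytic2_at 0 0 (g i)"
    "\<forall>h. analytic2_at 0 0 h \<longrightarrow> (\<exists>c a b. analytic2_at 0 0 a \<and> analytic2_at 0 0 b \<and>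
      near0 (\<lambda>x y. h x y = (\<Sum>i<n. c i * g i x y) + a x y * pdx f x y + b x y * pdy f x y))"
    unfolding milnor_span_def by (elim exE conjE)
  have "\<forall>i. \<exists>G. i < n \<longrightarrow> rep G (g i)"
  proof
    fix i show "\<exists>G. i < n \<longrightarrow> rep G (g i)"
    proof (cases "i < n")
      case True
      then obtain G where "rep G (g i)" using analytic_imp_rep[of "g i"] g(1) by blast
      thus ?thesis by blast
    qed simp
  qed
  from choice[OF this] obtain G where G: "\<And>i. i < n \<Longrightarrow> rep (G i) (g i)" by blast
  have "\<exists>c. H - lincomb n c G \<in> ideal2 U W" for H
  proof -
    obtain h where h: "rep H h" using germ_has_rep by blast
    from g(2)[rule_format, OF rep_analytic[OF h]] obtain c a b where
      ab: "analytic2_at 0 0 a" "analytic2_at 0 0 b" and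
      eq: "near0 (\<lambda>x y. h x y = (\<Sum>i<n. c i * g i x y) + a x y * pdx f x y + b x y * pdy f x y)" by blast
    obtain A where A: "rep A a" using analytic_imp_rep[OF ab(1)] by blast
    obtain B where B: "rep B b" using analytic_imp_rep[OF ab(2)] by blast
    have "H = lincomb n c G + A * U + B * W" unfolding lincomb_def
      by (rule rep_unique[OF h _ eq]) (intro rep_add rep_mult rep_sum rep_const A B U W G, auto)
    hence "H - lincomb n c G = A * U + B * W" by simp
    thus ?thesis using ideal2I by metis
  qed
  thus "spans (ideal2 U W) n" unfolding spans_def by blast
next
  assume "spans (ideal2 U W) n"
  then obtain G where G: "\<And>H. \<exists>c. H - lincomb n c G \<in> ideal2 U W" unfolding spans_def by blast
  from choice[of "\<lambda>i g. rep (G i) g"] germ_has_rep obtain g where g: "\<And>i. rep (G i) (g i)" by blast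
  show "milnor_span f n" unfolding milnor_span_def
  proof (intro exI[of _ g] conjI allI impI)
    show "analytic2_at 0 0 (g i)" for i using g rep_analytic by blast
    fix h assume "analytic2_at 0 0 h"
    then obtain H where H: "rep H h" using analytic_imp_rep by blast
    obtain c where "H - lincomb n c G \<in> ideal2 U W" using G by blast
    then obtain A B where "H - lincomb n c G = A * U + B * W" by (auto simp: ideal2_def)
    hence eq: "H = (\<Sum>i<n. gconst (c i) * G i) + A * U + B * W" by (simp add: lincomb_def algebra_simps)
    obtain a where a: "rep A a" using germ_has_rep by blast
    obtain b where b: "rep B b" using germ_has_rep by blast
    have "rep H (\<lambda>x y. (\<Sum>i<n. c i * g i x y) + a x y * pdx f x y + b x y * pdy f x y)"
      unfolding eq by (intro rep_add rep_mult rep_sum rep_const a b U W g)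
    from rep_near0[OF H this] show "\<exists>c a b. analytic2_at 0 0 a \<and> analytic2_at 0 0 b \<and>
        near0 (\<lambda>x y. h x y = (\<Sum>i<n. c i * g i x y) + a x y * pdx f x y + b x y * pdy f x y)"
      using rep_analytic[OF a] rep_analytic[OF b] by blast
  qed
qed

lemma milnor_eq:
  assumes "rep U (pdx f)" "rep W (pdy f)" "isect U W k"
  shows "milnor f = enat k"
proof -
  have sp: "milnor_span f k" "\<And>m. milnor_span f m \<Longrightarrow> k \<le> m"
    using assms(3) unfolding milnor_span_iff[OF assms(1,2)] isect_def colen_def by (auto simp: not_less[symmetric])
  hence "(LEAST n. milnor_span f n) = k" by (intro Least_equality) auto
  thus ?thesis using sp(1) by (auto simp: milnor_def)
qed

text \<open>Replaces termwise differentiation of double series: the relation holds for constants and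
  coordinates and survives sums and products. Differentiability at every point is included so that
  the rules for \<open>deriv\<close> apply.\<close>

definition drep :: "germ \<Rightarrow> (complex \<Rightarrow> complex \<Rightarrow> complex) \<Rightarrow> bool" where
  "drep F f \<longleftrightarrow> rep F f \<and> rep (dX F) (pdx f) \<and> rep (dY F) (pdy f) \<and>
     (\<forall>x y. (\<lambda>t. f t y) field_differentiable at x \<and> (\<lambda>t. f x t) field_differentiable at y)"

lemma drep_const: "drep (gconst c) (\<lambda>x y. c)"
  and drep_X: "drep gX (\<lambda>x y. x)" and drep_Y: "drep gY (\<lambda>x y. y)"
  using rep_X rep_Y rep_const rep_const[of 0] rep_const[of 1]
  by (auto simp: drep_def pdx_def pdy_def)

lemma drepD:
  assumes "drep F f"
  shows "rep F f" "rep (dX F) (pdx f)" "rep (dY F) (pdy f)"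
    "(\<lambda>t. f t y) field_differentiable at x" "(\<lambda>t. f x t) field_differentiable at y"
  using assms by (auto simp: drep_def)

lemma drep_add:
  assumes f: "drep F f" and g: "drep G g" shows "drep (F + G) (\<lambda>x y. f x y + g x y)"
proof -
  have "pdx (\<lambda>x y. f x y + g x y) = (\<lambda>x y. pdx f x y + pdx g x y)"
    unfolding pdx_def using drepD(4)[OF f] drepD(4)[OF g] by (simp add: fun_eq_iff)
  moreover have "pdy (\<lambda>x y. f x y + g x y) = (\<lambda>x y. pdy f x y + pdy g x y)"
    unfolding pdy_def using drepD(5)[OF f] drepD(5)[OF g] by (simp add: fun_eq_iff)
  ultimately show ?thesis using drepD[OF f] drepD[OF g]
    unfolding drep_def by (auto intro!: rep_add field_differentiable_add)
qed

lemma drep_mult: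
  assumes f: "drep F f" and g: "drep G g" shows "drep (F * G) (\<lambda>x y. f x y * g x y)"
proof -
  have "pdx (\<lambda>x y. f x y * g x y) = (\<lambda>x y. pdx f x y * g x y + f x y * pdx g x y)"
    unfolding pdx_def using drepD(4)[OF f] drepD(4)[OF g] by (simp add: fun_eq_iff)
  moreover have "pdy (\<lambda>x y. f x y * g x y) = (\<lambda>x y. pdy f x y * g x y + f x y * pdy g x y)"
    unfolding pdy_def using drepD(5)[OF f] drepD(5)[OF g] by (simp add: fun_eq_iff)
  ultimately show ?thesis using drepD[OF f] drepD[OF g]
    unfolding drep_def dX_mult dY_mult by (auto intro!: rep_add rep_mult field_differentiable_mult)
qed

lemma drep_power: "drep F f \<Longrightarrow> drep (F ^ n) (\<lambda>x y. f x y ^ n)"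
  using drep_const[of 1] by (induction n) (auto intro: drep_mult)

lemma drep_sum: "(\<And>i. i \<in> A \<Longrightarrow> drep (H i) (h i)) \<Longrightarrow> drep (\<Sum>i\<in>A. H i) (\<lambda>x y. \<Sum>i\<in>A. h i x y)"
proof (induction A rule: infinite_finite_induct)
  case (insert i A)
  thus ?case using drep_add[of "H i" "h i"] by simp
qed (use drep_const[of 0] in auto)

lemma milnor_drep: "drep F f \<Longrightarrow> isect (dX F) (dY F) k \<Longrightarrow> milnor f = enat k"
  unfolding drep_def using milnor_eq by blast

section \<open>Polynomial functions and linear changes of coordinates\<close>

lemma is_poly2_bound:
  fixes g :: "complex \<Rightarrow> complex \<Rightarrow> complex"
  assumes "\<And>x y. g x y = (\<Sum>i\<le>N. \<Sum>j\<le>N. a i j * x ^ i * y ^ j)" "N \<le> M"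
  shows "\<exists>b. \<forall>x y. g x y = (\<Sum>i\<le>M. \<Sum>j\<le>M. b i j * x ^ i * y ^ j)"
proof -
  define b where "b = (\<lambda>i j. if i \<le> N \<and> j \<le> N then a i j else 0)"
  have "g x y = (\<Sum>i\<le>M. \<Sum>j\<le>M. b i j * x ^ i * y ^ j)" for x y
  proof -
    have row: "(\<Sum>j\<le>M. b i j * x ^ i * y ^ j) = (if i \<le> N then \<Sum>j\<le>N. a i j * x ^ i * y ^ j else 0)" for i
      using assms(2) by (cases "i \<le> N") (auto simp: b_def intro!: sum.mono_neutral_cong_right split: if_splits)
    show ?thesis unfolding assms(1) row using assms(2)
      by (intro sum.mono_neutral_cong_left) simp_all
  qed
  thus ?thesis by blast
qed

lemma is_poly2_monom: "is_poly2 (\<lambda>x y. c * x ^ i * y ^ j)"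
proof -
  let ?N = "i + j"
  define a where "a = (\<lambda>k l. if k = i \<and> l = j then c else 0)"
  have "c * x ^ i * y ^ j = (\<Sum>k\<le>?N. \<Sum>l\<le>?N. a k l * x ^ k * y ^ l)" for x y
  proof -
    have "(\<Sum>k\<le>?N. \<Sum>l\<le>?N. a k l * x ^ k * y ^ l) = (\<Sum>(k,l)\<in>{..?N}\<times>{..?N}. a k l * x ^ k * y ^ l)"
      by (simp add: sum.cartesian_product)
    also have "\<dots> = (\<Sum>(k,l)\<in>{(i,j)}. a k l * x ^ k * y ^ l)"
      by (intro sum.mono_neutral_right) (auto simp: a_def split: if_splits)
    finally show ?thesis by (simp add: a_def)
  qed
  thus ?thesis unfolding is_poly2_def by blast
qed

lemma is_poly2_const: "is_poly2 (\<lambda>x y. c)"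
  and is_poly2_X: "is_poly2 (\<lambda>x y. x)" and is_poly2_Y: "is_poly2 (\<lambda>x y. y)"
  using is_poly2_monom[of c 0 0] is_poly2_monom[of 1 1 0] is_poly2_monom[of 1 0 1] by simp_all

lemma is_poly2_add:
  assumes "is_poly2 f" "is_poly2 g" shows "is_poly2 (\<lambda>x y. f x y + g x y)"
proof -
  from assms obtain N a M b where f: "\<And>x y. f x y = (\<Sum>i\<le>N. \<Sum>j\<le>N. a i j * x ^ i * y ^ j)"
    and g: "\<And>x y. g x y = (\<Sum>i\<le>M. \<Sum>j\<le>M. b i j * x ^ i * y ^ j)" unfolding is_poly2_def by auto
  obtain a' where "\<And>x y. f x y = (\<Sum>i\<le>N + M. \<Sum>j\<le>N + M. a' i j * x ^ i * y ^ j)"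
    using is_poly2_bound[OF f, of "N + M"] by auto
  moreover obtain b' where "\<And>x y. g x y = (\<Sum>i\<le>N + M. \<Sum>j\<le>N + M. b' i j * x ^ i * y ^ j)"
    using is_poly2_bound[OF g, of "N + M"] by auto
  ultimately show ?thesis unfolding is_poly2_def
    by (intro exI[of _ "N + M"] exI[of _ "\<lambda>i j. a' i j + b' i j"]) (simp add: sum.distrib distrib_right)
qed

lemma is_poly2_sum: "(\<And>i. i \<in> A \<Longrightarrow> is_poly2 (h i)) \<Longrightarrow> is_poly2 (\<lambda>x y. \<Sum>i\<in>A. h i x y)"
  by (induction A rule: infinite_finite_induct) (auto intro: is_poly2_const is_poly2_add)

lemma is_poly2_mult:
  assumes "is_poly2 f" "is_poly2 g" shows "is_poly2 (\<lambda>x y. f x y * g x y)"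
proof -
  from assms obtain N a M b where f: "\<And>x y. f x y = (\<Sum>i\<le>N. \<Sum>j\<le>N. a i j * x ^ i * y ^ j)"
    and g: "\<And>x y. g x y = (\<Sum>i\<le>M. \<Sum>j\<le>M. b i j * x ^ i * y ^ j)" unfolding is_poly2_def by auto
  have "f x y * g x y = (\<Sum>i\<le>N. \<Sum>j\<le>N. \<Sum>k\<le>M. \<Sum>l\<le>M. (a i j * b k l) * x ^ (i + k) * y ^ (j + l))" for x y
    unfolding f g sum_distrib_right unfolding sum_distrib_left by (simp add: power_add mult_ac)
  thus ?thesis by (simp only:) (intro is_poly2_sum is_poly2_monom)
qed

lemma is_poly2_power: "is_poly2 f \<Longrightarrow> is_poly2 (\<lambda>x y. f x y ^ n)"
  by (induction n) (auto intro: is_poly2_const is_poly2_mult)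

lemma is_poly2_linear:
  assumes "is_poly2 f" shows "is_poly2 (\<lambda>x y. f (\<alpha> * x + \<beta> * y) (\<gamma> * x + \<delta> * y))"
proof -
  from assms obtain N a where f: "\<And>x y. f x y = (\<Sum>i\<le>N. \<Sum>j\<le>N. a i j * x ^ i * y ^ j)"
    unfolding is_poly2_def by auto
  show ?thesis unfolding f
    by (intro is_poly2_sum is_poly2_mult is_poly2_power is_poly2_add is_poly2_const is_poly2_X is_poly2_Y)
qed

lemma deformationI:
  assumes f: "is_poly2 f" "f 0 0 = 0" and p: "is_poly2 p" "p 0 0 = 0"
  shows "deformation f (\<lambda>x y s. f x y + s * p x y)"
proof -
  from f p obtain N a M b where f': "\<And>x y. f x y = (\<Sum>i\<le>N. \<Sum>j\<le>N. a i j * x ^ i * y ^ j)"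
    and p': "\<And>x y. p x y = (\<Sum>i\<le>M. \<Sum>j\<le>M. b i j * x ^ i * y ^ j)" unfolding is_poly2_def by auto
  obtain a' where a': "\<And>x y. f x y = (\<Sum>i\<le>N + M. \<Sum>j\<le>N + M. a' i j * x ^ i * y ^ j)"
    using is_poly2_bound[OF f', of "N + M"] by auto
  obtain b' where b': "\<And>x y. p x y = (\<Sum>i\<le>N + M. \<Sum>j\<le>N + M. b' i j * x ^ i * y ^ j)"
    using is_poly2_bound[OF p', of "N + M"] by auto
  define K where "K = N + M"
  define c where "c = (\<lambda>m n k. if m \<le> K \<and> n \<le> K then (if k = 0 then a' m n else if k = (1::nat) then b' m n else 0) else 0)"
  have "((\<lambda>(m,n,k). c m n k * x ^ m * y ^ n * s ^ k) has_sum f x y + s * p x y) UNIV" for x y s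
  proof (rule has_sum_finite_neutralI[of "{..K} \<times> {..K} \<times> {0,1}"])
    have "(\<Sum>(m,n,k)\<in>{..K} \<times> {..K} \<times> {0,1}. c m n k * x ^ m * y ^ n * s ^ k) =
       (\<Sum>m\<le>K. \<Sum>n\<le>K. \<Sum>k\<in>{0,1}. c m n k * x ^ m * y ^ n * s ^ k)"
      by (simp only: sum.cartesian_product)
    also have "\<dots> = (\<Sum>m\<le>K. \<Sum>n\<le>K. a' m n * x ^ m * y ^ n + s * (b' m n * x ^ m * y ^ n))"
      by (intro sum.cong refl) (simp add: c_def)
    also have "\<dots> = f x y + s * p x y"
      unfolding a' b' K_def by (simp add: sum.distrib sum_distrib_left)
    finally show "f x y + s * p x y = (\<Sum>q\<in>{..K} \<times> {..K} \<times> {0,1}. case q of (m,n,k) \<Rightarrow> c m n k * x ^ m * y ^ n * s ^ k)"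
      by simp
  qed (auto simp: c_def split: if_splits)
  hence "analytic3_at0 (\<lambda>x y s. f x y + s * p x y)"
    unfolding analytic3_at0_def by (intro exI[of _ 1]) auto
  thus ?thesis unfolding deformation_def near0_def using f(2) p(2) by (auto intro: exI[of _ 1])
qed

text \<open>The chain rule along an affine line; with suitable \<open>u\<close> and \<open>v\<close>
  it gives both partial derivatives after a linear substitution.\<close>

lemma poly2_partial_derivs:
  assumes "is_poly2 f"
  shows "((\<lambda>t. f (\<alpha> * t + u) (\<gamma> * t + v)) has_field_derivative
    \<alpha> * pdx f (\<alpha> * x + u) (\<gamma> * x + v) + \<gamma> * pdy f (\<alpha> * x + u) (\<gamma> * x + v)) (at x)"
proof -
  from assms obtain N a where f: "\<And>x y. f x y = (\<Sum>i\<le>N. \<Sum>j\<le>N. a i j * x ^ i * y ^ j)"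
    unfolding is_poly2_def by auto
  have X: "pdx f x y = (\<Sum>i\<le>N. \<Sum>j\<le>N. a i j * (of_nat i * x ^ (i - 1)) * y ^ j)" for x y
    unfolding pdx_def f by (rule DERIV_imp_deriv) (auto intro!: derivative_eq_intros sum.cong)
  have Y: "pdy f x y = (\<Sum>i\<le>N. \<Sum>j\<le>N. a i j * x ^ i * (of_nat j * y ^ (j - 1)))" for x y
    unfolding pdy_def f by (rule DERIV_imp_deriv) (auto intro!: derivative_eq_intros sum.cong)
  have "((\<lambda>t. f (\<alpha> * t + u) (\<gamma> * t + v)) has_field_derivative (\<Sum>i\<le>N. \<Sum>j\<le>N.
     \<alpha> * (a i j * (of_nat i * (\<alpha> * x + u) ^ (i - 1)) * (\<gamma> * x + v) ^ j) +
     \<gamma> * (a i j * (\<alpha> * x + u) ^ i * (of_nat j * (\<gamma> * x + v) ^ (j - 1))))) (at x)"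
    unfolding f by (auto intro!: derivative_eq_intros sum.cong simp: algebra_simps)
  thus ?thesis unfolding X Y by (simp add: sum.distrib sum_distrib_left)
qed

section \<open>Invariance of the Milnor number under linear substitutions\<close>

lemma analytic2_regroup:
  fixes c :: "'i \<Rightarrow> complex"
  assumes "r > 0" and "\<And>p q. finite {i\<in>I. e1 i = p \<and> e2 i = q}"
    and s: "\<And>x y. cmod x < r \<Longrightarrow> cmod y < r \<Longrightarrow> ((\<lambda>i. c i * x ^ e1 i * y ^ e2 i) has_sum f x y) I"
  shows "analytic2_at 0 0 f"
proof -
  define a where "a = (\<lambda>p q. \<Sum>i\<in>{i\<in>I. e1 i = p \<and> e2 i = q}. c i)"
  have "((\<lambda>(p,q). a p q * x ^ p * y ^ q) has_sum f x y) UNIV" if "cmod x < r" "cmod y < r" for x y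
  proof (rule has_sum_fibers[OF s[OF that], where e = "\<lambda>i. (e1 i, e2 i)"])
    fix p :: "nat \<times> nat"
    obtain m n where p: "p = (m, n)" by (cases p)
    show "((\<lambda>i. c i * x ^ e1 i * y ^ e2 i) has_sum (case p of (p, q) \<Rightarrow> a p q * x ^ p * y ^ q)) {i \<in> I. (e1 i, e2 i) = p}"
      using assms(2)[of m n] by (intro has_sum_finiteI) (auto simp: p a_def sum_distrib_right)
  qed
  thus ?thesis unfolding analytic2_at_def using assms(1) by auto
qed

text \<open>Terms of the two binomial expansions, multiplied. The general ring allows the same
  formula for complex terms and for their real majorants.\<close>

definition lin_coeff :: "'a::comm_ring_1 \<Rightarrow> 'a \<Rightarrow> 'a \<Rightarrow> 'a \<Rightarrow> nat \<Rightarrow> nat \<Rightarrow> nat \<Rightarrow> nat \<Rightarrow> 'a" where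
  "lin_coeff a b c d m n i j =
     (of_nat (m choose i) * (a ^ i * b ^ (m - i))) * (of_nat (n choose j) * (c ^ j * d ^ (n - j)))"

lemma lin_coeff_sum:
  "(\<Sum>(i,j)\<in>{..m}\<times>{..n}. lin_coeff a b c d m n i j) = (a + b) ^ m * (c + d) ^ n"
  unfolding binomial_ring by (simp add: sum_product sum.cartesian_product lin_coeff_def mult.assoc)

lemma analytic2_linear:
  assumes "analytic2_at 0 0 h"
  shows "analytic2_at 0 0 (\<lambda>x y. h (\<alpha> * x + \<beta> * y) (\<gamma> * x + \<delta> * y))"
proof -
  obtain H where "rep H h" using analytic_imp_rep[OF assms] by blast
  then obtain r where r: "r > 0" and
    H: "\<And>x y. cmod x < r \<Longrightarrow> cmod y < r \<Longrightarrow> ((\<lambda>(m,n). cf H m n * x ^ m * y ^ n) has_sum h x y) UNIV"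
    unfolding rep_def by auto
  \<comment> \<open>Bounds the absolute row sums of the matrix, so the polydisc of radius
    \<open>r / M\<close> is mapped into that of radius \<open>r\<close>.\<close>
  define M where "M = 1 + cmod \<alpha> + cmod \<beta> + cmod \<gamma> + cmod \<delta>"
  have M: "M > 0" "cmod \<alpha> + cmod \<beta> \<le> M" "cmod \<gamma> + cmod \<delta> \<le> M" unfolding M_def
    by (smt (verit) norm_ge_zero)+
  define I where "I = Sigma (UNIV :: (nat \<times> nat) set) (\<lambda>(m,n). {..m} \<times> {..n})"
  define e1 where "e1 = (\<lambda>((m::nat,n::nat),(i::nat,j::nat)). i + j)"
  define e2 where "e2 = (\<lambda>((m::nat,n::nat),(i::nat,j::nat)). (m - i) + (n - j))"
  define c where "c = (\<lambda>((m,n),(i,j)). cf H m n * lin_coeff \<alpha> \<beta> \<gamma> \<delta> m n i j)"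
  show ?thesis
  proof (rule analytic2_regroup[of "r / M" I e1 e2 c])
    show "r / M > 0" using r M by simp
    show "finite {i \<in> I. e1 i = p \<and> e2 i = q}" for p q
      by (rule finite_subset[of _ "({..p+q} \<times> {..p+q}) \<times> ({..p+q} \<times> {..p+q})"])
        (auto simp: I_def e1_def e2_def)
    fix x y assume xy: "cmod x < r / M" "cmod y < r / M"
    define m0 where "m0 = max (cmod x) (cmod y)"
    have m0: "M * m0 < r" "m0 \<ge> 0" using xy M by (auto simp: m0_def field_simps max_def)
    have b1: "a * cmod x + b * cmod y < r" if "a \<ge> 0" "b \<ge> 0" "a + b \<le> M" for a b
    proof -
      have "a * cmod x + b * cmod y \<le> a * m0 + b * m0" using that by (intro add_mono mult_left_mono) (auto simp: m0_def)
      also have "\<dots> \<le> M * m0" using that m0 by (simp add: mult_right_mono flip: distrib_right)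
      finally show ?thesis using m0 by simp
    qed
    define X where "X = cmod \<alpha> * cmod x + cmod \<beta> * cmod y"
    define Y where "Y = cmod \<gamma> * cmod x + cmod \<delta> * cmod y"
    have XY: "0 \<le> X" "X < r" "0 \<le> Y" "Y < r" using b1 M by (auto simp: X_def Y_def)
    have tm: "c ((m,n),(i,j)) * x ^ e1 ((m,n),(i,j)) * y ^ e2 ((m,n),(i,j)) =
       cf H m n * lin_coeff (\<alpha> * x) (\<beta> * y) (\<gamma> * x) (\<delta> * y) m n i j" for m n i j
      by (simp add: c_def e1_def e2_def lin_coeff_def power_add power_mult_distrib mult_ac)
    show "((\<lambda>i. c i * x ^ e1 i * y ^ e2 i) has_sum h (\<alpha> * x + \<beta> * y) (\<gamma> * x + \<delta> * y)) I"
      unfolding I_def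
    proof (rule has_sum_SigmaI[where g = "\<lambda>(m,n). cf H m n * (\<alpha> * x + \<beta> * y) ^ m * (\<gamma> * x + \<delta> * y) ^ n"])
      fix p :: "nat \<times> nat"
      obtain m n where p: "p = (m, n)" by (cases p)
      show "((\<lambda>q. c (p, q) * x ^ e1 (p, q) * y ^ e2 (p, q)) has_sum
          (case p of (m, n) \<Rightarrow> cf H m n * (\<alpha> * x + \<beta> * y) ^ m * (\<gamma> * x + \<delta> * y) ^ n)) (case p of (m, n) \<Rightarrow> {..m} \<times> {..n})"
        unfolding p prod.case
      proof (rule has_sum_finiteI)
        show "cf H m n * (\<alpha> * x + \<beta> * y) ^ m * (\<gamma> * x + \<delta> * y) ^ n =
          (\<Sum>q\<in>{..m} \<times> {..n}. c ((m,n), q) * x ^ e1 ((m,n), q) * y ^ e2 ((m,n), q))"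
          unfolding mult.assoc[of "cf H m n"] lin_coeff_sum[symmetric] sum_distrib_left
          by (intro sum.cong) (auto simp: tm)
      qed simp
    next
      have "cmod (\<alpha> * x + \<beta> * y) \<le> X" "cmod (\<gamma> * x + \<delta> * y) \<le> Y"
        unfolding X_def Y_def by (metis norm_mult norm_triangle_ineq)+
      thus "((\<lambda>(m,n). cf H m n * (\<alpha> * x + \<beta> * y) ^ m * (\<gamma> * x + \<delta> * y) ^ n) has_sum
          h (\<alpha> * x + \<beta> * y) (\<gamma> * x + \<delta> * y)) UNIV"
        using XY by (intro H) auto
    next
      \<comment> \<open>The norms of the expanded terms belonging to \<open>(m, n)\<close> add up to
        those of the series of \<open>H\<close> at the nonnegative point \<open>(X, Y)\<close>,
        where it converges absolutely.\<close>
      have "(\<lambda>(m,n). cf H m n * of_real X ^ m * of_real Y ^ n) summable_on UNIV"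
        using H[of "of_real X" "of_real Y"] XY by (auto simp: summable_on_def)
      hence abs: "(\<lambda>(m,n). cmod (cf H m n) * (X ^ m * Y ^ n)) summable_on UNIV"
        using XY unfolding summable_on_iff_abs_summable_on_complex
        by (simp add: case_prod_unfold norm_mult norm_power mult.assoc)
      have normt: "cmod (c ((m,n),(i,j)) * x ^ e1 ((m,n),(i,j)) * y ^ e2 ((m,n),(i,j))) =
         cmod (cf H m n) * lin_coeff (cmod \<alpha> * cmod x) (cmod \<beta> * cmod y) (cmod \<gamma> * cmod x) (cmod \<delta> * cmod y) m n i j" for m n i j
        unfolding tm by (simp add: lin_coeff_def norm_mult norm_power)
      have "(\<lambda>q. norm (c q * x ^ e1 q * y ^ e2 q)) summable_on (SIGMA p:UNIV. case p of (m, n) \<Rightarrow> {..m} \<times> {..n})"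
      proof (rule summable_on_SigmaI[OF _ abs])
        fix p :: "nat \<times> nat"
        obtain m n where p: "p = (m, n)" by (cases p)
        show "((\<lambda>q. norm (c (p, q) * x ^ e1 (p, q) * y ^ e2 (p, q))) has_sum
            (case p of (m, n) \<Rightarrow> cmod (cf H m n) * (X ^ m * Y ^ n))) (case p of (m, n) \<Rightarrow> {..m} \<times> {..n})"
          unfolding p prod.case
        proof (rule has_sum_finiteI)
          show "cmod (cf H m n) * (X ^ m * Y ^ n) =
            (\<Sum>q\<in>{..m} \<times> {..n}. norm (c ((m,n), q) * x ^ e1 ((m,n), q) * y ^ e2 ((m,n), q)))"
            unfolding X_def Y_def lin_coeff_sum[symmetric] sum_distrib_left
            by (intro sum.cong) (auto simp: normt)
        qed simp
      qed simp
      thus "(\<lambda>i. c i * x ^ e1 i * y ^ e2 i) summable_on (SIGMA p:UNIV. case p of (m, n) \<Rightarrow> {..m} \<times> {..n})"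
        by (rule abs_summable_summable)
    qed
  qed
qed

lemma near0_linear:
  assumes "near0 P" shows "near0 (\<lambda>x y. P (\<alpha> * x + \<beta> * y) (\<gamma> * x + \<delta> * y))"
proof -
  obtain r where r: "r > 0" "\<And>x y. cmod x < r \<Longrightarrow> cmod y < r \<Longrightarrow> P x y" using assms unfolding near0_def by auto
  define M where "M = 1 + cmod \<alpha> + cmod \<beta> + cmod \<gamma> + cmod \<delta>"
  have M: "M > 0" "cmod \<alpha> + cmod \<beta> \<le> M" "cmod \<gamma> + cmod \<delta> \<le> M" unfolding M_def
    by (smt (verit) norm_ge_zero)+
  have b: "cmod (a * x + b * y) < r" if xy: "cmod x < r / M" "cmod y < r / M" and ab: "cmod a + cmod b \<le> M" for a b x y
  proof -
    define m where "m = max (cmod x) (cmod y)"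
    have m: "M * m < r" "m \<ge> 0" using xy M by (auto simp: m_def field_simps max_def)
    have "cmod (a * x + b * y) \<le> cmod a * cmod x + cmod b * cmod y" by (metis norm_mult norm_triangle_ineq)
    also have "\<dots> \<le> cmod a * m + cmod b * m" by (intro add_mono mult_left_mono) (auto simp: m_def)
    also have "\<dots> \<le> M * m" using ab m by (simp add: mult_right_mono flip: distrib_right)
    finally show ?thesis using m by simp
  qed
  show ?thesis unfolding near0_def
    using r M b by (intro exI[of _ "r / M"]) auto
qed

text \<open>Generators and cofactors are pulled back; the gradient is transformed by the transposed
  matrix, which is invertible.\<close>

lemma milnor_span_linear:
  assumes f: "is_poly2 f" and det: "\<alpha> * \<delta> - \<beta> * \<gamma> \<noteq> 0" and sp: "milnor_span f n"
  shows "milnor_span (\<lambda>x y. f (\<alpha> * x + \<beta> * y) (\<gamma> * x + \<delta> * y)) n"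
proof -
  define \<Delta> where "\<Delta> = \<alpha> * \<delta> - \<beta> * \<gamma>"
  have \<Delta>: "\<Delta> \<noteq> 0" using det by (simp add: \<Delta>_def)
  let ?L = "\<lambda>h x y. h (\<alpha> * x + \<beta> * y) (\<gamma> * x + \<delta> * y) :: complex"
  let ?L' = "\<lambda>h x y. h (\<delta> / \<Delta> * x + (- \<beta> / \<Delta>) * y) ((- \<gamma> / \<Delta>) * x + \<alpha> / \<Delta> * y) :: complex"
  have inv1: "\<delta> / \<Delta> * (\<alpha> * x + \<beta> * y) + - \<beta> / \<Delta> * (\<gamma> * x + \<delta> * y) = x" for x y
    using \<Delta> by (simp add: field_simps) (simp add: \<Delta>_def algebra_simps)
  have inv2: "- \<gamma> / \<Delta> * (\<alpha> * x + \<beta> * y) + \<alpha> / \<Delta> * (\<gamma> * x + \<delta> * y) = y" for x y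
    using \<Delta> by (simp add: field_simps) (simp add: \<Delta>_def algebra_simps)
  have pX: "pdx (?L f) = (\<lambda>x y. \<alpha> * ?L (pdx f) x y + \<gamma> * ?L (pdy f) x y)"
    unfolding pdx_def[of "?L f"] using DERIV_imp_deriv[OF poly2_partial_derivs[OF f, of \<alpha> _ \<gamma> _]] by (intro ext) auto
  have pY: "pdy (?L f) = (\<lambda>x y. \<beta> * ?L (pdx f) x y + \<delta> * ?L (pdy f) x y)"
  proof (intro ext)
    fix x y
    have "((\<lambda>t. ?L f x t) has_field_derivative \<beta> * ?L (pdx f) x y + \<delta> * ?L (pdy f) x y) (at y)"
      using poly2_partial_derivs[OF f, of \<beta> "\<alpha> * x" \<delta> "\<gamma> * x" y] by (simp add: add.commute)
    thus "pdy (?L f) x y = \<beta> * ?L (pdx f) x y + \<delta> * ?L (pdy f) x y"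
      unfolding pdy_def[of "?L f"] by (rule DERIV_imp_deriv)
  qed
  obtain g where g: "\<forall>i<n. analytic2_at 0 0 (g i)"
    "\<forall>h. analytic2_at 0 0 h \<longrightarrow> (\<exists>c a b. analytic2_at 0 0 a \<and> analytic2_at 0 0 b \<and>
      near0 (\<lambda>x y. h x y = (\<Sum>i<n. c i * g i x y) + a x y * pdx f x y + b x y * pdy f x y))"
    using sp unfolding milnor_span_def by (elim exE conjE)
  have comb: "analytic2_at 0 0 (\<lambda>x y. c1 * a x y + c2 * b x y)" if ab: "analytic2_at 0 0 a" "analytic2_at 0 0 b" for a b c1 c2
  proof -
    obtain A where A: "rep A a" using analytic_imp_rep[OF ab(1)] by blast
    obtain B where B: "rep B b" using analytic_imp_rep[OF ab(2)] by blast
    have "rep (gconst c1 * A + gconst c2 * B) (\<lambda>x y. c1 * a x y + c2 * b x y)"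
      by (intro rep_add rep_mult rep_const A B)
    thus ?thesis by (rule rep_analytic)
  qed
  show ?thesis unfolding milnor_span_def
  proof (intro exI[of _ "\<lambda>i. ?L (g i)"] conjI allI impI)
    show "analytic2_at 0 0 (?L (g i))" if "i < n" for i using g(1) that analytic2_linear by blast
    fix h assume h: "analytic2_at 0 0 h"
    have "analytic2_at 0 0 (?L' h)" using h by (rule analytic2_linear)
    from g(2)[rule_format, OF this] obtain c a b where ab: "analytic2_at 0 0 a" "analytic2_at 0 0 b"
      and eq: "near0 (\<lambda>x y. ?L' h x y = (\<Sum>i<n. c i * g i x y) + a x y * pdx f x y + b x y * pdy f x y)" by blast
    \<comment> \<open>The cofactors relative to the new partial derivatives, found by inverting that
      transformation.\<close>
    define a' where "a' = (\<lambda>x y. (\<delta> / \<Delta>) * ?L a x y + (- \<beta> / \<Delta>) * ?L b x y)"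
    define b' where "b' = (\<lambda>x y. (- \<gamma> / \<Delta>) * ?L a x y + (\<alpha> / \<Delta>) * ?L b x y)"
    have "near0 (\<lambda>x y. ?L (?L' h) x y = (\<Sum>i<n. c i * ?L (g i) x y) + ?L a x y * ?L (pdx f) x y + ?L b x y * ?L (pdy f) x y)"
      using near0_linear[OF eq] .
    hence "near0 (\<lambda>x y. h x y = (\<Sum>i<n. c i * ?L (g i) x y) + ?L a x y * ?L (pdx f) x y + ?L b x y * ?L (pdy f) x y)"
      unfolding inv1 inv2 .
    moreover have "a' x y * pdx (?L f) x y + b' x y * pdy (?L f) x y = ?L a x y * ?L (pdx f) x y + ?L b x y * ?L (pdy f) x y" for x y
      unfolding pX pY a'_def b'_def using \<Delta>
      by (simp add: field_simps) (simp add: \<Delta>_def algebra_simps)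
    ultimately have "near0 (\<lambda>x y. h x y = (\<Sum>i<n. c i * ?L (g i) x y) + a' x y * pdx (?L f) x y + b' x y * pdy (?L f) x y)"
      by (simp add: add.assoc)
    moreover have "analytic2_at 0 0 a'" "analytic2_at 0 0 b'" unfolding a'_def b'_def
      using ab by (intro comb analytic2_linear; simp)+
    ultimately show "\<exists>c a b. analytic2_at 0 0 a \<and> analytic2_at 0 0 b \<and>
        near0 (\<lambda>x y. h x y = (\<Sum>i<n. c i * ?L (g i) x y) + a x y * pdx (?L f) x y + b x y * pdy (?L f) x y)"
      by blast
  qed
qed

lemma milnor_linear:
  assumes f: "is_poly2 f" and det: "\<alpha> * \<delta> - \<beta> * \<gamma> \<noteq> 0"
  shows "milnor (\<lambda>x y. f (\<alpha> * x + \<beta> * y) (\<gamma> * x + \<delta> * y)) = milnor f"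
proof -
  define \<Delta> where "\<Delta> = \<alpha> * \<delta> - \<beta> * \<gamma>"
  have \<Delta>: "\<Delta> \<noteq> 0" using det by (simp add: \<Delta>_def)
  let ?g = "\<lambda>x y. f (\<alpha> * x + \<beta> * y) (\<gamma> * x + \<delta> * y)"
  have inv: "(\<lambda>x y. ?g (\<delta> / \<Delta> * x + (- \<beta> / \<Delta>) * y) ((- \<gamma> / \<Delta>) * x + \<alpha> / \<Delta> * y)) = f"
  proof -
    have 1: "\<alpha> * (\<delta> / \<Delta> * x + - \<beta> / \<Delta> * y) + \<beta> * (- \<gamma> / \<Delta> * x + \<alpha> / \<Delta> * y) = x" for x y
      using \<Delta> by (simp add: field_simps) (simp add: \<Delta>_def algebra_simps)
    have 2: "\<gamma> * (\<delta> / \<Delta> * x + - \<beta> / \<Delta> * y) + \<delta> * (- \<gamma> / \<Delta> * x + \<alpha> / \<Delta> * y) = y" for x y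
      using \<Delta> by (simp add: field_simps) (simp add: \<Delta>_def algebra_simps)
    show ?thesis unfolding 1 2 ..
  qed
  have det': "\<delta> / \<Delta> * (\<alpha> / \<Delta>) - (- \<beta> / \<Delta>) * (- \<gamma> / \<Delta>) \<noteq> 0"
    using \<Delta> by (simp add: field_simps) (simp add: \<Delta>_def algebra_simps)
  have "milnor_span ?g n \<longleftrightarrow> milnor_span f n" for n
    using milnor_span_linear[OF f det, of n]
      milnor_span_linear[OF is_poly2_linear[OF f, of \<alpha> \<beta> \<gamma> \<delta>] det', of n, unfolded inv] by blast
  hence "milnor_span ?g = milnor_span f" by (intro ext)
  thus ?thesis by (simp only: milnor_def)
qed

section \<open>Homogeneous forms and their deformations\<close>

text \<open>A form of degree \<open>N\<close> is stored as its dehomogenisation at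
  \<open>y = 1\<close>. \<open>coeff p N\<close> belongs to \<open>x^N\<close>, so it vanishes
  exactly when y divides the form.\<close>

definition hform :: "nat \<Rightarrow> complex poly \<Rightarrow> complex \<Rightarrow> complex \<Rightarrow> complex" where
  "hform N p x y = (\<Sum>i\<le>N. coeff p i * x ^ i * y ^ (N - i))"

definition ghom :: "nat \<Rightarrow> complex poly \<Rightarrow> germ" where
  "ghom N p = (\<Sum>i\<le>N. gconst (coeff p i) * gX ^ i * gY ^ (N - i))"

lemma drep_ghom: "drep (ghom N p) (hform N p)"
  unfolding ghom_def hform_def[abs_def]
  by (intro drep_sum drep_mult drep_power drep_const drep_X drep_Y)

lemma is_poly2_hform: "is_poly2 (hform N p)"
  unfolding hform_def[abs_def] by (intro is_poly2_sum is_poly2_monom)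

lemma cf_ghom: "cf (ghom N p) a b = (if a + b = N then coeff p a else 0)"
proof -
  have "cf (ghom N p) a b = (\<Sum>i\<le>N. if i = a then (if a + b = N then coeff p a else 0) else 0)"
    unfolding ghom_def cf_sum mult.assoc cf_const_mult cf_XY by (intro sum.cong) auto
  thus ?thesis by auto
qed

lemma hform_mult_linear:
  assumes "degree p \<le> N"
  shows "hform (Suc N) ([:-a, 1:] * p) x y = (x - a * y) * hform N p x y"
proof -
  have "coeff p (Suc N) = 0" using assms by (intro coeff_eq_0) auto
  hence s: "(\<Sum>i\<le>Suc N. a * coeff p i * x ^ i * y ^ (Suc N - i)) = a * y * hform N p x y"
    unfolding hform_def sum_distrib_left by (auto intro!: sum.cong simp: Suc_diff_le)
  have "hform (Suc N) (pCons 0 p) x y = x * hform N p x y"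
    unfolding hform_def sum.atMost_Suc_shift by (simp add: sum_distrib_left mult_ac)
  moreover have "[:-a, 1:] * p = pCons 0 p - smult a p" by simp
  ultimately show ?thesis using s
    by (simp add: hform_def algebra_simps sum_subtractf)
qed

lemma ghom_mult_linear:
  assumes "degree p \<le> N"
  shows "ghom (Suc N) ([:-a, 1:] * p) = (gX - gconst a * gY) * ghom N p"
proof -
  have "coeff p (Suc N) = 0" using assms by (intro coeff_eq_0) auto
  hence "cf (ghom (Suc N) (pCons 0 p - smult a p)) i j = cf ((gX - gconst a * gY) * ghom N p) i j" for i j
    by (auto simp: cf_ghom left_diff_distrib mult.assoc cf_X_mult cf_Y_mult coeff_pCons split: nat.splits)
  thus ?thesis by (intro germ_eqI) simp
qed

text \<open>On the line \<open>x = a y\<close> the form restricts to \<open>poly r a\<close> times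
  \<open>y^m\<close>; algebraically, \<open>r\<close> minus its value at \<open>a\<close> is
  divisible by the linear factor.\<close>

lemma isect_line_ghom:
  assumes "poly r a \<noteq> 0" "degree r \<le> m"
  shows "isect (gX - gconst a * gY) (ghom m r) m"
proof -
  let ?l = "gX - gconst a * gY"
  have "poly (r - [:poly r a:]) a = 0" by simp
  then obtain s where s: "r - [:poly r a:] = [:-a, 1:] * s" unfolding poly_eq_0_iff_dvd by blast
  have deg: "s = 0 \<or> degree s < m"
  proof (cases "s = 0")
    case False
    hence "degree (r - [:poly r a:]) = Suc (degree s)" unfolding s by (subst degree_mult_eq) auto
    moreover have "degree (r - [:poly r a:]) \<le> m" using assms(2) by (intro degree_diff_le) auto
    ultimately show ?thesis by simp
  qed simp
  have "\<exists>h. ghom m ([:-a, 1:] * s) = ?l * h"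
  proof (cases m)
    case 0
    hence "s = 0" using deg by simp
    moreover have "ghom m 0 = 0" by (simp add: ghom_def)
    ultimately show ?thesis by (intro exI[of _ 0]) simp
  next
    case (Suc m')
    thus ?thesis using ghom_mult_linear[of s m' a] deg by auto
  qed
  then obtain h where h: "ghom m ([:-a, 1:] * s) = ?l * h" by blast
  have r: "ghom m r = ?l * h + gconst (poly r a) * gY ^ m"
  proof -
    have "r = [:-a, 1:] * s + [:poly r a:]" by (simp only: s[symmetric]) simp
    hence "coeff r k = coeff ([:-a, 1:] * s) k + coeff [:poly r a:] k" for k by (metis coeff_add)
    hence "cf (ghom m r) i j = cf (ghom m ([:-a, 1:] * s) + gconst (poly r a) * gY ^ m) i j" for i j
      using cf_XY[of 0 m i j] by (auto simp: cf_ghom coeff_pCons[of "poly r a"] simp del: mult_pCons_left split: nat.splits)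
    thus ?thesis unfolding h[symmetric] by (rule germ_eqI)
  qed
  have "isect gY ?l 1" by (rule isect_Y) auto
  from isect_power[OF this, of m] have "isect (gconst (poly r a) * gY ^ m) ?l m"
    using assms(1) by (subst isect_unit_mult) (auto simp: cf_const)
  moreover have "ideal2 (gconst (poly r a) * gY ^ m) ?l = ideal2 ?l (ghom m r)"
  proof (rule ideal2_eqI)
    have "gconst (poly r a) * gY ^ m = (- h) * ?l + 1 * ghom m r" by (simp add: r algebra_simps)
    thus "gconst (poly r a) * gY ^ m \<in> ideal2 ?l (ghom m r)" by (metis ideal2I)
    show "ghom m r \<in> ideal2 (gconst (poly r a) * gY ^ m) ?l"
      unfolding r by (rule gidealD(2)) (auto intro: gidealD(4))
  qed auto
  ultimately show ?thesis using isect_ideal_cong by blast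
qed

text \<open>The first form is a constant times \<open>N\<close> lines, the axis \<open>y = 0\<close>
  being excluded by \<open>degree p = N\<close>, and each of them meets the second form with
  multiplicity \<open>m\<close>.\<close>

lemma isect_ghom:
  assumes "degree p = N" "p \<noteq> 0" "degree r \<le> m" "\<And>a. poly p a = 0 \<Longrightarrow> poly r a \<noteq> 0"
  shows "isect (ghom N p) (ghom m r) (N * m)"
  using assms(1,2,4)
proof (induction N arbitrary: p)
  case 0
  then obtain c where c: "p = [:c:]" by (auto elim: degree_eq_zeroE)
  have "isect (gconst c * 1) (ghom m r) 0"
    using 0 c by (subst isect_unit_mult) (auto simp: cf_const isect_unit)
  thus ?case by (simp add: ghom_def c)
next
  case (Suc N)
  obtain a where a: "poly p a = 0"
    using fundamental_theorem_of_algebra[of p] Suc.prems(1) constant_degree[of p] by auto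
  then obtain s where s: "p = [:-a, 1:] * s" unfolding poly_eq_0_iff_dvd by blast
  have s0: "s \<noteq> 0" using Suc.prems s by auto
  have "degree p = Suc (degree s)" unfolding s using s0 by (subst degree_mult_eq) auto
  hence ds: "degree s = N" using Suc.prems by simp
  have "isect (ghom N s) (ghom m r) (N * m)"
    using Suc.prems(3) by (intro Suc.IH ds s0) (auto simp: s)
  moreover have "isect (gX - gconst a * gY) (ghom m r) m"
    using Suc.prems(3)[OF a] assms(3) by (rule isect_line_ghom)
  ultimately have "isect ((gX - gconst a * gY) * ghom N s) (ghom m r) (m + N * m)"
    by (intro isect_mult)
  thus ?case using ghom_mult_linear[of s N a] ds by (simp add: s)
qed

lemma milnor_hform:
  assumes q: "degree q = d" "1 \<le> d" and sf: "\<And>a. poly q a = 0 \<Longrightarrow> poly (pderiv q) a \<noteq> 0"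
  shows "milnor (hform d q) = enat ((d - 1)\<^sup>2)"
proof -
  \<comment> \<open>By Euler's relation this is the dehomogenised y-derivative. At a root of
    \<open>pderiv q\<close> its value is \<open>d\<close> times that of \<open>q\<close>, nonzero
    for a simple-rooted \<open>q\<close>.\<close>
  define r where "r = smult (of_nat d) q - pCons 0 (pderiv q)"
  have cr: "coeff r i = (of_nat d - of_nat i) * coeff q i" for i
    by (cases i) (auto simp: r_def coeff_pCons coeff_pderiv algebra_simps)
  have X: "dX (ghom d q) = ghom (d - 1) (pderiv q)"
    using q(2) by (intro germ_eqI) (auto simp: cf_ghom coeff_pderiv)
  have Y: "dY (ghom d q) = ghom (d - 1) r"
  proof (rule germ_eqI)
    fix a b show "cf (dY (ghom d q)) a b = cf (ghom (d - 1) r) a b"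
    proof (cases "a + Suc b = d")
      case True
      hence "d = a + Suc b" by simp
      hence "(of_nat d :: complex) - of_nat a = of_nat (Suc b)" by (simp only: of_nat_add) simp
      thus ?thesis using True by (auto simp: cf_ghom cr)
    next
      case False thus ?thesis using q(2) by (auto simp: cf_ghom)
    qed
  qed
  have "degree r \<le> d - 1"
  proof (rule degree_le, intro allI impI)
    fix i assume "d - 1 < i"
    thus "coeff r i = 0" using q coeff_eq_0[of q i] by (cases "i = d") (auto simp: cr)
  qed
  moreover have "poly r a \<noteq> 0" if "poly (pderiv q) a = 0" for a
    using sf[of a] that q(2) by (auto simp: r_def)
  moreover have "degree (pderiv q) = d - 1" using q by (simp add: degree_pderiv)
  moreover have "pderiv q \<noteq> 0" using q by (auto simp: pderiv_eq_0_iff)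
  ultimately have "isect (ghom (d - 1) (pderiv q)) (ghom (d - 1) r) ((d - 1) * (d - 1))"
    by (intro isect_ghom)
  thus ?thesis using milnor_drep[OF drep_ghom[of d q]] by (simp add: X Y power2_eq_square)
qed

text \<open>For \<open>n = \<delta>\<close> the monomial \<open>x\<^sup>n\<close> is omitted because the form of degree \<open>\<delta>\<close> already contains it.\<close>

definition perturb :: "complex \<Rightarrow> nat \<Rightarrow> nat \<Rightarrow> nat \<Rightarrow> nat \<Rightarrow> nat \<Rightarrow> complex \<Rightarrow> complex \<Rightarrow> complex" where
  "perturb \<epsilon> e i j n \<delta> x y = y ^ e + \<epsilon> * x ^ i * y ^ j + (if n < \<delta> then 1 else 0) * x ^ n"

definition gperturb :: "complex \<Rightarrow> nat \<Rightarrow> nat \<Rightarrow> nat \<Rightarrow> nat \<Rightarrow> nat \<Rightarrow> germ" where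
  "gperturb \<epsilon> e i j n \<delta> = gY ^ e + gconst \<epsilon> * gX ^ i * gY ^ j + gconst (if n < \<delta> then 1 else 0) * gX ^ n"

lemma drep_gperturb: "drep (gperturb \<epsilon> e i j n \<delta>) (perturb \<epsilon> e i j n \<delta>)"
  unfolding gperturb_def perturb_def[abs_def]
  by (intro drep_add drep_mult drep_power drep_const drep_X drep_Y)

lemma is_poly2_perturb: "is_poly2 (perturb \<epsilon> e i j n \<delta>)"
  unfolding perturb_def[abs_def]
  by (intro is_poly2_add is_poly2_mult is_poly2_power is_poly2_const is_poly2_X is_poly2_Y)

lemma cf_gperturb: "cf (gperturb \<epsilon> e i j n \<delta>) a b =
   (if a = 0 \<and> b = e then 1 else 0) + (if a = i \<and> b = j then \<epsilon> else 0) + (if n < \<delta> \<and> a = n \<and> b = 0 then 1 else 0)"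
  using cf_XY[of 0 e a b] cf_XY[of n 0 a b] by (auto simp: gperturb_def mult.assoc cf_XY)

text \<open>The form starts in degree \<open>\<delta> \<ge> n\<close>, so lower terms come from the
  perturbation only. The monomial \<open>x^n\<close> comes from the perturbation if
  \<open>n < \<delta>\<close> and from the form if \<open>n = \<delta>\<close>.\<close>

lemma cf_perturbed_form:
  fixes \<epsilon> s :: complex
  assumes q: "coeff q \<delta> \<noteq> 0" and s: "s \<noteq> 0" and n: "e < n" "n \<le> \<delta>" "1 \<le> i" "1 \<le> j" "i + j \<le> e"
  defines "G \<equiv> ghom \<delta> q + gconst s * gperturb \<epsilon> e i j n \<delta>"
  shows "cf G 0 e = s" "cf G i j = s * \<epsilon>" "cf G n 0 \<noteq> 0"
    "\<And>a b. a + b < n \<Longrightarrow> (a, b) \<noteq> (0, e) \<Longrightarrow> (a, b) \<noteq> (i, j) \<Longrightarrow> cf G a b = 0"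
  using assms by (auto simp: cf_ghom cf_gperturb)

lemma milnor_two_edges:
  assumes q: "coeff q \<delta> \<noteq> 0" and s: "s \<noteq> 0" and n: "e < n" "n \<le> \<delta>" and ij: "1 \<le> i" "1 \<le> j" "i + j \<le> e"
  shows "milnor (\<lambda>x y. hform \<delta> q x y + s * perturb 1 e i j n \<delta> x y) = enat (e * (i - 1) + j * n - (n - 1))"
    and "milnor (\<lambda>x y. y * (hform \<delta> q x y + s * perturb 1 e i j n \<delta> x y)) = enat (n + (e * (i - 1) + j * n))"
proof -
  define G where "G = ghom \<delta> q + gconst s * gperturb 1 e i j n \<delta>"
  have G: "drep G (\<lambda>x y. hform \<delta> q x y + s * perturb 1 e i j n \<delta> x y)"
    unfolding G_def by (intro drep_add drep_mult drep_const drep_ghom drep_gperturb)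
  note c = cf_perturbed_form[OF q s n ij, where \<epsilon> = 1, folded G_def]
  have I: "isect (dX G) (gconst (of_nat \<kappa>) * G + gY * dY G) (e * (i - 1) + j * n)" for \<kappa>
    using c s ij n by (intro isect_two_edges) auto
  have n0: "cf G a 0 = 0" if "a < n" for a using c(4)[of a 0] that ij by auto
  show "milnor (\<lambda>x y. hform \<delta> q x y + s * perturb 1 e i j n \<delta> x y) = enat (e * (i - 1) + j * n - (n - 1))"
    by (rule milnor_drep[OF G isect_gradient[OF I c(3) n0]]) (use n in auto)
  show "milnor (\<lambda>x y. y * (hform \<delta> q x y + s * perturb 1 e i j n \<delta> x y)) = enat (n + (e * (i - 1) + j * n))"
    by (rule milnor_drep[OF drep_mult[OF drep_Y G] isect_gradient_Y_mult[OF I c(3) n0]])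
qed

lemma milnor_one_edge:
  assumes q: "coeff q \<delta> \<noteq> 0" and s: "s \<noteq> 0" and n: "1 \<le> e" "e < n" "n \<le> \<delta>"
  shows "milnor (\<lambda>x y. hform \<delta> q x y + s * perturb 0 e 0 0 n \<delta> x y) = enat ((e - 1) * (n - 1))"
    and "milnor (\<lambda>x y. y * (hform \<delta> q x y + s * perturb 0 e 0 0 n \<delta> x y)) = enat (n + e * (n - 1))"
proof -
  define G where "G = ghom \<delta> q + gconst s * gperturb 0 e 0 0 n \<delta>"
  have G: "drep G (\<lambda>x y. hform \<delta> q x y + s * perturb 0 e 0 0 n \<delta> x y)"
    unfolding G_def by (intro drep_add drep_mult drep_const drep_ghom drep_gperturb)
  have c: "cf G 0 e \<noteq> 0" "cf G n 0 \<noteq> 0" "\<And>a b. a + b < n \<Longrightarrow> (a, b) \<noteq> (0, e) \<Longrightarrow> cf G a b = 0"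
    using assms by (auto simp: G_def cf_ghom cf_gperturb)
  note I = isect_one_edge[OF c(1,2) n(1,2) c(3)]
  have n0: "cf G a 0 = 0" if "a < n" for a using c(3)[of a 0] that n by auto
  show "milnor (\<lambda>x y. hform \<delta> q x y + s * perturb 0 e 0 0 n \<delta> x y) = enat ((e - 1) * (n - 1))"
    by (rule milnor_drep[OF G I(2)])
  show "milnor (\<lambda>x y. y * (hform \<delta> q x y + s * perturb 0 e 0 0 n \<delta> x y)) = enat (n + e * (n - 1))"
    by (rule milnor_drep[OF drep_mult[OF drep_Y G] isect_gradient_Y_mult[OF I(1) c(2) n0]])
qed

text \<open>The perturbation is chosen in convenient coordinates and carried back by the inverse
  substitution, which does not change Milnor numbers.\<close>

lemma generic_milnor_by_coordinates:
  assumes f: "is_poly2 f" "f 0 0 = 0" and P: "is_poly2 P" "P 0 0 = 0" and det: "\<alpha> * \<delta> - \<beta> * \<gamma> \<noteq> 0"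
    and m: "\<And>s. s \<noteq> 0 \<Longrightarrow> milnor (\<lambda>x y. f (\<alpha> * x + \<beta> * y) (\<gamma> * x + \<delta> * y) + s * P x y) = k"
  shows "\<exists>F. deformation f F \<and> generic_milnor F k"
proof -
  define \<Delta> where "\<Delta> = \<alpha> * \<delta> - \<beta> * \<gamma>"
  have \<Delta>: "\<Delta> \<noteq> 0" using det by (simp add: \<Delta>_def)
  define Q where "Q = (\<lambda>x y. P (\<delta> / \<Delta> * x + (- \<beta> / \<Delta>) * y) ((- \<gamma> / \<Delta>) * x + \<alpha> / \<Delta> * y))"
  have Q: "is_poly2 Q" unfolding Q_def using P(1) by (rule is_poly2_linear)
  have inv1: "\<delta> / \<Delta> * (\<alpha> * x + \<beta> * y) + - \<beta> / \<Delta> * (\<gamma> * x + \<delta> * y) = x" for x y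
    using \<Delta> by (simp add: field_simps) (simp add: \<Delta>_def algebra_simps)
  have inv2: "- \<gamma> / \<Delta> * (\<alpha> * x + \<beta> * y) + \<alpha> / \<Delta> * (\<gamma> * x + \<delta> * y) = y" for x y
    using \<Delta> by (simp add: field_simps) (simp add: \<Delta>_def algebra_simps)
  have "milnor (\<lambda>x y. f x y + s * Q x y) = k" if "s \<noteq> 0" for s
  proof -
    have "is_poly2 (\<lambda>x y. f x y + s * Q x y)" using f(1) Q by (intro is_poly2_add is_poly2_mult is_poly2_const)
    from milnor_linear[OF this det] show ?thesis using m[OF that] by (simp only: Q_def inv1 inv2)
  qed
  hence "generic_milnor (\<lambda>x y s. f x y + s * Q x y) k"
    unfolding generic_milnor_def by (auto simp: eventually_at_filter)
  moreover have "deformation f (\<lambda>x y s. f x y + s * Q x y)"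
    by (rule deformationI[OF f Q]) (simp add: Q_def P)
  ultimately show ?thesis by blast
qed

section \<open>Multiple factors and coordinates adapted to a form\<close>

lemma hform_eqI:
  assumes "\<And>i. i \<le> N \<Longrightarrow> coeff p i = c i" shows "hform N p x y = (\<Sum>i\<le>N. c i * x ^ i * y ^ (N - i))"
  unfolding hform_def using assms by simp

lemma ex_hform: "\<exists>p. degree p \<le> N \<and> (\<forall>i\<le>N. coeff p i = c i) \<and> (\<forall>x y. (\<Sum>i\<le>N. c i * x ^ i * y ^ (N - i)) = hform N p x y)"
proof -
  define p where "p = (\<Sum>i\<le>N. monom (c i) i)"
  have "coeff p i = (if i \<le> N then c i else 0)" for i
    by (auto simp: p_def coeff_sum)
  moreover from this have "degree p \<le> N" by (intro degree_le) auto
  ultimately show ?thesis using hform_eqI[of N p c] by (intro exI[of _ p]) auto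
qed

lemma hform_linear_mult:
  "\<exists>p'. degree p' \<le> Suc N \<and> (\<forall>x y. (\<alpha> * x + \<beta> * y) * hform N p x y = hform (Suc N) p' x y)"
proof -
  \<comment> \<open>The test \<open>i \<le> N\<close> keeps out a coefficient of \<open>p\<close>
    beyond \<open>N\<close>, which \<open>hform N p\<close> ignores.\<close>
  define c where "c = (\<lambda>i. (case i of 0 \<Rightarrow> 0 | Suc k \<Rightarrow> \<alpha> * coeff p k) + (if i \<le> N then \<beta> * coeff p i else 0))"
  obtain p' where p': "degree p' \<le> Suc N" "\<And>x y. (\<Sum>i\<le>Suc N. c i * x ^ i * y ^ (Suc N - i)) = hform (Suc N) p' x y"
    using ex_hform[of "Suc N" c] by auto
  have "(\<alpha> * x + \<beta> * y) * hform N p x y = (\<Sum>i\<le>Suc N. c i * x ^ i * y ^ (Suc N - i))" for x y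
  proof -
    have "(\<Sum>i\<le>Suc N. (case i of 0 \<Rightarrow> 0 | Suc k \<Rightarrow> \<alpha> * coeff p k) * x ^ i * y ^ (Suc N - i)) = \<alpha> * x * hform N p x y"
      unfolding sum.atMost_Suc_shift hform_def by (simp add: sum_distrib_left mult_ac)
    moreover have "(\<Sum>i\<le>Suc N. (if i \<le> N then \<beta> * coeff p i else 0) * x ^ i * y ^ (Suc N - i)) = \<beta> * y * hform N p x y"
      unfolding hform_def sum_distrib_left by (auto intro!: sum.cong simp: Suc_diff_le)
    ultimately show ?thesis by (simp add: c_def distrib_right sum.distrib del: sum.atMost_Suc)
  qed
  thus ?thesis using p' by metis
qed

lemma hform_linear:
  "\<exists>p'. degree p' \<le> N \<and> (\<forall>x y. hform N p (\<alpha> * x + \<beta> * y) (\<gamma> * x + \<delta> * y) = hform N p' x y)"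
proof -
  have pow: "\<exists>p'. \<forall>x y. (\<alpha> * x + \<beta> * y) ^ k * (\<gamma> * x + \<delta> * y) ^ l = hform (k + l) p' x y" for k l
  proof (induction k)
    case 0
    show ?case
    proof (induction l)
      case 0 show ?case by (rule exI[of _ 1]) (simp add: hform_def)
    next
      case (Suc l)
      then obtain p' where "\<forall>x y. (\<gamma> * x + \<delta> * y) ^ l = hform l p' x y" by auto
      thus ?case using hform_linear_mult[of l \<gamma> \<delta> p'] by auto
    qed
  next
    case (Suc k)
    then obtain p' where "\<forall>x y. (\<alpha> * x + \<beta> * y) ^ k * (\<gamma> * x + \<delta> * y) ^ l = hform (k + l) p' x y" by auto
    thus ?case using hform_linear_mult[of "k + l" \<alpha> \<beta> p'] by (auto simp: mult.assoc)
  qed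
  have "\<forall>i. \<exists>p'. i \<le> N \<longrightarrow> (\<forall>x y. (\<alpha> * x + \<beta> * y) ^ i * (\<gamma> * x + \<delta> * y) ^ (N - i) = hform N p' x y)"
  proof
    fix i show "\<exists>p'. i \<le> N \<longrightarrow> (\<forall>x y. (\<alpha> * x + \<beta> * y) ^ i * (\<gamma> * x + \<delta> * y) ^ (N - i) = hform N p' x y)"
      using pow[of i "N - i"] by (cases "i \<le> N") auto
  qed
  from choice[OF this] obtain h where
    h: "\<And>i x y. i \<le> N \<Longrightarrow> (\<alpha> * x + \<beta> * y) ^ i * (\<gamma> * x + \<delta> * y) ^ (N - i) = hform N (h i) x y" by blast
  define c where "c = (\<lambda>k. \<Sum>i\<le>N. coeff p i * coeff (h i) k)"
  obtain p' where p': "degree p' \<le> N" "\<And>x y. (\<Sum>k\<le>N. c k * x ^ k * y ^ (N - k)) = hform N p' x y"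
    using ex_hform[of N c] by auto
  have "hform N p (\<alpha> * x + \<beta> * y) (\<gamma> * x + \<delta> * y) = (\<Sum>k\<le>N. c k * x ^ k * y ^ (N - k))" for x y
  proof -
    have "hform N p (\<alpha> * x + \<beta> * y) (\<gamma> * x + \<delta> * y) = (\<Sum>i\<le>N. coeff p i * hform N (h i) x y)"
      unfolding hform_def[of N p] by (intro sum.cong refl) (simp add: h mult.assoc)
    also have "\<dots> = (\<Sum>k\<le>N. c k * x ^ k * y ^ (N - k))"
      unfolding hform_def c_def sum_distrib_left sum_distrib_right by (subst sum.swap) (simp add: mult_ac)
    finally show ?thesis .
  qed
  thus ?thesis using p' by metis
qed

lemma hform_lead: "hform N p 1 0 = coeff p N"
proof -
  have "hform N p 1 0 = (\<Sum>i\<le>N. if i = N then coeff p N else 0)" unfolding hform_def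
    by (intro sum.cong) (auto simp: power_0_left)
  thus ?thesis by simp
qed

lemma hform_dehomogenize: "degree p \<le> N \<Longrightarrow> hform N p x 1 = poly p x"
  unfolding hform_def poly_altdef by (simp add: sum.mono_neutral_right[of "{..N}" "{..degree p}"] coeff_eq_0)

lemma hform_Y_factor:
  assumes "coeff p (Suc N) = 0" shows "hform (Suc N) p x y = y * hform N p x y"
  using assms unfolding hform_def sum_distrib_left by (auto intro!: sum.cong simp: Suc_diff_le)

text \<open>The multiple-factor clause of \<open>homogeneous_singularity\<close>, isolated so that
  it can be moved between coordinate systems.\<close>

definition square_factor :: "(complex \<Rightarrow> complex \<Rightarrow> complex) \<Rightarrow> bool" where
  "square_factor f \<longleftrightarrow> (\<exists>g h. is_poly2 g \<and> is_poly2 h \<and> \<not> (\<exists>k. \<forall>x y. g x y = k) \<and>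
     (\<forall>x y. f x y = (g x y)\<^sup>2 * h x y))"

lemma square_factor_linear:
  assumes det: "\<alpha> * \<delta> - \<beta> * \<gamma> \<noteq> 0" and sf: "square_factor (\<lambda>x y. f (\<alpha> * x + \<beta> * y) (\<gamma> * x + \<delta> * y))"
  shows "square_factor f"
proof -
  define \<Delta> where "\<Delta> = \<alpha> * \<delta> - \<beta> * \<gamma>"
  have \<Delta>: "\<Delta> \<noteq> 0" using det by (simp add: \<Delta>_def)
  have i1: "\<alpha> * (\<delta> / \<Delta> * x + - \<beta> / \<Delta> * y) + \<beta> * (- \<gamma> / \<Delta> * x + \<alpha> / \<Delta> * y) = x" for x y
    using \<Delta> by (simp add: field_simps) (simp add: \<Delta>_def algebra_simps)
  have i2: "\<gamma> * (\<delta> / \<Delta> * x + - \<beta> / \<Delta> * y) + \<delta> * (- \<gamma> / \<Delta> * x + \<alpha> / \<Delta> * y) = y" for x y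
    using \<Delta> by (simp add: field_simps) (simp add: \<Delta>_def algebra_simps)
  have j1: "\<delta> / \<Delta> * (\<alpha> * x + \<beta> * y) + - \<beta> / \<Delta> * (\<gamma> * x + \<delta> * y) = x" for x y
    using \<Delta> by (simp add: field_simps) (simp add: \<Delta>_def algebra_simps)
  have j2: "- \<gamma> / \<Delta> * (\<alpha> * x + \<beta> * y) + \<alpha> / \<Delta> * (\<gamma> * x + \<delta> * y) = y" for x y
    using \<Delta> by (simp add: field_simps) (simp add: \<Delta>_def algebra_simps)
  from sf obtain g h where g: "is_poly2 g" "is_poly2 h" "\<not> (\<exists>k. \<forall>x y. g x y = k)"
    and eq: "\<And>x y. f (\<alpha> * x + \<beta> * y) (\<gamma> * x + \<delta> * y) = (g x y)\<^sup>2 * h x y" unfolding square_factor_def by auto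
  let ?g = "\<lambda>x y. g (\<delta> / \<Delta> * x + - \<beta> / \<Delta> * y) (- \<gamma> / \<Delta> * x + \<alpha> / \<Delta> * y)"
  let ?h = "\<lambda>x y. h (\<delta> / \<Delta> * x + - \<beta> / \<Delta> * y) (- \<gamma> / \<Delta> * x + \<alpha> / \<Delta> * y)"
  show ?thesis unfolding square_factor_def
  proof (rule exI[of _ ?g], rule exI[of _ ?h], intro conjI allI)
    show "is_poly2 ?g" by (rule is_poly2_linear[OF g(1)])
    show "is_poly2 ?h" by (rule is_poly2_linear[OF g(2)])
    show "f x y = (?g x y)\<^sup>2 * ?h x y" for x y
      using eq[of "\<delta> / \<Delta> * x + - \<beta> / \<Delta> * y" "- \<gamma> / \<Delta> * x + \<alpha> / \<Delta> * y"] unfolding i1 i2 .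
    show "\<not> (\<exists>k. \<forall>x y. ?g x y = k)"
    proof
      assume "\<exists>k. \<forall>x y. ?g x y = k"
      then obtain k where k: "\<And>x y. ?g x y = k" by blast
      have "g x y = k" for x y using k[of "\<alpha> * x + \<beta> * y" "\<gamma> * x + \<delta> * y"] unfolding j1 j2 .
      thus False using g(3) by blast
    qed
  qed
qed

lemma square_factor_Y:
  assumes "coeff p (Suc (Suc N)) = 0" "coeff p (Suc N) = 0" shows "square_factor (hform (Suc (Suc N)) p)"
  unfolding square_factor_def
proof (rule exI[of _ "\<lambda>x y. y"], rule exI[of _ "hform N p"], intro conjI allI)
  show "hform (Suc (Suc N)) p x y = y\<^sup>2 * hform N p x y" for x y
    using assms by (simp add: hform_Y_factor power2_eq_square)
  show "\<not> (\<exists>k. \<forall>(x::complex) y. y = (k::complex))" by (metis zero_neq_one)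
  show "is_poly2 (\<lambda>x y. y)" by (rule is_poly2_Y)
  show "is_poly2 (hform N p)" by (rule is_poly2_hform)
qed

lemma square_factor_double_root:
  assumes "degree q = d" "1 \<le> d" "poly q a = 0" "poly (pderiv q) a = 0" shows "square_factor (hform d q)"
proof -
  from assms obtain s where s: "q = [:-a, 1:] * s" unfolding poly_eq_0_iff_dvd by blast
  have "pderiv q = s + [:-a, 1:] * pderiv s" unfolding s pderiv_mult by (simp add: pderiv_pCons)
  hence "poly s a = 0" using assms(4) by simp
  then obtain r where r: "s = [:-a, 1:] * r" unfolding poly_eq_0_iff_dvd by blast
  have r0: "r \<noteq> 0" using assms s r by auto
  have ds: "degree s = Suc (degree r)" unfolding r using r0 by (subst degree_mult_eq) auto
  have "s \<noteq> 0" unfolding r mult_eq_0_iff using r0 by simp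
  hence "degree q = Suc (degree s)" unfolding s by (subst degree_mult_eq) auto
  hence d: "d = Suc (Suc (degree r))" using ds assms(1) by simp
  have eq: "hform d q x y = (x - a * y)\<^sup>2 * hform (degree r) r x y" for x y
    unfolding d s by (subst hform_mult_linear) (simp add: ds, unfold r, subst hform_mult_linear, simp_all add: power2_eq_square)
  show ?thesis unfolding square_factor_def
  proof (rule exI[of _ "\<lambda>x y. x - a * y"], rule exI[of _ "hform (degree r) r"], intro conjI allI)
    have "is_poly2 (\<lambda>x y. x + (- a) * y)"
      by (intro is_poly2_add is_poly2_mult is_poly2_const is_poly2_X is_poly2_Y)
    thus "is_poly2 (\<lambda>x y. x - a * y)" by simp
    show "\<not> (\<exists>k. \<forall>x y. x - a * y = k)"
    proof
      assume "\<exists>k. \<forall>x y. x - a * y = k"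
      then obtain k where k: "\<And>x y. x - a * y = k" by blast
      from k[of 0 0] k[of 1 0] show False by simp
    qed
  qed (use eq is_poly2_hform in auto)
qed

text \<open>A direction \<open>(t, 1)\<close> on which \<open>f\<close> does not vanish becomes the
  axis \<open>y = 0\<close>; the coefficient of \<open>x^d\<close> is the value of \<open>f\<close>
  there.\<close>

lemma homogeneous_coordinates:
  assumes "1 \<le> d" "homogeneous_singularity d f"
  obtains \<alpha> \<beta> \<gamma> \<delta> q where "\<alpha> * \<delta> - \<beta> * \<gamma> \<noteq> 0" "degree q = d"
    "\<And>x y. f (\<alpha> * x + \<beta> * y) (\<gamma> * x + \<delta> * y) = hform d q x y"
proof -
  from assms(2) obtain c where c: "\<exists>i\<le>d. c i \<noteq> 0" and f: "\<And>x y. f x y = (\<Sum>i\<le>d. c i * x ^ i * y ^ (d - i))"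
    unfolding homogeneous_singularity_def by blast
  obtain p where p: "degree p \<le> d" "\<And>i. i \<le> d \<Longrightarrow> coeff p i = c i" "\<And>x y. f x y = hform d p x y"
    using ex_hform[of d c] f by auto
  have "p \<noteq> 0" using c p(2) by auto
  then obtain t where t: "poly p t \<noteq> 0" using poly_all_0_iff_0 by blast
  obtain q where q: "degree q \<le> d" "\<And>x y. f (t * x + 1 * y) (1 * x + 0 * y) = hform d q x y"
    using hform_linear[of d p t 1 1 0] p(3) by auto
  have "coeff q d = hform d p t 1" using q(2)[of 1 0] p(3) by (simp add: hform_lead)
  also have "\<dots> \<noteq> 0" using t p(1) by (simp add: hform_dehomogenize)
  finally have "degree q = d" using q(1) by (intro antisym le_degree)
  thus ?thesis using q(2) by (intro that[of t 0 1 1 q]) auto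
qed

lemma nat_between_squares:
  fixes k :: nat
  assumes "k \<ge> 1" obtains m o' where "m \<ge> 2" "k = (m - 1)\<^sup>2 + o'" "o' \<le> 2 * m - 2"
proof -
  define m where "m = (LEAST m. k < m\<^sup>2)"
  have ex: "k < (k + 1)\<^sup>2" by (simp add: power2_eq_square)
  have m: "k < m\<^sup>2" unfolding m_def by (rule LeastI[of "\<lambda>m. k < m\<^sup>2", OF ex])
  have m2: "m \<ge> 2"
  proof (rule ccontr)
    assume "\<not> m \<ge> 2"
    hence "m\<^sup>2 \<le> 1\<^sup>2" by (intro power_mono) auto
    thus False using m assms by simp
  qed
  have "\<not> k < (m - 1)\<^sup>2" using m2 not_less_Least[of "m - 1" "\<lambda>m. k < m\<^sup>2"] by (auto simp: m_def)
  moreover have "m\<^sup>2 = (m - 1)\<^sup>2 + (2 * m - 1)" using m2 by (cases m) (auto simp: power2_eq_square)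
  ultimately show ?thesis using m m2 by (intro that[of m "k - (m - 1)\<^sup>2"]) auto
qed

lemma milnor_smooth:
  assumes "s \<noteq> 0" "2 \<le> d" shows "milnor (\<lambda>x y. hform d q x y + s * x) = enat 0"
proof -
  define G where "G = ghom d q + gconst s * gX"
  have G: "drep G (\<lambda>x y. hform d q x y + s * x)"
    unfolding G_def by (intro drep_add drep_mult drep_const drep_ghom drep_X)
  have "isect (dX G * 1) (dY G) 0"
    using assms by (subst isect_unit_mult) (auto simp: G_def cf_ghom isect_unit)
  thus ?thesis using milnor_drep[OF G] by simp
qed

theorem theorem2:
  fixes d :: nat and f0 :: "complex \<Rightarrow> complex \<Rightarrow> complex"
  assumes "d \<ge> 3" and "homogeneous_singularity d f0"
  shows "milnor f0 = enat ((d - 1)^2) \<and>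
         (\<forall>k::nat. k \<le> (d - 1) * (d - 2) + 1 \<longrightarrow>
            (\<exists>F. deformation f0 F \<and> generic_milnor F (enat k)))"
proof -
  from assms obtain \<alpha> \<beta> \<gamma> \<delta> q where det: "\<alpha> * \<delta> - \<beta> * \<gamma> \<noteq> 0" and q: "degree q = d"
    and fq: "\<And>x y. f0 (\<alpha> * x + \<beta> * y) (\<gamma> * x + \<delta> * y) = hform d q x y"
    by (auto elim!: homogeneous_coordinates[of d f0, rotated])
  from assms(2) obtain c where f0: "\<And>x y. f0 x y = (\<Sum>i\<le>d. c i * x ^ i * y ^ (d - i))"
    unfolding homogeneous_singularity_def by blast
  have poly_f0: "is_poly2 f0" unfolding f0[abs_def] by (intro is_poly2_sum is_poly2_monom)
  have f00: "f0 0 0 = 0" using assms(1) unfolding f0 by (intro sum.neutral) (auto simp: power_0_left)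
  have sf: "\<not> square_factor f0"
    using assms(2) unfolding homogeneous_singularity_def square_factor_def by blast
  have lead: "coeff q d \<noteq> 0" using q assms(1) by (metis leading_coeff_0_iff degree_0 not_numeral_le_zero)
  note realize = generic_milnor_by_coordinates[OF poly_f0 f00]

  have mu: "milnor f0 = enat ((d - 1)\<^sup>2)"
  proof -
    have "poly (pderiv q) a \<noteq> 0" if "poly q a = 0" for a
    proof
      assume "poly (pderiv q) a = 0"
      hence "square_factor (hform d q)" using q that assms(1) by (intro square_factor_double_root) auto
      hence "square_factor (\<lambda>x y. f0 (\<alpha> * x + \<beta> * y) (\<gamma> * x + \<delta> * y))" by (simp add: fq)
      thus False using square_factor_linear[OF det] sf by blast
    qed
    hence "milnor (hform d q) = enat ((d - 1)\<^sup>2)" using q assms(1) by (intro milnor_hform) auto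
    thus ?thesis using milnor_linear[OF poly_f0 det] by (simp add: fq)
  qed

  obtain z where z: "poly q z = 0"
    using fundamental_theorem_of_algebra[of q] constant_degree[of q] q assms(1) by auto
  \<comment> \<open>The vector \<open>(\<alpha>', \<gamma>')\<close> spans the line of
    \<open>f0\<close> given by the root \<open>z\<close>; it becomes the axis \<open>y = 0\<close>
    of the second coordinate system.\<close>
  define \<alpha>' where "\<alpha>' = \<alpha> * z + \<beta>"
  define \<gamma>' where "\<gamma>' = \<gamma> * z + \<delta>"
  have det': "\<alpha>' * \<gamma> - \<alpha> * \<gamma>' \<noteq> 0" using det by (simp add: \<alpha>'_def \<gamma>'_def algebra_simps)
  obtain p where p: "\<And>x y. f0 (\<alpha>' * x + \<alpha> * y) (\<gamma>' * x + \<gamma> * y) = hform d p x y"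
  proof -
    obtain p0 where "\<And>x y. f0 x y = hform d p0 x y" using ex_hform[of d c] f0 by auto
    thus ?thesis using hform_linear[of d p0 \<alpha>' \<alpha> \<gamma>' \<gamma>] that by metis
  qed
  have pd: "coeff p d = 0"
  proof -
    have "coeff p d = f0 (\<alpha> * z + \<beta> * 1) (\<gamma> * z + \<delta> * 1)"
      using p[of 1 0] by (simp add: hform_lead \<alpha>'_def \<gamma>'_def)
    thus ?thesis unfolding fq using z q by (simp add: hform_dehomogenize)
  qed
  \<comment> \<open>The cofactor of y contains \<open>x^(d-1)\<close>, since otherwise the square of
    y would divide \<open>f0\<close>.\<close>
  have pd1: "coeff p (d - 1) \<noteq> 0"
  proof
    assume "coeff p (d - 1) = 0"
    moreover have "Suc (Suc (d - 2)) = d" "Suc (d - 2) = d - 1" using assms(1) by auto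
    ultimately have "square_factor (hform d p)" using square_factor_Y[of p "d - 2"] pd by simp
    hence "square_factor (\<lambda>x y. f0 (\<alpha>' * x + \<alpha> * y) (\<gamma>' * x + \<gamma> * y))" by (simp add: p)
    thus False using square_factor_linear[OF det'] sf by blast
  qed
  have fp: "f0 (\<alpha>' * x + \<alpha> * y) (\<gamma>' * x + \<gamma> * y) = y * hform (d - 1) p x y" for x y
    unfolding p using hform_Y_factor[of p "d - 1"] pd assms(1) by simp

  have K0: "\<exists>F. deformation f0 F \<and> generic_milnor F (enat k)"
    if "is_poly2 P" "P 0 0 = 0" "\<And>s. s \<noteq> 0 \<Longrightarrow> milnor (\<lambda>x y. hform d q x y + s * P x y) = enat k" for P k
    using realize[OF that(1,2) det] that(3) by (simp add: fq)
  \<comment> \<open>Here the perturbation is \<open>y * P\<close>, so the whole deformation keeps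
    the factor y.\<close>
  have K1: "\<exists>F. deformation f0 F \<and> generic_milnor F (enat k)"
    if P: "is_poly2 P" and k: "\<And>s. s \<noteq> 0 \<Longrightarrow> milnor (\<lambda>x y. y * (hform (d - 1) p x y + s * P x y)) = enat k" for P k
    using realize[OF is_poly2_mult[OF is_poly2_Y P] _ det'] k by (simp add: fp distrib_left mult.left_commute)

  have "\<exists>F. deformation f0 F \<and> generic_milnor F (enat k)" if k: "k \<le> (d - 1) * (d - 2) + 1" for k
  proof (cases "k = 0")
    case True
    show ?thesis using milnor_smooth[of _ d q] assms(1) True by (intro K0[of "\<lambda>x y. x"]) (auto intro: is_poly2_X)
  next
    case False
    then obtain m t where m: "m \<ge> 2" "k = (m - 1)\<^sup>2 + t" "t \<le> 2 * m - 2" using nat_between_squares[of k] by auto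
    obtain D where D: "d = D + 3" using assms(1) by (metis add.commute le_Suc_ex)
    obtain M where M: "m = M + 2" using m(1) by (metis add.commute le_Suc_ex)
    \<comment> \<open>With \<open>D = d - 3\<close> and \<open>M = m - 2\<close>, the bound on
      \<open>k\<close> is split as \<open>(d - 2)\<^sup>2 + (d - 1)\<close>; comparing squares gives
      \<open>m \<le> d - 1\<close>.\<close>
    have bound: "(M + 1)\<^sup>2 + t \<le> (D + 1)\<^sup>2 + (D + 2)"
      using k m(2) by (simp add: D M power2_eq_square algebra_simps)
    have "M \<le> D"
    proof (rule ccontr)
      assume "\<not> M \<le> D"
      hence "(D + 2)\<^sup>2 \<le> (M + 1)\<^sup>2" by (intro power_mono) auto
      thus False using bound by (simp add: power2_eq_square algebra_simps)
    qed
    consider "t \<le> M" | "t = M + 1" | "t = M + 2" | "M + 3 \<le> t" by linarith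
    thus ?thesis
    proof cases
      case 1
      then obtain r where r: "M = t + r" using le_Suc_ex by blast
      have num: "m * ((r + 1) - 1) + (t + 1) * (m + 1) - ((m + 1) - 1) = k"
        unfolding m(2) M r by (simp add: power2_eq_square algebra_simps)
      have "milnor (\<lambda>x y. hform d q x y + s * perturb 1 m (r + 1) (t + 1) (m + 1) d x y) = enat k" if "s \<noteq> 0" for s
        using milnor_two_edges(1)[of q d s m "m + 1" "r + 1" "t + 1"] lead that \<open>M \<le> D\<close>
        unfolding num by (simp add: M r D)
      thus ?thesis by (rule K0[OF is_poly2_perturb, rotated]) (auto simp: perturb_def M)
    next
      case 2
      have num: "(m - 1) * ((m + 1) - 1) = k"
        unfolding m(2) M 2 by (simp add: power2_eq_square algebra_simps)
      have "milnor (\<lambda>x y. hform d q x y + s * perturb 0 m 0 0 (m + 1) d x y) = enat k" if "s \<noteq> 0" for s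
        using milnor_one_edge(1)[of q d s m "m + 1"] lead that \<open>M \<le> D\<close>
        unfolding num by (simp add: M D)
      thus ?thesis by (rule K0[OF is_poly2_perturb, rotated]) (auto simp: perturb_def M)
    next
      case 3
      have num: "m + (m - 1) * (m - 1) = k"
        unfolding m(2) M 3 by (simp add: power2_eq_square algebra_simps)
      have "milnor (\<lambda>x y. y * (hform (d - 1) p x y + s * perturb 0 (m - 1) 0 0 m (d - 1) x y)) = enat k" if "s \<noteq> 0" for s
        using milnor_one_edge(2)[of p "d - 1" s "m - 1" m] pd1 that \<open>M \<le> D\<close>
        unfolding num by (simp add: M D)
      thus ?thesis by (rule K1[OF is_poly2_perturb])
    next
      case 4
      obtain j where j: "t = M + 3 + j" using 4 le_Suc_ex by blast
      have "j + 1 \<le> M" using m(3) by (simp add: j M)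
      then obtain i where i: "M = j + 1 + i" using le_Suc_ex by blast
      \<comment> \<open>The cofactor of y must reach degree \<open>m + 1\<close>, hence
        \<open>m \<le> d - 2\<close>. For \<open>m = d - 1\<close> the bound allows only
        \<open>t \<le> m\<close>.\<close>
      have "M + 1 \<le> D"
      proof (rule ccontr)
        assume "\<not> M + 1 \<le> D"
        hence "M = D" using \<open>M \<le> D\<close> by simp
        thus False using bound 4 by simp
      qed
      have num: "(m + 1) + (m * ((i + 1) - 1) + (j + 1) * (m + 1)) = k"
        unfolding m(2) M j i by (simp add: power2_eq_square algebra_simps)
      have "milnor (\<lambda>x y. y * (hform (d - 1) p x y + s * perturb 1 m (i + 1) (j + 1) (m + 1) (d - 1) x y)) = enat k" if "s \<noteq> 0" for s
        using milnor_two_edges(2)[of p "d - 1" s m "m + 1" "i + 1" "j + 1"] pd1 that \<open>M + 1 \<le> D\<close>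
        unfolding num by (simp add: M D i)
      thus ?thesis by (rule K1[OF is_poly2_perturb])
    qed
  qed
  thus ?thesis using mu by blast
qed

end
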